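(* Let $\nu$ be an uncountable cardinal and let $P$ be a poset with no infinite antichain. (1) If $\nu$ is a successor cardinal, i.e. $\nu=\kappa^+$, then $\operatorname{Cov}(P)\geq \nu$ if and only if $P$ contains either a copy of $[\nu]^2$ or a copy of its dual. (2) If $\nu$ is a limit cardinal, then $\operatorname{Cov}(P)\geq \nu$ if and only if $P$ contains a copy of a poset $Q$, or of its dual, where $Q$ is of the form $\sum_{\alpha\in C}Q_{\alpha}$ with $C$ a chain of cardinality $\operatorname{cf}(\nu)$, $Q_{\alpha}:=[\kappa_{\alpha}^+]^2$ for $\alpha\in C$, and $(\kappa_{\alpha}^+)_{\alpha\in C}$ a family of distinct cardinals, all less than $\nu$, such that $\bigvee\{\kappa_{\alpha}^+ : \alpha\in C\}=\nu$.
   Context: The chain covering number $\operatorname{Cov}(P)$ of a poset $P$ is the least cardinal number of chains needed to cover the underlying set of $P$. A poset $P$ contains a copy of a poset $R$ if $R$ is isomorphic to the poset induced by $P$ on some subset. The dual $P^*$ of $P$ is the same set with the opposite order. For an infinite ordinal $\nu$, $[\nu]^2:=\{(\alpha,\beta):\alpha<\beta<\nu\}$ is ordered by $(\alpha,\beta)\leq(\alpha',\beta')$ iff $\alpha\leq\alpha'$ and $\beta\leq\beta'$. The notation $\kappa^+$ is the successor cardinal of $\kappa$ (in the posets $[\kappa_\alpha^+]^2$ it is infinite), $\operatorname{cf}(\nu)$ is the cofinality of $\nu$, and $\bigvee$ denotes the supremum of a set of cardinals. For a chain $C$ and posets $Q_\alpha$ ($\alpha\in C$), $\sum_{\alpha\in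 C}Q_\alpha$ is the lexicographical sum: the disjoint union of the $Q_\alpha$, where $x\in Q_\alpha$ is below $y\in Q_\beta$ iff either $\alpha<\beta$ in $C$, or $\alpha=\beta$ and $x\leq y$ in $Q_\alpha$. *)

theory Defs
  imports Main "HOL-Library.Countable_Set"
begin

unbundle cardinal_syntax

text \<open>
  A poset is a relation satisfying \<open>Partial_order\<close>; its underlying set is its \<open>Field\<close> and its
  dual is its converse. Cardinals are the relations satisfying \<open>Card_order\<close>, i.e. initial
  ordinals, compared across types by \<open>\<le>o\<close>, \<open><o\<close>, \<open>=o\<close>.

  Several definitions below quantify over cardinals (or chains) on the same type \<open>'b\<close> as a given
  cardinal \<open>\<nu>\<close>. Only objects of size at most \<open>\<nu>\<close> matter there, and each of these has an
  isomorphic representative on a subset of \<open>Field \<nu>\<close>, so this is no restriction.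
\<close>

definition no_infinite_antichain :: "'a rel \<Rightarrow> bool" where
  "no_infinite_antichain P \<longleftrightarrow>
     \<not> (\<exists>A \<subseteq> Field P. infinite A \<and> (\<forall>x\<in>A. \<forall>y\<in>A. x \<noteq> y \<longrightarrow> (x, y) \<notin> P))"

text \<open>
  The least element of a set of cardinals. The choice is determined up to \<open>=o\<close>.
\<close>

definition least_cardinal :: "'a rel set \<Rightarrow> 'a rel" where
  "least_cardinal K = (SOME c. c \<in> K \<and> (\<forall>d\<in>K. c \<le>o d))"

lemma least_cardinal:
  assumes "K \<noteq> {}" and "\<forall>c\<in>K. Card_order c"
  shows "least_cardinal K \<in> K" and "\<forall>d\<in>K. least_cardinal K \<le>o d"
proof -
  have "\<exists>c. c \<in> K \<and> (\<forall>d\<in>K. c \<le>o d)"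
    using exists_minim_Card_order[OF assms] by blast
  from someI_ex[OF this]
  show "least_cardinal K \<in> K" and "\<forall>d\<in>K. least_cardinal K \<le>o d"
    by (auto simp: least_cardinal_def)
qed

definition chain_covers :: "'a rel \<Rightarrow> 'a set set set" where
  "chain_covers P = {\<C>. \<C> \<subseteq> Chains P \<and> \<Union>\<C> = Field P}"

definition Cov :: "'a rel \<Rightarrow> 'a set rel" where
  "Cov P = least_cardinal {|\<C>| | \<C>. \<C> \<in> chain_covers P}"

lemma singletons_chain_cover:
  assumes "Partial_order P"
  shows "(\<lambda>x. {x}) ` Field P \<in> chain_covers P"
  using assms by (auto simp: chain_covers_def Chains_def order_on_defs refl_on_def)

lemma Cov:
  assumes "Partial_order P"
  shows "\<exists>\<C> \<in> chain_covers P. Cov P = |\<C>|"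
    and "\<C> \<in> chain_covers P \<Longrightarrow> Cov P \<le>o |\<C>|"
proof -
  let ?K = "{|\<C>| | \<C>. \<C> \<in> chain_covers P}"
  have "?K \<noteq> {}" "\<forall>c\<in>?K. Card_order c"
    using singletons_chain_cover[OF assms] by (auto simp: card_of_Card_order)
  from least_cardinal[OF this]
  show "\<exists>\<C> \<in> chain_covers P. Cov P = |\<C>|"
    and "\<C> \<in> chain_covers P \<Longrightarrow> Cov P \<le>o |\<C>|"
    unfolding Cov_def by blast+
qed

text \<open>
  Despite its place in the theory of well-order embeddings, \<open>iso\<close> is ordinary order
  isomorphism for arbitrary relations, see \<open>iso_iff2\<close>.
\<close>

definition contains_copy :: "'a rel \<Rightarrow> 'c rel \<Rightarrow> bool" where
  "contains_copy P R \<longleftrightarrow> (\<exists>S \<subseteq> Field P. \<exists>f. iso R (Restr P S) f)"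

text \<open>
  The poset \<open>[\<nu>]\<^sup>2\<close>, for a well-order \<open>\<nu>\<close> whose field plays the role of the set of ordinals
  below \<open>\<nu>\<close>.
\<close>

definition pairs_poset :: "'b rel \<Rightarrow> ('b \<times> 'b) rel" where
  "pairs_poset \<nu> =
     {((a, b), (a', b')) | a b a' b'.
        (a, b) \<in> \<nu> - Id \<and> (a', b') \<in> \<nu> - Id \<and> (a, a') \<in> \<nu> \<and> (b, b') \<in> \<nu>}"

definition lex_sum :: "'i rel \<Rightarrow> ('i \<Rightarrow> 'c rel) \<Rightarrow> ('i \<times> 'c) rel" where
  "lex_sum C Q =
     {((i, x), (j, y)) | i x j y.
        i \<in> Field C \<and> j \<in> Field C \<and> x \<in> Field (Q i) \<and> y \<in> Field (Q j) \<and>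
        ((i, j) \<in> C - Id \<or> (i = j \<and> (x, y) \<in> Q i))}"

definition successor_cardinal :: "'b rel \<Rightarrow> bool" where
  "successor_cardinal \<nu> \<longleftrightarrow>
     Card_order \<nu> \<and> (\<exists>\<kappa> :: 'b rel. Card_order \<kappa> \<and> \<nu> =o cardSuc \<kappa>)"

definition limit_cardinal :: "'b rel \<Rightarrow> bool" where
  "limit_cardinal \<nu> \<longleftrightarrow> Card_order \<nu> \<and> Field \<nu> \<noteq> {} \<and> \<not> successor_cardinal \<nu>"

text \<open>
  The library's \<open>cofinal\<close> asks for strictly larger elements. On a limit ordinal, in particular on
  an infinite cardinal, this is the same as being unbounded.
\<close>

definition cofinality :: "'b rel \<Rightarrow> 'b rel" where
  "cofinality \<nu> = least_cardinal {|A| | A. A \<subseteq> Field \<nu> \<and> cofinal A \<nu>}"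

definition is_cardinal_Sup :: "'c rel set \<Rightarrow> 'b rel \<Rightarrow> bool" where
  "is_cardinal_Sup K \<nu> \<longleftrightarrow>
     Card_order \<nu> \<and> (\<forall>\<kappa>\<in>K. \<kappa> \<le>o \<nu>) \<and>
     (\<forall>\<mu> :: 'b rel. Card_order \<mu> \<and> (\<forall>\<kappa>\<in>K. \<kappa> \<le>o \<mu>) \<longrightarrow> \<nu> \<le>o \<mu>)"

text \<open>
  The index chain \<open>C\<close> is an arbitrary linear order, not necessarily a well-order. The
  infinity condition matters because \<open>cardSuc\<close> of a finite cardinal is finite.
\<close>

definition limit_index_data :: "'b rel \<Rightarrow> 'b rel \<Rightarrow> ('b \<Rightarrow> 'b rel) \<Rightarrow> bool" where
  "limit_index_data \<nu> C \<kappa> \<longleftrightarrow>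
     Linear_order C \<and> |Field C| =o cofinality \<nu> \<and>
     (\<forall>\<alpha>\<in>Field C. Card_order (\<kappa> \<alpha>) \<and> infinite (Field (cardSuc (\<kappa> \<alpha>))) \<and> cardSuc (\<kappa> \<alpha>) <o \<nu>) \<and>
     (\<forall>\<alpha>\<in>Field C. \<forall>\<beta>\<in>Field C. \<alpha> \<noteq> \<beta> \<longrightarrow> \<not> cardSuc (\<kappa> \<alpha>) =o cardSuc (\<kappa> \<beta>)) \<and>
     is_cardinal_Sup ((\<lambda>\<alpha>. cardSuc (\<kappa> \<alpha>)) ` Field C) \<nu>"

end

theory Submission
  imports Defs
begin

text \<open>
  Since there is no infinite antichain, a set that is not covered by fewer than \<open>\<nu>\<close> chains can be
  shrunk until the elements incomparable to any given one are covered by fewer than \<open>\<nu>\<close> chains.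
  Then \<open>x\<close> and \<open>y\<close> being near, in the sense that the elements between them are covered by fewer than
  \<open>\<nu>\<close> chains, is an equivalence relation whose classes are ordered linearly. If some class is not
  covered by fewer than \<open>\<nu>\<close> chains, it contains, up to duality, such a set \<open>Q\<close> in which the
  complement of each principal up-set \<open>\<up>x\<close> is covered by fewer than \<open>\<nu>\<close> chains.

  If \<open>\<nu>\<close> is a successor, some class is of this kind, and in \<open>Q\<close> one can repeatedly remove the
  down-closure of a chain that is unbounded in what remains. This gives chains \<open>K \<xi>\<close> for \<open>\<xi> < \<nu>\<close>, none
  of whose elements lies below an element of an earlier chain. By the Dushnik-Miller theorem, the
  absence of infinite antichains allows us to assume that each chain is dominated by all later ones,
  and a copy of \<open>[\<nu>]\<^sup>2\<close> can be chosen in their union.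

  If \<open>\<nu>\<close> is a limit, either the classes themselves, or intervals of \<open>Q\<close> built along a cofinal
  sequence, form a chain of blocks whose cover numbers are cofinal in \<open>\<nu>\<close>, and the successor case
  applies inside the blocks.
\<close>

subsection \<open>Cardinal arithmetic and covers by few chains\<close>

text \<open>The obstacle is a singular \<nu>, where a union of fewer than \<nu> thin sets need not
  be thin. Two devices make up for regularity. A union of fewer than \<nu> sets is harmless when one
  cardinal below \<nu> bounds all their cover numbers; such bounds appear as
  \<open>thin P (cardSuc |C| )\<close>, which means that at most |C| chains suffice. And blocks
  whose elements are comparable across blocks can share their colours, so that the number of blocks
  is irrelevant. The second device explains the role of the near classes: if the whole set has a
  large cover number, then the classes cannot have a common small bound. For a successor \<nu> all
  thin sets do have a common bound, so a single class is already large; for a limit \<nu> the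
  classes may all be thin with cover numbers cofinal in \<nu>, which is why the limit case has two
  sources of blocks.\<close>

lemma finite_ordLess_Cinfinite:
  assumes "finite A" "Cinfinite \<nu>" shows "|A| <o \<nu>"
  using assms finite_ordLess_infinite[of "|A|" \<nu>]
  by (simp add: cinfinite_def card_of_well_order_on card_order_on_well_order_on Field_card_of)

lemma card_of_ordLess_cardSuc_iff: "Card_order \<kappa> \<Longrightarrow> |A| <o cardSuc \<kappa> \<longleftrightarrow> |A| \<le>o \<kappa>"
  by (rule cardSuc_ordLeq_ordLess) (simp_all add: card_of_Card_order)

text \<open>Both factors embed into their disjoint sum, which is still below \<nu> and, if infinite,
  absorbs its square. This covers singular \<nu> as well.\<close>

lemma card_of_Times_ordLess_infinite:
  assumes "Cinfinite \<nu>" and A: "|A| <o \<nu>" and B: "|B| <o \<nu>"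
  shows "|A \<times> B| <o \<nu>"
proof -
  define D where "D = A <+> B"
  have D: "|D| <o \<nu>" using assms unfolding D_def
    by (auto simp: cinfinite_def intro: card_of_Plus_ordLess_infinite_Field)
  have AD: "|A| \<le>o |D|" "|B| \<le>o |D|" unfolding D_def
    by (simp_all add: card_of_Plus1 card_of_Plus2)
  show ?thesis
  proof (cases "finite D")
    case True
    then have "finite (A \<times> B)" unfolding D_def by auto
    then show ?thesis using assms(1) by (rule finite_ordLess_Cinfinite)
  next
    case False
    then have "|A \<times> B| \<le>o |D|"
      using card_of_Times_ordLeq_infinite_Field[of "|D|" A B] AD
      by (simp add: Field_card_of card_of_card_order_on)
    then show ?thesis using D ordLeq_ordLess_trans by blast
  qed
qed

lemma exists_cofinal_card_eq_cofinality:
  assumes "Cinfinite \<nu>"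
  obtains A where "A \<subseteq> Field \<nu>" "cofinal A \<nu>" "cofinality \<nu> = |A|"
proof -
  let ?K = "{|A| | A. A \<subseteq> Field \<nu> \<and> cofinal A \<nu>}"
  have "cofinal (Field \<nu>) \<nu>" using assms infinite_Card_order_limit[of \<nu>]
    unfolding cofinal_def cinfinite_def by blast
  then have "?K \<noteq> {}" "\<forall>c\<in>?K. Card_order c" by (auto simp: card_of_Card_order)
  from least_cardinal(1)[OF this] show thesis using that unfolding cofinality_def by auto
qed

lemma cofinality_le:
  assumes "A \<subseteq> Field \<nu>" "cofinal A \<nu>"
  shows "cofinality \<nu> \<le>o |A|"
proof -
  let ?K = "{|A| | A. A \<subseteq> Field \<nu> \<and> cofinal A \<nu>}"
  have "?K \<noteq> {}" "\<forall>c\<in>?K. Card_order c" using assms by (auto simp: card_of_Card_order)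
  from least_cardinal(2)[OF this] show ?thesis using assms unfolding cofinality_def by auto
qed

lemma cofinality_le_self:
  assumes "Cinfinite \<nu>" shows "cofinality \<nu> \<le>o \<nu>"
proof -
  obtain A where A: "A \<subseteq> Field \<nu>" "cofinality \<nu> = |A|"
    using exists_cofinal_card_eq_cofinality[OF assms] by metis
  have "|A| \<le>o |Field \<nu>|" using A by (simp add: card_of_mono1)
  then show ?thesis using A assms card_of_Field_ordIso ordLeq_ordIso_trans by metis
qed

lemma regular_le_cofinality:
  assumes "Cinfinite \<nu>" "regularCard \<nu>" shows "\<nu> \<le>o cofinality \<nu>"
proof -
  obtain A where "A \<subseteq> Field \<nu>" "cofinal A \<nu>" "cofinality \<nu> = |A|"
    using exists_cofinal_card_eq_cofinality[OF assms(1)] by metis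
  then show ?thesis using assms(2) unfolding regularCard_def
    using ordIso_symmetric[of "|A|" \<nu>] ordIso_imp_ordLeq by auto
qed

lemma bounded_of_less_cofinality:
  assumes \<nu>: "Cinfinite \<nu>" and I: "|I| <o cofinality \<nu>" and c: "\<And>i. i \<in> I \<Longrightarrow> c i \<in> Field \<nu>"
  shows "\<exists>b\<in>Field \<nu>. \<forall>i\<in>I. (c i, b) \<in> \<nu>"
proof -
  have "|c ` I| <o cofinality \<nu>" using I card_of_image ordLeq_ordLess_trans by blast
  then have "\<not> cofinal (c ` I) \<nu>" using cofinality_le[of "c ` I" \<nu>] c not_ordLess_ordLeq by blast
  then obtain b where b: "b \<in> Field \<nu>" "\<And>i. i \<in> I \<Longrightarrow> b = c i \<or> (b, c i) \<notin> \<nu>"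
    unfolding cofinal_def by auto
  have "wo_rel \<nu>" using \<nu> unfolding wo_rel_def by (simp add: card_order_on_well_order_on)
  then have "\<forall>i\<in>I. (c i, b) \<in> \<nu>" using b c wo_rel.TOTALS wo_rel.REFL refl_onD by metis
  with b show ?thesis by blast
qed

text \<open>A smaller cardinal is isomorphic to a proper initial segment of \<nu>. Thus bounds below
  \<nu> are handled as elements \<open>c\<close> of \<open>Field \<nu>\<close>, and
  \<open>|underS \<nu> c|\<close> is a representative on the type of \<nu>.\<close>

lemma ordLess_imp_ordLeq_underS:
  assumes \<nu>: "Card_order \<nu>" and X: "|X| <o \<nu>"
  shows "\<exists>c\<in>Field \<nu>. |X| \<le>o |underS \<nu> c|"
proof -
  have wo: "Well_order \<nu>" using \<nu> by (simp add: card_order_on_well_order_on)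
  obtain c where c: "c \<in> Field \<nu>" "|X| =o Restr \<nu> (underS \<nu> c)"
    using X ordLess_iff_ordIso_Restr[OF wo card_of_Well_order] by blast
  have "Field (Restr \<nu> (underS \<nu> c)) = underS \<nu> c"
    using wo by (simp add: wo_rel_def wo_rel.underS_ofilter Field_Restr_ofilter)
  moreover have "Card_order (Restr \<nu> (underS \<nu> c))"
    using c(2) Card_order_ordIso2 card_of_Card_order by blast
  ultimately have "Restr \<nu> (underS \<nu> c) =o |underS \<nu> c|"
    using card_of_Field_ordIso ordIso_symmetric by metis
  then show ?thesis using c ordIso_transitive ordIso_imp_ordLeq by blast
qed

lemma cardinalities_bounded_of_less_cofinality:
  assumes \<nu>: "Cinfinite \<nu>" and I: "|I| <o cofinality \<nu>" and A: "\<And>i. i \<in> I \<Longrightarrow> |A i| <o \<nu>"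
  shows "\<exists>c\<in>Field \<nu>. \<forall>i\<in>I. |A i| \<le>o |underS \<nu> c|"
proof -
  have "\<forall>i\<in>I. \<exists>c\<in>Field \<nu>. |A i| \<le>o |underS \<nu> c|"
    using A \<nu> ordLess_imp_ordLeq_underS by blast
  then obtain d where d: "\<forall>i\<in>I. d i \<in> Field \<nu> \<and> |A i| \<le>o |underS \<nu> (d i)|" by metis
  obtain b where b: "b \<in> Field \<nu>" "\<forall>i\<in>I. (d i, b) \<in> \<nu>"
    using bounded_of_less_cofinality[OF \<nu> I, of d] d by blast
  have po: "trans \<nu>" "antisym \<nu>" using \<nu>
    by (auto simp: card_order_on_def well_order_on_def linear_order_on_def partial_order_on_def preorder_on_def)
  have "\<forall>i\<in>I. underS \<nu> (d i) \<subseteq> underS \<nu> b"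
    using b(2) po unfolding underS_def trans_def antisym_def by blast
  then show ?thesis using d b card_of_mono1 ordLeq_transitive by metis
qed

lemma card_of_UNION_less_cofinality:
  assumes \<nu>: "Cinfinite \<nu>" and I: "|I| <o cofinality \<nu>" and A: "\<And>i. i \<in> I \<Longrightarrow> |A i| <o \<nu>"
  shows "|\<Union>i\<in>I. A i| <o \<nu>"
proof -
  obtain c where c: "c \<in> Field \<nu>" "\<forall>i\<in>I. |A i| \<le>o |underS \<nu> c|"
    using cardinalities_bounded_of_less_cofinality[of \<nu> I A, OF \<nu> I A] by blast
  have "|SIGMA i:I. A i| \<le>o |I \<times> underS \<nu> c|" using c(2) by (rule card_of_Sigma_mono1)
  moreover have "|I \<times> underS \<nu> c| <o \<nu>"
  proof (rule card_of_Times_ordLess_infinite[OF \<nu>])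
    show "|I| <o \<nu>" by (rule ordLess_ordLeq_trans[OF I cofinality_le_self[OF \<nu>]])
    show "|underS \<nu> c| <o \<nu>" using \<nu> c(1) by (simp add: card_of_underS)
  qed
  ultimately show ?thesis using card_of_UNION_Sigma ordLeq_ordLess_trans ordLeq_transitive by metis
qed

text \<open>
  A set is \<open>thin\<close> if fewer than \<open>\<nu>\<close> chains cover it. The cover is given as a colouring; that the
  colours are elements of the poset itself is no restriction, by \<open>thinI\<close> below.
\<close>

definition thin :: "'a rel \<Rightarrow> 'k rel \<Rightarrow> 'a set \<Rightarrow> bool" where
  "thin P \<nu> S \<longleftrightarrow>
     (\<exists>f :: 'a \<Rightarrow> 'a. |f ` S| <o \<nu> \<and> (\<forall>x\<in>S. \<forall>y\<in>S. f x = f y \<longrightarrow> (x, y) \<in> P \<or> (y, x) \<in> P))"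

lemma thinI:
  fixes g :: "'a \<Rightarrow> 'c"
  assumes g: "|g ` S| <o \<nu>"
    and comp: "\<And>x y. x \<in> S \<Longrightarrow> y \<in> S \<Longrightarrow> g x = g y \<Longrightarrow> (x, y) \<in> P \<or> (y, x) \<in> P"
  shows "thin P \<nu> S"
proof -
  \<comment> \<open>A colour is renamed to a chosen element of its colour class.\<close>
  define f where "f = (\<lambda>x. inv_into S g (g x))"
  have "f ` S = inv_into S g ` (g ` S)" by (auto simp: f_def)
  then have "|f ` S| <o \<nu>" using g card_of_image ordLeq_ordLess_trans by metis
  moreover have "g x = g y" if "x \<in> S" "y \<in> S" "f x = f y" for x y
    using that unfolding f_def by (metis f_inv_into_f imageI)
  ultimately show ?thesis unfolding thin_def using comp by blast
qed

lemma thin_converse [simp]: "thin (P\<inverse>) \<nu> S = thin P \<nu> S"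
  unfolding thin_def by auto

lemma thin_subset: "thin P \<nu> S \<Longrightarrow> S' \<subseteq> S \<Longrightarrow> thin P \<nu> S'"
  unfolding thin_def by (meson card_of_mono1 image_mono ordLeq_ordLess_trans subsetD)

lemma thin_ordLeq: "thin P \<nu> S \<Longrightarrow> \<nu> \<le>o \<nu>' \<Longrightarrow> thin P \<nu>' S"
  unfolding thin_def by (meson ordLess_ordLeq_trans)

lemma thin_singleton:
  assumes "Cinfinite \<nu>" "(x, x) \<in> P" shows "thin P \<nu> {x}"
proof (rule thinI[where g = id])
  show "|id ` {x}| <o \<nu>" using assms(1) by (intro finite_ordLess_Cinfinite) auto
qed (use assms in auto)

lemma thin_Un:
  fixes P :: "'a rel"
  assumes \<nu>: "Cinfinite \<nu>" and S: "thin P \<nu> S" and T: "thin P \<nu> T"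
  shows "thin P \<nu> (S \<union> T)"
proof -
  obtain f :: "'a \<Rightarrow> 'a" where f: "|f ` S| <o \<nu>" "\<forall>x\<in>S. \<forall>y\<in>S. f x = f y \<longrightarrow> (x, y) \<in> P \<or> (y, x) \<in> P"
    using S unfolding thin_def by blast
  obtain g :: "'a \<Rightarrow> 'a" where g: "|g ` T| <o \<nu>" "\<forall>x\<in>T. \<forall>y\<in>T. g x = g y \<longrightarrow> (x, y) \<in> P \<or> (y, x) \<in> P"
    using T unfolding thin_def by blast
  define h where "h x = (if x \<in> S then Inl (f x) else Inr (g x))" for x
  have "h ` (S \<union> T) \<subseteq> f ` S <+> g ` T" unfolding h_def by auto
  moreover have "|f ` S <+> g ` T| <o \<nu>"
    using \<nu> f g by (auto simp: cinfinite_def intro: card_of_Plus_ordLess_infinite_Field)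
  ultimately have "|h ` (S \<union> T)| <o \<nu>" by (rule ordLeq_ordLess_trans[OF card_of_mono1])
  then show ?thesis by (rule thinI) (use f g in \<open>auto simp: h_def split: if_splits\<close>)
qed

text \<open>Colouring by pairs (index, colour) takes at most \<open>|I \<times> C|\<close> colours.
  The common bound |C| is what makes \<open>|I| <o \<nu>\<close> suffice when \<nu> is
  singular.\<close>

lemma thin_UNION_uniform:
  fixes P :: "'a rel" and C :: "'c set"
  assumes \<nu>: "Cinfinite \<nu>" and I: "|I| <o \<nu>" and C: "|C| <o \<nu>"
    and S: "\<And>i. i \<in> I \<Longrightarrow> thin P (cardSuc |C| ) (S i)"
  shows "thin P \<nu> (\<Union>i\<in>I. S i)"
proof -
  have "\<forall>i\<in>I. \<exists>h. h ` S i \<subseteq> C \<and> (\<forall>x\<in>S i. \<forall>y\<in>S i. h x = h y \<longrightarrow> (x, y) \<in> P \<or> (y, x) \<in> P)"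
  proof
    fix i assume "i \<in> I"
    then have "thin P (cardSuc |C| ) (S i)" by (rule S)
    then obtain f :: "'a \<Rightarrow> 'a" where f: "|f ` S i| <o cardSuc |C|"
      "\<forall>x\<in>S i. \<forall>y\<in>S i. f x = f y \<longrightarrow> (x, y) \<in> P \<or> (y, x) \<in> P"
      unfolding thin_def by blast
    then have "|f ` S i| \<le>o |C|" by (simp add: card_of_ordLess_cardSuc_iff card_of_Card_order)
    then obtain e where e: "inj_on e (f ` S i)" "e ` f ` S i \<subseteq> C"
      using card_of_ordLeq[of "f ` S i" C] by blast
    have "(\<lambda>x. e (f x)) ` S i \<subseteq> C" using e(2) by auto
    moreover have "f x = f y" if "x \<in> S i" "y \<in> S i" "e (f x) = e (f y)" for x y
      using e(1) that unfolding inj_on_def by blast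
    ultimately show "\<exists>h. h ` S i \<subseteq> C \<and> (\<forall>x\<in>S i. \<forall>y\<in>S i. h x = h y \<longrightarrow> (x, y) \<in> P \<or> (y, x) \<in> P)"
      using f(2) by (intro exI[of _ "\<lambda>x. e (f x)"]) blast
  qed
  from this[unfolded bchoice_iff] obtain h where h: "\<forall>i\<in>I. h i ` S i \<subseteq> C \<and>
    (\<forall>x\<in>S i. \<forall>y\<in>S i. h i x = h i y \<longrightarrow> (x, y) \<in> P \<or> (y, x) \<in> P)" by (elim exE)
  \<comment> \<open>The sets may overlap, so each point first selects one of them.\<close>
  have "\<forall>x\<in>(\<Union>i\<in>I. S i). \<exists>i\<in>I. x \<in> S i" by blast
  then obtain n where n: "\<forall>x\<in>(\<Union>i\<in>I. S i). n x \<in> I \<and> x \<in> S (n x)" by metis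
  let ?g = "\<lambda>x. (n x, h (n x) x)"
  have "?g ` (\<Union>i\<in>I. S i) \<subseteq> I \<times> C" using n h by blast
  moreover have "|I \<times> C| <o \<nu>" using \<nu> I C by (rule card_of_Times_ordLess_infinite)
  ultimately have "|?g ` (\<Union>i\<in>I. S i)| <o \<nu>" by (rule ordLeq_ordLess_trans[OF card_of_mono1])
  then show ?thesis
  proof (rule thinI)
    fix x y assume "x \<in> (\<Union>i\<in>I. S i)" "y \<in> (\<Union>i\<in>I. S i)" "?g x = ?g y"
    then show "(x, y) \<in> P \<or> (y, x) \<in> P" using n h by (metis prod.inject)
  qed
qed

text \<open>Fewer than \<open>cofinality \<nu>\<close> cardinals below \<nu> are bounded below
  \<nu>; this supplies the common bound that \<open>thin_UNION_uniform\<close> asks for.\<close>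

lemma thin_uniform_of_less_cofinality:
  fixes P :: "'a rel" and I :: "'i set"
  assumes \<nu>: "Cinfinite \<nu>" and I: "|I| <o cofinality \<nu>"
    and S: "\<And>i. i \<in> I \<Longrightarrow> thin P \<nu> (S i)"
  shows "\<exists>c\<in>Field \<nu>. \<forall>i\<in>I. thin P (cardSuc |underS \<nu> c| ) (S i)"
proof -
  have "\<forall>i\<in>I. thin P \<nu> (S i)" using S by blast
  then obtain f :: "'i \<Rightarrow> 'a \<Rightarrow> 'a" where f: "\<forall>i\<in>I. |f i ` S i| <o \<nu> \<and>
      (\<forall>x\<in>S i. \<forall>y\<in>S i. f i x = f i y \<longrightarrow> (x, y) \<in> P \<or> (y, x) \<in> P)"
    unfolding thin_def bchoice_iff by blast
  obtain c where c: "c \<in> Field \<nu>" "\<forall>i\<in>I. |f i ` S i| \<le>o |underS \<nu> c|"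
    using cardinalities_bounded_of_less_cofinality[OF \<nu> I, of "\<lambda>i. f i ` S i"] f by blast
  have "thin P (cardSuc |underS \<nu> c| ) (S i)" if i: "i \<in> I" for i
  proof (rule thinI[where g = "f i"])
    show "|f i ` S i| <o cardSuc |underS \<nu> c|"
      using c i by (simp add: card_of_ordLess_cardSuc_iff card_of_Card_order)
  qed (use f i in blast)
  then show ?thesis using c(1) by blast
qed

lemma thin_UNION:
  fixes P :: "'a rel" and I :: "'i set"
  assumes \<nu>: "Cinfinite \<nu>" and I: "|I| <o cofinality \<nu>"
    and S: "\<And>i. i \<in> I \<Longrightarrow> thin P \<nu> (S i)"
  shows "thin P \<nu> (\<Union>i\<in>I. S i)"
proof -
  obtain c where c: "c \<in> Field \<nu>" "\<forall>i\<in>I. thin P (cardSuc |underS \<nu> c| ) (S i)"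
    using thin_uniform_of_less_cofinality[OF \<nu> I, of P S] S by blast
  show ?thesis
  proof (rule thin_UNION_uniform[OF \<nu>, where C = "underS \<nu> c"])
    show "|I| <o \<nu>" by (rule ordLess_ordLeq_trans[OF I cofinality_le_self[OF \<nu>]])
    show "|underS \<nu> c| <o \<nu>" using \<nu> c(1) by (simp add: card_of_underS)
  qed (use c(2) in blast)
qed

text \<open>All blocks draw on the same palette \<open>Field \<kappa>\<close>: points of equal
  colour are comparable by the colouring if they share a block, and by \<open>comp\<close> if they
  do not. So arbitrarily many blocks are allowed.\<close>

lemma thin_blocks:
  fixes P :: "'a rel"
  assumes \<kappa>: "Card_order \<kappa>"
    and blocks: "\<And>x. x \<in> S \<Longrightarrow> thin P (cardSuc \<kappa>) {y \<in> S. b y = b x}"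
    and comp: "\<And>x y. x \<in> S \<Longrightarrow> y \<in> S \<Longrightarrow> b x \<noteq> b y \<Longrightarrow> (x, y) \<in> P \<or> (y, x) \<in> P"
  shows "thin P (cardSuc \<kappa>) S"
proof -
  have "\<forall>j\<in>b ` S. \<exists>h. h ` {y \<in> S. b y = j} \<subseteq> Field \<kappa> \<and>
    (\<forall>x\<in>S. \<forall>y\<in>S. b x = j \<longrightarrow> b y = j \<longrightarrow> h x = h y \<longrightarrow> (x, y) \<in> P \<or> (y, x) \<in> P)"
  proof
    fix j assume "j \<in> b ` S"
    then have "thin P (cardSuc \<kappa>) {y \<in> S. b y = j}" using blocks by auto
    then obtain f :: "'a \<Rightarrow> 'a" where f: "|f ` {y \<in> S. b y = j}| <o cardSuc \<kappa>"
      "\<forall>x\<in>S. \<forall>y\<in>S. b x = j \<longrightarrow> b y = j \<longrightarrow> f x = f y \<longrightarrow> (x, y) \<in> P \<or> (y, x) \<in> P"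
      unfolding thin_def by auto
    then have "|f ` {y \<in> S. b y = j}| \<le>o \<kappa>" using \<kappa> by (simp add: card_of_ordLess_cardSuc_iff card_of_Card_order)
    then have "|f ` {y \<in> S. b y = j}| \<le>o |Field \<kappa>|"
      by (rule ordLeq_ordIso_trans[OF _ ordIso_symmetric[OF card_of_Field_ordIso[OF \<kappa>]]])
    then obtain e where e: "inj_on e (f ` {y \<in> S. b y = j})" "e ` f ` {y \<in> S. b y = j} \<subseteq> Field \<kappa>"
      using card_of_ordLeq[of "f ` {y \<in> S. b y = j}" "Field \<kappa>"] by blast
    have "(\<lambda>x. e (f x)) ` {y \<in> S. b y = j} \<subseteq> Field \<kappa>" using e(2) by auto
    moreover have "f x = f y" if "x \<in> S" "y \<in> S" "b x = j" "b y = j" "e (f x) = e (f y)" for x y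
      using e(1) that unfolding inj_on_def by blast
    ultimately show "\<exists>h. h ` {y \<in> S. b y = j} \<subseteq> Field \<kappa> \<and>
      (\<forall>x\<in>S. \<forall>y\<in>S. b x = j \<longrightarrow> b y = j \<longrightarrow> h x = h y \<longrightarrow> (x, y) \<in> P \<or> (y, x) \<in> P)"
      using f(2) by (intro exI[of _ "\<lambda>x. e (f x)"]) blast
  qed
  from this[unfolded bchoice_iff] obtain h where h: "\<forall>j\<in>b ` S. h j ` {y \<in> S. b y = j} \<subseteq> Field \<kappa> \<and>
    (\<forall>x\<in>S. \<forall>y\<in>S. b x = j \<longrightarrow> b y = j \<longrightarrow> h j x = h j y \<longrightarrow> (x, y) \<in> P \<or> (y, x) \<in> P)"
    by (elim exE)
  let ?g = "\<lambda>x. h (b x) x"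
  have "?g ` S \<subseteq> Field \<kappa>" using h by blast
  then have "|?g ` S| \<le>o \<kappa>"
    by (rule ordLeq_ordIso_trans[OF card_of_mono1 card_of_Field_ordIso[OF \<kappa>]])
  then have "|?g ` S| <o cardSuc \<kappa>" using \<kappa> by (simp add: card_of_ordLess_cardSuc_iff card_of_Card_order)
  then show ?thesis
  proof (rule thinI)
    fix x y assume "x \<in> S" "y \<in> S" "?g x = ?g y"
    then show "(x, y) \<in> P \<or> (y, x) \<in> P" using h comp by (cases "b x = b y") auto
  qed
qed

text \<open>A cover becomes a colouring by sending each point to a chain that contains it;
  conversely the colour classes form a cover.\<close>

lemma Cov_ge_iff_not_thin:
  fixes P :: "'a rel"
  assumes P: "Partial_order P" and \<nu>: "Card_order \<nu>"
  shows "\<nu> \<le>o Cov P \<longleftrightarrow> \<not> thin P \<nu> (Field P)"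
proof -
  have "Card_order (Cov P)" using Cov(1)[OF P] card_of_Card_order by fastforce
  then have "\<nu> \<le>o Cov P \<longleftrightarrow> \<not> Cov P <o \<nu>"
    using \<nu> by (simp add: not_ordLess_iff_ordLeq card_order_on_well_order_on)
  moreover have "Cov P <o \<nu> \<longleftrightarrow> thin P \<nu> (Field P)"
  proof
    assume lt: "Cov P <o \<nu>"
    obtain \<C> where \<C>: "\<C> \<subseteq> Chains P" "\<Union>\<C> = Field P" "Cov P = |\<C>|"
      using Cov(1)[OF P] unfolding chain_covers_def by blast
    then have "\<forall>x\<in>Field P. \<exists>C. x \<in> C \<and> C \<in> \<C>" by blast
    then obtain g :: "'a \<Rightarrow> 'a set" where g: "\<forall>x\<in>Field P. x \<in> g x \<and> g x \<in> \<C>"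
      by metis
    have "|g ` Field P| \<le>o |\<C>|" using g by (intro card_of_mono1) auto
    then have "|g ` Field P| <o \<nu>" using lt \<C>(3) ordLeq_ordLess_trans by metis
    then show "thin P \<nu> (Field P)"
    proof (rule thinI)
      fix x y assume xy: "x \<in> Field P" "y \<in> Field P" "g x = g y"
      then have "g x \<in> Chains P" "x \<in> g x" "y \<in> g x" using g \<C>(1) by auto
      then show "(x, y) \<in> P \<or> (y, x) \<in> P" unfolding Chains_def by blast
    qed
  next
    assume "thin P \<nu> (Field P)"
    then obtain f :: "'a \<Rightarrow> 'a" where f: "|f ` Field P| <o \<nu>"
      "\<forall>x\<in>Field P. \<forall>y\<in>Field P. f x = f y \<longrightarrow> (x, y) \<in> P \<or> (y, x) \<in> P"
      unfolding thin_def by blast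
    let ?\<C> = "(\<lambda>c. {x \<in> Field P. f x = c}) ` f ` Field P"
    have "(x, y) \<in> P \<or> (y, x) \<in> P" if "x \<in> Field P" "y \<in> Field P" "f x = f y" for x y
      using f(2) that by blast
    then have "{x \<in> Field P. f x = c} \<in> Chains P" for c unfolding Chains_def by simp
    then have "?\<C> \<subseteq> Chains P" by blast
    moreover have "\<Union>?\<C> = Field P" by auto
    ultimately have "?\<C> \<in> chain_covers P" unfolding chain_covers_def by simp
    then have "Cov P \<le>o |?\<C>|" by (rule Cov(2)[OF P])
    then have "Cov P \<le>o |f ` Field P|" by (rule ordLeq_transitive[OF _ card_of_image])
    then show "Cov P <o \<nu>" using f(1) by (rule ordLeq_ordLess_trans)
  qed
  ultimately show ?thesis by simp
qed

subsection \<open>Nearness\<close>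

lemma no_infinite_antichain_seq:
  assumes P: "Partial_order P" and fac: "no_infinite_antichain P"
    and x: "\<And>n :: nat. x n \<in> Field P"
  shows "\<exists>m n. m < n \<and> ((x m, x n) \<in> P \<or> (x n, x m) \<in> P)"
proof (rule ccontr)
  assume "\<not> ?thesis"
  then have inc: "(x m, x n) \<notin> P" if "m \<noteq> n" for m n using that by (metis nat_neq_iff)
  have refl: "(y, y) \<in> P" if "y \<in> Field P" for y
    using P that by (auto simp: order_on_defs refl_on_def)
  have "inj x"
  proof (rule injI)
    show "m = n" if "x m = x n" for m n using inc[of m n] refl[OF x[of m]] that by metis
  qed
  then have "infinite (range x)" by (rule range_inj_infinite)
  moreover have "\<forall>y\<in>range x. \<forall>z\<in>range x. y \<noteq> z \<longrightarrow> (y, z) \<notin> P"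
  proof (intro ballI impI)
    fix y z assume "y \<in> range x" "z \<in> range x" "y \<noteq> z"
    then obtain m n where "y = x m" "z = x n" "m \<noteq> n" by blast
    then show "(y, z) \<notin> P" using inc by simp
  qed
  moreover have "range x \<subseteq> Field P" using x by auto
  ultimately show False using fac unfolding no_infinite_antichain_def by blast
qed

text \<open>\<open>B\<close> is a notion of largeness. If every large set can be shrunk to a large
  set of \<open>R\<close>-successors of one of its points, iteration gives a sequence homogeneous
  for \<open>R\<close>. In the applications such a sequence is excluded, so the shrinking has to get
  stuck.\<close>

lemma homogeneous_sequence:
  assumes S: "B S" and step: "\<And>T. T \<subseteq> S \<Longrightarrow> B T \<Longrightarrow> \<exists>x\<in>T. B {y \<in> T. R x y}"
  shows "\<exists>s :: nat \<Rightarrow> 'a. (\<forall>n. s n \<in> S) \<and> (\<forall>m n. m < n \<longrightarrow> R (s m) (s n))"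
proof -
  \<comment> \<open>A state consists of the current set and the point picked from it; the next set
    is that of the successors of this point.\<close>
  have "\<exists>f. \<forall>n. (fst (f n) \<subseteq> S \<and> snd (f n) \<in> fst (f n) \<and> B {y \<in> fst (f n). R (snd (f n)) y})
    \<and> fst (f (Suc n)) = {y \<in> fst (f n). R (snd (f n)) y}"
  proof (rule dependent_nat_choice)
    show "\<exists>p. fst p \<subseteq> S \<and> snd p \<in> fst p \<and> B {y \<in> fst p. R (snd p) y}"
      using step[of S] S by auto
  next
    fix p :: "'a set \<times> 'a" and n :: nat
    let ?T = "{y \<in> fst p. R (snd p) y}"
    assume p: "fst p \<subseteq> S \<and> snd p \<in> fst p \<and> B ?T"
    then have "?T \<subseteq> S" by blast
    then obtain x where "x \<in> ?T" "B {y \<in> ?T. R x y}" using step[of ?T] p by blast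
    then show "\<exists>q. (fst q \<subseteq> S \<and> snd q \<in> fst q \<and> B {y \<in> fst q. R (snd q) y}) \<and> fst q = ?T"
      using \<open>?T \<subseteq> S\<close> by (intro exI[of _ "(?T, x)"]) simp
  qed
  then obtain f where f: "\<And>n. fst (f n) \<subseteq> S" "\<And>n. snd (f n) \<in> fst (f n)"
    "\<And>n. fst (f (Suc n)) = {y \<in> fst (f n). R (snd (f n)) y}" by blast
  have anti: "fst (f k) \<subseteq> fst (f n)" if "n \<le> k" for n k
    by (rule lift_Suc_antimono_le[of "\<lambda>n. fst (f n)", OF _ that]) (use f(3) in blast)
  have "R (snd (f m)) (snd (f n))" if "m < n" for m n
  proof -
    have "fst (f n) \<subseteq> fst (f (Suc m))" using that by (intro anti) simp
    then show ?thesis using f(2)[of n] f(3)[of m] by blast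
  qed
  then show ?thesis using f by (intro exI[of _ "\<lambda>n. snd (f n)"]) blast
qed

text \<open>Otherwise every non-thin subset would have a point whose incomparable elements in it are
  again non-thin; moving into them repeatedly would build an infinite antichain.\<close>

lemma subset_with_thin_incomparables:
  assumes P: "Partial_order P" and fac: "no_infinite_antichain P"
    and S: "S \<subseteq> Field P" "\<not> thin P \<nu> S"
  shows "\<exists>T\<subseteq>S. \<not> thin P \<nu> T \<and> (\<forall>x\<in>T. thin P \<nu> {y \<in> T. (x, y) \<notin> P \<and> (y, x) \<notin> P})"
proof (rule ccontr)
  assume no: "\<not> ?thesis"
  have "\<exists>s :: nat \<Rightarrow> 'a. (\<forall>n. s n \<in> S) \<and>
      (\<forall>m n. m < n \<longrightarrow> (s m, s n) \<notin> P \<and> (s n, s m) \<notin> P)"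
    by (rule homogeneous_sequence[where B = "\<lambda>T. \<not> thin P \<nu> T"]) (use no S in blast)+
  then obtain s :: "nat \<Rightarrow> 'a" where s: "\<And>n. s n \<in> S"
    "\<And>m n. m < n \<Longrightarrow> (s m, s n) \<notin> P \<and> (s n, s m) \<notin> P" by blast
  have "\<And>n. s n \<in> Field P" using s(1) S(1) by blast
  from no_infinite_antichain_seq[OF P fac this] show False using s(2) by blast
qed

definition between :: "'a rel \<Rightarrow> 'a set \<Rightarrow> 'a \<Rightarrow> 'a \<Rightarrow> 'a set" where
  "between P S x y = {w \<in> S. (x, w) \<in> P \<and> (w, y) \<in> P \<or> (y, w) \<in> P \<and> (w, x) \<in> P}"

definition near :: "'a rel \<Rightarrow> 'k rel \<Rightarrow> 'a set \<Rightarrow> 'a \<Rightarrow> 'a \<Rightarrow> bool" where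
  "near P \<nu> S x y \<longleftrightarrow> thin P \<nu> (between P S x y)"

lemma near_converse [simp]: "near (P\<inverse>) \<nu> S = near P \<nu> S"
proof -
  have "between (P\<inverse>) S x y = between P S x y" for x y unfolding between_def by auto
  then show ?thesis unfolding near_def by (simp add: fun_eq_iff)
qed

context
  fixes P :: "'a rel" and \<nu> :: "'k rel" and S :: "'a set"
  assumes P: "Partial_order P" and \<nu>: "Cinfinite \<nu>" and S: "S \<subseteq> Field P"
    and inc: "\<And>x. x \<in> S \<Longrightarrow> thin P \<nu> {y \<in> S. (x, y) \<notin> P \<and> (y, x) \<notin> P}"
begin

lemma near_sym: "near P \<nu> S x y \<Longrightarrow> near P \<nu> S y x"
  unfolding near_def between_def by (simp add: disj_commute)

lemma near_refl: "x \<in> S \<Longrightarrow> near P \<nu> S x x"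
proof -
  assume x: "x \<in> S"
  have "antisym P" "(x, x) \<in> P" using P x S by (auto simp: order_on_defs refl_on_def)
  then have "between P S x x \<subseteq> {x}" unfolding between_def antisym_def by blast
  then show ?thesis unfolding near_def
    using thin_subset thin_singleton[OF \<nu> \<open>(x, x) \<in> P\<close>] by metis
qed

text \<open>A point between \<open>x\<close> and \<open>z\<close> that is comparable with
  \<open>y\<close> lies between \<open>x\<close> and \<open>y\<close> or between \<open>y\<close>
  and \<open>z\<close>; the remaining ones are incomparable with \<open>y\<close> and form a thin
  set.\<close>

lemma near_trans:
  assumes y: "y \<in> S" and xy: "near P \<nu> S x y" and yz: "near P \<nu> S y z"
  shows "near P \<nu> S x z"
proof -
  have "between P S x z \<subseteq>
    (between P S x y \<union> between P S y z) \<union> {w \<in> S. (y, w) \<notin> P \<and> (w, y) \<notin> P}"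
    unfolding between_def by blast
  moreover have "thin P \<nu> \<dots>" using xy yz inc[OF y] unfolding near_def by (intro thin_Un \<nu>)
  ultimately show ?thesis unfolding near_def by (rule thin_subset[rotated])
qed

lemma incomparable_near:
  assumes "(x, y) \<notin> P" "(y, x) \<notin> P" shows "near P \<nu> S x y"
proof -
  have "trans P" using P by (auto simp: order_on_defs)
  then have "between P S x y = {}" unfolding between_def trans_def using assms by blast
  moreover have "thin P \<nu> {}"
    using finite_ordLess_Cinfinite[OF _ \<nu>, of "{} :: 'a set"] unfolding thin_def by simp
  ultimately show ?thesis unfolding near_def by simp
qed

text \<open>Nearness is convex: if a \<le> b \<le> c and a is near c, then a is near b. Hence a
  point near \<open>x\<close> cannot lie above \<open>y\<close>, for then \<open>x\<close> would be
  near \<open>y\<close>. Points that are not near are comparable, so the order survives replacing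
  \<open>x\<close> by \<open>x'\<close> and then \<open>y\<close> by \<open>y'\<close>.\<close>

lemma near_classes_ordered:
  assumes xS: "x \<in> S" "x' \<in> S" "y \<in> S" "y' \<in> S"
    and xy: "(x, y) \<in> P" "\<not> near P \<nu> S x y"
    and near: "near P \<nu> S x x'" "near P \<nu> S y y'"
  shows "(x', y') \<in> P"
proof -
  have tr: "trans P" using P by (auto simp: order_on_defs)
  have between_near: "near P \<nu> S a b" if "(a, b) \<in> P" "(b, c) \<in> P" "near P \<nu> S a c" for a b c
  proof -
    have "antisym P" using P by (auto simp: order_on_defs)
    then have "between P S a b \<subseteq> between P S a c"
      using that tr unfolding between_def trans_def antisym_def by blast
    then show ?thesis using that(3) thin_subset unfolding near_def by metis
  qed
  have "\<not> near P \<nu> S x' y" using near_trans[OF xS(2) near(1)] xy(2) by blast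
  moreover have "(x', y) \<in> P"
  proof (rule ccontr)
    assume "(x', y) \<notin> P"
    then have "(y, x') \<in> P" using incomparable_near calculation by blast
    then show False using between_near[OF xy(1) _ near(1)] xy(2) by blast
  qed
  ultimately have x'y: "\<not> near P \<nu> S x' y" "(x', y) \<in> P" by blast+
  then have "\<not> near P \<nu> S x' y'" using near_trans[OF xS(4) _ near_sym[OF near(2)]] by blast
  show ?thesis
  proof (rule ccontr)
    assume "(x', y') \<notin> P"
    then have "(y', x') \<in> P" using incomparable_near \<open>\<not> near P \<nu> S x' y'\<close> by blast
    then have "near P \<nu> S y' x'" using between_near[OF _ x'y(2) near_sym[OF near(2)]] by blast
    then show False using near_sym \<open>\<not> near P \<nu> S x' y'\<close> by blast
  qed
qed

end

section \<open>Sets that are directed up to thin sets\<close>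

definition upward :: "'a rel \<Rightarrow> 'k rel \<Rightarrow> 'a set \<Rightarrow> bool" where
  "upward P \<nu> Q \<longleftrightarrow> Q \<subseteq> Field P \<and> \<not> thin P \<nu> Q \<and> (\<forall>y\<in>Q. thin P \<nu> {z \<in> Q. (y, z) \<notin> P})"

lemma upward_subset:
  "upward P \<nu> Q \<Longrightarrow> Q' \<subseteq> Q \<Longrightarrow> \<not> thin P \<nu> Q' \<Longrightarrow> upward P \<nu> Q'"
  unfolding upward_def by (auto elim!: thin_subset)

text \<open>The class of \<open>x\<close> splits into the points above, below and incomparable to
  \<open>x\<close>; the last part is thin, so one of the first two is not. In the part above
  \<open>x\<close>, a point that is not above \<open>y\<close> is either between \<open>x\<close>
  and \<open>y\<close>, which are near, or incomparable to \<open>y\<close>, and both kinds form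
  thin sets.\<close>

lemma upward_in_near_class:
  fixes P :: "'a rel"
  assumes P: "Partial_order P" and \<nu>: "Cinfinite \<nu>" and S: "S \<subseteq> Field P"
    and inc: "\<And>x. x \<in> S \<Longrightarrow> thin P \<nu> {y \<in> S. (x, y) \<notin> P \<and> (y, x) \<notin> P}"
    and x: "x \<in> S" "\<not> thin P \<nu> {y \<in> S. near P \<nu> S y x}"
  shows "\<exists>Q\<subseteq>S. upward P \<nu> Q \<or> upward (P\<inverse>) \<nu> Q"
proof -
  let ?A = "\<lambda>P. {y \<in> S. (x, y) \<in> P \<and> near P \<nu> S x y}"
  \<comment> \<open>Nearness is self-dual, so a single argument with \<open>R\<close> serves both
    halves of the class.\<close>
  have up: "upward R \<nu> (?A R)"
    if R: "R = P \<or> R = P\<inverse>" and nt: "\<not> thin R \<nu> (?A R)" for R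
    unfolding upward_def
  proof (intro conjI ballI)
    show "?A R \<subseteq> Field R" using S R by auto
    show "\<not> thin R \<nu> (?A R)" by (rule nt)
    fix y assume y: "y \<in> ?A R"
    have "{z \<in> ?A R. (y, z) \<notin> R} \<subseteq> between R S x y \<union> {z \<in> S. (y, z) \<notin> P \<and> (z, y) \<notin> P}"
      using R unfolding between_def by blast
    moreover have "thin R \<nu> (between R S x y \<union> {z \<in> S. (y, z) \<notin> P \<and> (z, y) \<notin> P})"
      using y R inc[of y] by (intro thin_Un \<nu>) (auto simp: near_def)
    ultimately show "thin R \<nu> {z \<in> ?A R. (y, z) \<notin> R}" by (rule thin_subset[rotated])
  qed
  have "{y \<in> S. near P \<nu> S y x} \<subseteq>
     (?A P \<union> ?A (P\<inverse>)) \<union> {y \<in> S. (x, y) \<notin> P \<and> (y, x) \<notin> P}"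
    using near_sym[OF P \<nu> S inc] by auto
  then have "\<not> thin P \<nu> ((?A P \<union> ?A (P\<inverse>)) \<union> {y \<in> S. (x, y) \<notin> P \<and> (y, x) \<notin> P})"
    using x(2) by (meson thin_subset)
  then have "\<not> thin P \<nu> (?A P) \<or> \<not> thin P \<nu> (?A (P\<inverse>))"
    using inc[OF x(1)] thin_Un[OF \<nu>] by meson
  then show ?thesis
  proof
    assume "\<not> thin P \<nu> (?A P)"
    then show ?thesis using up[of P] by (intro exI[of _ "?A P"]) auto
  next
    assume "\<not> thin P \<nu> (?A (P\<inverse>))"
    then show ?thesis using up[of "P\<inverse>"] by (intro exI[of _ "?A (P\<inverse>)"]) auto
  qed
qed

text \<open>The points of \<open>Q\<close> not above some \<open>u\<close> form a union of fewer
  than \<open>cofinality \<nu>\<close> thin sets and hence do not exhaust \<open>Q\<close>. Adding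
  each \<open>u\<close> to its own set yields strictness.\<close>

lemma upward_strict_bound:
  assumes P: "Partial_order P" and \<nu>: "Cinfinite \<nu>" and Q: "upward P \<nu> Q"
    and U: "U \<subseteq> Q" "|U| <o cofinality \<nu>"
  shows "\<exists>q\<in>Q. \<forall>u\<in>U. (u, q) \<in> P \<and> u \<noteq> q"
proof (rule ccontr)
  assume no: "\<not> ?thesis"
  have "thin P \<nu> ({z \<in> Q. (u, z) \<notin> P} \<union> {u})" if "u \<in> U" for u
  proof -
    have "(u, u) \<in> P" using P Q U that unfolding upward_def order_on_defs refl_on_def by blast
    then show ?thesis using Q U that unfolding upward_def by (intro thin_Un \<nu> thin_singleton) auto
  qed
  then have "thin P \<nu> (\<Union>u\<in>U. {z \<in> Q. (u, z) \<notin> P} \<union> {u})" by (rule thin_UNION[OF \<nu> U(2)])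
  moreover have "Q \<subseteq> (\<Union>u\<in>U. {z \<in> Q. (u, z) \<notin> P} \<union> {u})" using no by blast
  ultimately have "thin P \<nu> Q" by (rule thin_subset)
  then show False using Q unfolding upward_def by blast
qed

text \<open>
  Going through a well-order of \<open>Q\<close>, keep an element whenever it is \<open>L\<close>-above all the
  elements kept so far.
\<close>

lemma greedy_well_ordered_subset:
  fixes Q :: "'a set" and L :: "'a \<Rightarrow> 'a \<Rightarrow> bool"
  obtains W :: "'a rel" and X where "Well_order W" "Field W = UNIV" "X \<subseteq> Q"
    "\<And>x y. x \<in> X \<Longrightarrow> y \<in> X \<Longrightarrow> (x, y) \<in> W - Id \<Longrightarrow> L x y"
    "\<And>q. q \<in> Q \<Longrightarrow> q \<notin> X \<Longrightarrow> \<exists>x\<in>X. \<not> L x q"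
proof -
  obtain W :: "'a rel" where W: "Well_order W" "Field W = UNIV" using well_ordering by metis
  have wf: "wf (W - Id)" using W unfolding well_order_on_def by blast
  have "\<exists>f. \<forall>q. f q = (q \<in> Q \<and> (\<forall>x. (x, q) \<in> W - Id \<longrightarrow> f x \<longrightarrow> L x q))"
    by (rule dependent_wf_choice[OF wf]) auto
  then obtain f where f: "\<forall>q. f q = (q \<in> Q \<and> (\<forall>x. (x, q) \<in> W - Id \<longrightarrow> f x \<longrightarrow> L x q))" ..
  show thesis
  proof (rule that[of W "Collect f"])
    show "Collect f \<subseteq> Q" using f by blast
    show "L x y" if "x \<in> Collect f" "y \<in> Collect f" "(x, y) \<in> W - Id" for x y using f that by blast
    show "\<exists>x\<in>Collect f. \<not> L x q" if "q \<in> Q" "q \<notin> Collect f" for q using f that by blast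
  qed (fact W)+
qed

subsection \<open>Ladders of unbounded chains\<close>

lemma successor_Cinfinite:
  assumes "Cinfinite \<kappa>" "\<nu> =o cardSuc \<kappa>" shows "Cinfinite \<nu>"
  using Cinfinite_cong[OF ordIso_symmetric[OF assms(2)] Cinfinite_cardSuc[OF assms(1)]] .

lemma successor_le_cofinality:
  assumes "Cinfinite \<kappa>" "\<nu> =o cardSuc \<kappa>" shows "\<nu> \<le>o cofinality \<nu>"
proof (rule regular_le_cofinality[OF successor_Cinfinite[OF assms]])
  show "regularCard \<nu>"
    by (rule regularCard_ordIso[OF ordIso_symmetric[OF assms(2)] Cinfinite_cardSuc[OF assms(1)]
        regularCard_cardSuc[OF assms(1)]])
qed

lemma natLeq_ordLess_successor:
  assumes "Cinfinite \<kappa>" "\<nu> =o cardSuc \<kappa>" shows "natLeq <o \<nu>"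
proof -
  have "natLeq \<le>o \<kappa>" using assms(1) by (rule natLeq_ordLeq_cinfinite)
  moreover have "\<kappa> <o cardSuc \<kappa>" using assms(1) by (simp add: cardSuc_greater)
  ultimately have "natLeq <o cardSuc \<kappa>" by (rule ordLeq_ordLess_trans)
  then show ?thesis by (rule ordLess_ordIso_trans[OF _ ordIso_symmetric[OF assms(2)]])
qed

text \<open>
  If all chains outside \<open>\<up>x\<close> were bounded, for every \<open>x\<close>, then by directedness the whole
  complement of \<open>\<up>x\<close> would lie below some \<open>y\<close>; call this \<open>L x y\<close>. Cut \<open>Q\<close> along a maximal
  well-ordered \<open>L\<close>-chain \<open>X\<close>, putting \<open>q\<close> into the block of the least \<open>a q \<in> X\<close> that is not
  below \<open>q\<close>. Elements of non-adjacent blocks are comparable, so the even and the odd blocks form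
  two thin sets (\<open>p\<close> is the parity).
\<close>

lemma exists_unbounded_chain:
  fixes P :: "'a rel" and \<nu> :: "'b rel" and \<kappa> :: "'k rel"
  assumes P: "Partial_order P" and \<kappa>: "Cinfinite \<kappa>" and suc: "\<nu> =o cardSuc \<kappa>"
    and Q: "upward P \<nu> Q"
  shows "\<exists>x\<in>Q. \<exists>K\<subseteq>Q. K \<in> Chains P \<and> (\<forall>k\<in>K. (x, k) \<notin> P) \<and> (\<forall>q\<in>Q. \<exists>k\<in>K. (k, q) \<notin> P)"
proof (rule ccontr)
  assume no: "\<not> ?thesis"
  have \<nu>: "Cinfinite \<nu>" by (rule successor_Cinfinite[OF \<kappa> suc])
  have cof: "\<nu> \<le>o cofinality \<nu>" by (rule successor_le_cofinality[OF \<kappa> suc])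
  have tr: "trans P" and asym: "antisym P" using P by (auto simp: order_on_defs)
  have bound: "\<exists>q\<in>Q. \<forall>u\<in>U. (u, q) \<in> P \<and> u \<noteq> q" if "U \<subseteq> Q" "|U| <o \<nu>" for U
    using upward_strict_bound[OF P \<nu> Q that(1)] ordLess_ordLeq_trans[OF that(2) cof] .
  define L where "L x y \<longleftrightarrow> x \<in> Q \<and> y \<in> Q \<and> (x, y) \<in> P \<and> x \<noteq> y \<and>
    (\<forall>z\<in>Q. (x, z) \<in> P \<or> (z, y) \<in> P)" for x y
  have exL: "\<exists>y. L x y" if x: "x \<in> Q" for x
  proof -
    let ?Z = "{z \<in> Q. (x, z) \<notin> P}"
    have "thin P \<nu> ?Z" using Q x unfolding upward_def by blast
    then obtain f :: "'a \<Rightarrow> 'a" where f: "|f ` ?Z| <o \<nu>"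
      "\<forall>y\<in>?Z. \<forall>z\<in>?Z. f y = f z \<longrightarrow> (y, z) \<in> P \<or> (z, y) \<in> P" unfolding thin_def by blast
    have "\<forall>c. \<exists>q. q \<in> Q \<and> (\<forall>z\<in>?Z. f z = c \<longrightarrow> (z, q) \<in> P)"
    proof
      fix c
      let ?K = "{z \<in> ?Z. f z = c}"
      have "?K \<in> Chains P" using f(2) unfolding Chains_def by simp
      moreover have "?K \<subseteq> Q" "\<forall>k\<in>?K. (x, k) \<notin> P" by auto
      ultimately have "\<not> (\<forall>q\<in>Q. \<exists>k\<in>?K. (k, q) \<notin> P)" using no x by blast
      then show "\<exists>q. q \<in> Q \<and> (\<forall>z\<in>?Z. f z = c \<longrightarrow> (z, q) \<in> P)" by blast
    qed
    from this[unfolded choice_iff] obtain u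
      where "\<forall>c. u c \<in> Q \<and> (\<forall>z\<in>?Z. f z = c \<longrightarrow> (z, u c) \<in> P)" by (elim exE)
    then have u: "\<And>c. u c \<in> Q" "\<And>z. z \<in> ?Z \<Longrightarrow> (z, u (f z)) \<in> P" by simp_all
    have "|u ` f ` ?Z| <o \<nu>" by (rule ordLeq_ordLess_trans[OF card_of_image f(1)])
    then have "\<exists>q\<in>Q. \<forall>v\<in>u ` f ` ?Z. (v, q) \<in> P \<and> v \<noteq> q"
      using u(1) by (intro bound) auto
    then obtain y where y: "y \<in> Q" "\<forall>c\<in>f ` ?Z. (u c, y) \<in> P" by auto
    have "|{x, y}| <o \<nu>" by (rule finite_ordLess_Cinfinite[OF _ \<nu>]) simp
    then have "\<exists>q\<in>Q. \<forall>v\<in>{x, y}. (v, q) \<in> P \<and> v \<noteq> q" using x y(1) by (intro bound) auto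
    then obtain y' where y': "y' \<in> Q" "(x, y') \<in> P" "x \<noteq> y'" "(y, y') \<in> P" by auto
    have "(z, y') \<in> P" if "z \<in> ?Z" for z
    proof -
      have "(z, u (f z)) \<in> P" "(u (f z), y) \<in> P" using u(2)[OF that] y(2) that by simp_all
      then show ?thesis using y'(4) tr by (meson transD)
    qed
    then show ?thesis using x y' unfolding L_def by blast
  qed
  obtain W :: "'a rel" and X where W: "Well_order W" "Field W = UNIV" and X: "X \<subseteq> Q"
    "\<And>x y. x \<in> X \<Longrightarrow> y \<in> X \<Longrightarrow> (x, y) \<in> W - Id \<Longrightarrow> L x y"
    "\<And>q. q \<in> Q \<Longrightarrow> q \<notin> X \<Longrightarrow> \<exists>x\<in>X. \<not> L x q"
    using greedy_well_ordered_subset[of Q L] by metis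
  define R where "R = W - Id"
  have wf: "wf R" using W unfolding R_def well_order_on_def by blast
  have trR: "trans R" unfolding R_def using W
    by (intro trans_diff_Id) (auto simp: order_on_defs)
  have totR: "x = y \<or> (x, y) \<in> R \<or> (y, x) \<in> R" for x y
    using W unfolding R_def order_on_defs total_on_def by auto
  have irR: "(x, x) \<notin> R" for x unfolding R_def by simp
  \<comment> \<open>If \<open>q\<close> were above all of \<open>X\<close>, then a \<open>y\<close>
    with \<open>L q y\<close> would be \<open>L\<close>-above all of \<open>X\<close>. The
    maximality of \<open>X\<close> would put \<open>y\<close> into \<open>X\<close>, contradicting
    irreflexivity of \<open>L\<close>.\<close>
  have unb: "\<exists>x\<in>X. (x, q) \<notin> P" if q: "q \<in> Q" for q
  proof (rule ccontr)
    assume "\<not> ?thesis"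
    then have le: "\<And>x. x \<in> X \<Longrightarrow> (x, q) \<in> P" by blast
    obtain y where y: "L q y" using exL q by blast
    have Ly: "L x y" if "x \<in> X" for x
      unfolding L_def
    proof (intro conjI ballI)
      show "x \<in> Q" "y \<in> Q" using that X(1) y unfolding L_def by blast+
      have qy: "(q, y) \<in> P" "q \<noteq> y" using y unfolding L_def by blast+
      show "(x, y) \<in> P" by (rule transD[OF tr le[OF that] qy(1)])
      show "x \<noteq> y" using le[OF that] qy antisymD[OF asym] by blast
      fix z assume "z \<in> Q"
      then have "(q, z) \<in> P \<or> (z, y) \<in> P" using y unfolding L_def by blast
      then show "(x, z) \<in> P \<or> (z, y) \<in> P" using transD[OF tr le[OF that]] by blast
    qed
    then have "y \<in> X" using X(3) y unfolding L_def by blast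
    then have "L y y" by (rule Ly)
    then show False unfolding L_def by blast
  qed
  have "\<forall>q\<in>Q. \<exists>x. x \<in> X \<and> (x, q) \<notin> P \<and> (\<forall>x'. (x', x) \<in> R \<longrightarrow> x' \<in> X \<longrightarrow> (x', q) \<in> P)"
  proof
    fix q assume "q \<in> Q"
    then obtain x0 where "x0 \<in> {x \<in> X. (x, q) \<notin> P}" using unb by blast
    from wfE_min[OF wf this] obtain x where "x \<in> {x \<in> X. (x, q) \<notin> P}"
      "\<And>x'. (x', x) \<in> R \<Longrightarrow> x' \<notin> {x \<in> X. (x, q) \<notin> P}" by blast
    then show "\<exists>x. x \<in> X \<and> (x, q) \<notin> P \<and> (\<forall>x'. (x', x) \<in> R \<longrightarrow> x' \<in> X \<longrightarrow> (x', q) \<in> P)" by blast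
  qed
  from this[unfolded bchoice_iff] obtain a where a: "\<And>q. q \<in> Q \<Longrightarrow> a q \<in> X"
    "\<And>q. q \<in> Q \<Longrightarrow> (a q, q) \<notin> P" "\<And>q x. q \<in> Q \<Longrightarrow> (x, a q) \<in> R \<Longrightarrow> x \<in> X \<Longrightarrow> (x, q) \<in> P"
    by blast
  \<comment> \<open>As \<open>a q\<close> is not below \<open>q\<close>, the relation
    \<open>L (a q) d\<close> forces \<open>q\<close> below \<open>d\<close>; as \<open>d\<close>
    precedes \<open>a q'\<close>, minimality of \<open>a q'\<close> puts \<open>d\<close> below
    \<open>q'\<close>.\<close>
  have far: "(q, q') \<in> P"
    if q: "q \<in> Q" "q' \<in> Q" and d: "d \<in> X" "(a q, d) \<in> R" "(d, a q') \<in> R" for q q' d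
  proof -
    have "L (a q) d" using X(2)[OF a(1)[OF q(1)] d(1)] d(2) unfolding R_def by blast
    then have "(q, d) \<in> P" using a(2)[OF q(1)] q(1) unfolding L_def by blast
    moreover have "(d, q') \<in> P" by (rule a(3)[OF q(2) d(3) d(1)])
    ultimately show ?thesis by (rule transD[OF tr])
  qed
  define succ where "succ x y \<longleftrightarrow> x \<in> X \<and> y \<in> X \<and> (x, y) \<in> R \<and> (\<forall>d\<in>X. (x, d) \<in> R \<longrightarrow> (d, y) \<notin> R)"
    for x y
  \<comment> \<open>Elements without immediate predecessor in \<open>X\<close> get
    \<open>False\<close>, and the value flips at each successor. So two distinct elements of
    \<open>X\<close> with equal parity have another one strictly between them.\<close>
  have "\<exists>p. \<forall>y. p y = (\<exists>x. succ x y \<and> \<not> p x)"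
    by (rule dependent_wf_choice[OF wf]) (auto simp: succ_def)
  then obtain p where p: "\<And>y. p y = (\<exists>x. succ x y \<and> \<not> p x)" by blast
  have succ_unique: "x = x'" if "succ x y" "succ x' y" for x x' y
    using that totR[of x x'] unfolding succ_def by blast
  have alternate: "p y \<longleftrightarrow> \<not> p x" if "succ x y" for x y
    using p[of y] succ_unique[OF that] that by blast
  have thin_suc: "thin P (cardSuc \<kappa>) S" if "thin P \<nu> S" for S
    by (rule thin_ordLeq[OF that ordIso_imp_ordLeq[OF suc]])
  have "thin P (cardSuc \<kappa>) {q \<in> Q. p (a q) = i}" for i
  proof (rule thin_blocks[where b = a])
    show "Card_order \<kappa>" using \<kappa> by simp
    fix x assume x: "x \<in> {q \<in> Q. p (a q) = i}"
    \<comment> \<open>The block of \<open>x\<close> misses the up-set of \<open>a x\<close>.\<close>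
    have "thin P \<nu> {z \<in> Q. (a x, z) \<notin> P}" using x Q a(1) X(1) unfolding upward_def by blast
    moreover have "{y \<in> {q \<in> Q. p (a q) = i}. a y = a x} \<subseteq> {z \<in> Q. (a x, z) \<notin> P}"
      using a(2) by force
    ultimately have "thin P \<nu> {y \<in> {q \<in> Q. p (a q) = i}. a y = a x}" by (rule thin_subset)
    then show "thin P (cardSuc \<kappa>) {y \<in> {q \<in> Q. p (a q) = i}. a y = a x}" by (rule thin_suc)
  next
    fix x y assume xy: "x \<in> {q \<in> Q. p (a q) = i}" "y \<in> {q \<in> Q. p (a q) = i}" "a x \<noteq> a y"
    have gap: "\<exists>d\<in>X. (a x, d) \<in> R \<and> (d, a y) \<in> R"
      if "x \<in> Q" "y \<in> Q" "p (a x) = p (a y)" "(a x, a y) \<in> R" for x y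
      using that alternate[of "a x" "a y"] a(1) unfolding succ_def by blast
    show "(x, y) \<in> P \<or> (y, x) \<in> P"
      using totR[of "a x" "a y"] gap[of x y] gap[of y x] far xy by blast
  qed
  then have "thin P (cardSuc \<kappa>) ({q \<in> Q. p (a q) = True} \<union> {q \<in> Q. p (a q) = False})"
    by (intro thin_Un Cinfinite_cardSuc \<kappa>)
  moreover have "{q \<in> Q. p (a q) = True} \<union> {q \<in> Q. p (a q) = False} = Q" by auto
  ultimately have "thin P \<nu> Q"
    using thin_ordLeq[OF _ ordIso_imp_ordLeq[OF ordIso_symmetric[OF suc]]] by metis
  then show False using Q unfolding upward_def by blast
qed

text \<open>The recursion never stops: each chain lies outside the up-set of some \<open>x\<close>
  in \<open>Q\<close>, so its down-closure is thin, and by regularity fewer than \<nu> removed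
  down-closures leave an upward set. Unboundedness of \<open>K \<xi>\<close> in what remains also
  gives the last property: if \<open>q\<close> bounds \<open>U\<close> there, an element of the
  chain not below \<open>q\<close> must be above all of \<open>U\<close>.\<close>

lemma exists_chain_ladder:
  fixes P :: "'a rel" and \<nu> :: "'b rel" and \<kappa> :: "'k rel"
  assumes P: "Partial_order P" and \<kappa>: "Cinfinite \<kappa>" and suc: "\<nu> =o cardSuc \<kappa>"
    and Q: "upward P \<nu> Q"
  shows "\<exists>K :: 'b \<Rightarrow> 'a set. (\<forall>\<xi>. K \<xi> \<subseteq> Q \<and> K \<xi> \<in> Chains P) \<and>
    (\<forall>\<eta> \<xi>. (\<eta>, \<xi>) \<in> \<nu> - Id \<longrightarrow> (\<forall>y\<in>K \<xi>. \<forall>k\<in>K \<eta>. (y, k) \<notin> P)) \<and>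
    (\<forall>\<eta> \<xi>. (\<eta>, \<xi>) \<in> \<nu> \<longrightarrow> (\<forall>y\<in>K \<xi>. \<exists>k\<in>K \<eta>. (k, y) \<notin> P)) \<and>
    (\<forall>\<xi> U. U \<subseteq> K \<xi> \<longrightarrow> |U| <o \<nu> \<longrightarrow> (\<exists>k\<in>K \<xi>. \<forall>u\<in>U. (u, k) \<in> P))"
proof -
  have \<nu>: "Cinfinite \<nu>" by (rule successor_Cinfinite[OF \<kappa> suc])
  have cof: "\<nu> \<le>o cofinality \<nu>" by (rule successor_le_cofinality[OF \<kappa> suc])
  have tr: "trans P" using P by (auto simp: order_on_defs)
  have wo: "Well_order \<nu>" using \<nu> by (simp add: card_order_on_well_order_on)
  then have wf: "wf (\<nu> - Id)" and tr\<nu>: "trans \<nu>" and as\<nu>: "antisym \<nu>" by (auto simp: order_on_defs)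
  define Qs where "Qs K \<xi> = {q \<in> Q. \<forall>\<eta>. (\<eta>, \<xi>) \<in> \<nu> - Id \<longrightarrow> (\<forall>k\<in>K \<eta>. (q, k) \<notin> P)}"
    for K :: "'b \<Rightarrow> 'a set" and \<xi>
  define good where "good K \<xi> C \<longleftrightarrow> C \<subseteq> Qs K \<xi> \<and> C \<in> Chains P \<and>
    (\<forall>q\<in>Qs K \<xi>. \<exists>k\<in>C. (k, q) \<notin> P) \<and> (\<exists>x\<in>Q. \<forall>k\<in>C. (x, k) \<notin> P)" for K :: "'b \<Rightarrow> 'a set" and \<xi> C
  have up: "upward P \<nu> (Qs K \<xi>)" if K: "\<And>\<eta>. (\<eta>, \<xi>) \<in> \<nu> - Id \<Longrightarrow> good K \<eta> (K \<eta>)" for K \<xi>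
  proof (rule upward_subset[OF Q])
    show "Qs K \<xi> \<subseteq> Q" unfolding Qs_def by blast
    show "\<not> thin P \<nu> (Qs K \<xi>)"
    proof
      assume thin: "thin P \<nu> (Qs K \<xi>)"
      let ?D = "\<lambda>\<eta>. {q \<in> Q. \<exists>k\<in>K \<eta>. (q, k) \<in> P}"
      have "thin P \<nu> (\<Union>\<eta>\<in>underS \<nu> \<xi>. ?D \<eta>)"
      proof (rule thin_UNION[OF \<nu>])
        have "|underS \<nu> \<xi>| <o \<nu>"
        \<comment> \<open>The recursion runs over the whole type; outside \<open>Field \<nu>\<close>
          there are no predecessors.\<close>
        proof (cases "\<xi> \<in> Field \<nu>")
          case True then show ?thesis using \<nu> by (simp add: card_of_underS)
        next
          case False
          then have "underS \<nu> \<xi> = {}" unfolding underS_def Field_def by blast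
          then show ?thesis by (simp add: finite_ordLess_Cinfinite[OF _ \<nu>])
        qed
        then show "|underS \<nu> \<xi>| <o cofinality \<nu>" by (rule ordLess_ordLeq_trans[OF _ cof])
        fix \<eta> assume "\<eta> \<in> underS \<nu> \<xi>"
        then have "good K \<eta> (K \<eta>)" using K unfolding underS_def by blast
        then obtain x where x: "x \<in> Q" "\<forall>k\<in>K \<eta>. (x, k) \<notin> P" unfolding good_def by blast
        have "thin P \<nu> {z \<in> Q. (x, z) \<notin> P}" using Q x unfolding upward_def by blast
        moreover have "?D \<eta> \<subseteq> {z \<in> Q. (x, z) \<notin> P}" using x(2) transD[OF tr] by blast
        ultimately show "thin P \<nu> (?D \<eta>)" by (rule thin_subset)
      qed
      then have "thin P \<nu> (Qs K \<xi> \<union> (\<Union>\<eta>\<in>underS \<nu> \<xi>. ?D \<eta>))" using thin by (intro thin_Un \<nu>)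
      moreover have "Q \<subseteq> Qs K \<xi> \<union> (\<Union>\<eta>\<in>underS \<nu> \<xi>. ?D \<eta>)" unfolding Qs_def underS_def by blast
      ultimately have "thin P \<nu> Q" by (rule thin_subset)
      then show False using Q unfolding upward_def by blast
    qed
  qed
  have "\<exists>K. \<forall>\<xi>. good K \<xi> (K \<xi>)"
  proof (rule dependent_wf_choice[OF wf])
    fix f g :: "'b \<Rightarrow> 'a set" and \<xi> C
    assume "\<And>\<eta>. (\<eta>, \<xi>) \<in> \<nu> - Id \<Longrightarrow> f \<eta> = g \<eta>"
    then have "Qs f \<xi> = Qs g \<xi>" unfolding Qs_def by auto
    then show "good f \<xi> C = good g \<xi> C" unfolding good_def by simp
  next
    fix \<xi> and K :: "'b \<Rightarrow> 'a set"
    assume "\<And>\<eta>. (\<eta>, \<xi>) \<in> \<nu> - Id \<Longrightarrow> good K \<eta> (K \<eta>)"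
    from exists_unbounded_chain[OF P \<kappa> suc up[OF this]]
    obtain x where x: "x \<in> Qs K \<xi>" and ex: "\<exists>C\<subseteq>Qs K \<xi>. C \<in> Chains P \<and>
      (\<forall>k\<in>C. (x, k) \<notin> P) \<and> (\<forall>q\<in>Qs K \<xi>. \<exists>k\<in>C. (k, q) \<notin> P)" by (rule bexE)
    moreover have "x \<in> Q" using x unfolding Qs_def by simp
    ultimately show "\<exists>C. good K \<xi> C" unfolding good_def by auto
  qed
  then obtain K where K: "\<And>\<xi>. good K \<xi> (K \<xi>)" by blast
  have KQs: "K \<xi> \<subseteq> Qs K \<xi>" and chain: "K \<xi> \<in> Chains P"
    and unb: "\<And>q. q \<in> Qs K \<xi> \<Longrightarrow> \<exists>k\<in>K \<xi>. (k, q) \<notin> P" for \<xi>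
    using K[of \<xi>] unfolding good_def by blast+
  show ?thesis
  proof (intro exI[of _ K] conjI allI impI ballI)
    show "K \<xi> \<subseteq> Q" for \<xi> using KQs[of \<xi>] unfolding Qs_def by blast
    show "K \<xi> \<in> Chains P" for \<xi> by (rule chain)
    show "(y, k) \<notin> P" if "(\<eta>, \<xi>) \<in> \<nu> - Id" "y \<in> K \<xi>" "k \<in> K \<eta>" for \<eta> \<xi> y k
      using KQs[of \<xi>] that unfolding Qs_def by blast
    show "\<exists>k\<in>K \<eta>. (k, y) \<notin> P" if "(\<eta>, \<xi>) \<in> \<nu>" "y \<in> K \<xi>" for \<eta> \<xi> y
    proof (rule unb)
      have "(\<eta>', \<xi>) \<in> \<nu> - Id" if "(\<eta>', \<eta>) \<in> \<nu> - Id" for \<eta>'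
        using that \<open>(\<eta>, \<xi>) \<in> \<nu>\<close> transD[OF tr\<nu>] antisymD[OF as\<nu>] by blast
      then show "y \<in> Qs K \<eta>" using KQs[of \<xi>] that(2) unfolding Qs_def by blast
    qed
    show "\<exists>k\<in>K \<xi>. \<forall>u\<in>U. (u, k) \<in> P" if U: "U \<subseteq> K \<xi>" "|U| <o \<nu>" for \<xi> U
    proof -
      obtain q where q: "q \<in> Qs K \<xi>" "\<forall>u\<in>U. (u, q) \<in> P"
        using upward_strict_bound[OF P \<nu> up[OF K] _ ordLess_ordLeq_trans[OF U(2) cof], of \<xi>]
          U(1) KQs[of \<xi>] by blast
      obtain k where k: "k \<in> K \<xi>" "(k, q) \<notin> P" using unb[OF q(1)] by blast
      have "(u, k) \<in> P" if u: "u \<in> U" for u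
      proof -
        have "(u, k) \<in> P \<or> (k, u) \<in> P" using chain[of \<xi>] u U(1) k(1) unfolding Chains_def by blast
        moreover have "(k, u) \<notin> P" using k(2) q(2) u transD[OF tr] by blast
        ultimately show ?thesis by blast
      qed
      then show ?thesis using k(1) by blast
    qed
  qed
qed

text \<open>The partition relation \<nu> \<rightarrow> (\<nu>, \<omega>) for regular \<nu>. Unless
  an infinite independent sequence exists, \<open>A\<close> shrinks to a \<open>B\<close> in which
  each vertex has fewer than \<nu> non-neighbours. A maximal greedy clique in \<open>B\<close> then
  has size at least \<nu>: the non-neighbours of a smaller one would, by regularity, be too few to
  cover the rest of \<open>B\<close>.\<close>

lemma dushnik_miller_regular:
  fixes E :: "'b \<Rightarrow> 'b \<Rightarrow> bool"
  assumes \<nu>: "Cinfinite \<nu>" and cof: "\<nu> \<le>o cofinality \<nu>" and A: "\<not> |A| <o \<nu>"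
    and sym: "\<And>a b. E a b \<Longrightarrow> E b a"
    and no_seq: "\<And>s :: nat \<Rightarrow> 'b. (\<And>n. s n \<in> A) \<Longrightarrow> \<exists>m n. m < n \<and> (s m = s n \<or> E (s m) (s n))"
  shows "\<exists>H\<subseteq>A. \<not> |H| <o \<nu> \<and> (\<forall>a\<in>H. \<forall>b\<in>H. a \<noteq> b \<longrightarrow> E a b)"
proof -
  have "\<exists>B\<subseteq>A. \<not> |B| <o \<nu> \<and> (\<forall>a\<in>B. |{b \<in> B. a \<noteq> b \<and> \<not> E a b}| <o \<nu>)"
  proof (rule ccontr)
    assume no: "\<not> ?thesis"
    have "\<exists>s :: nat \<Rightarrow> 'b. (\<forall>n. s n \<in> A) \<and> (\<forall>m n. m < n \<longrightarrow> s m \<noteq> s n \<and> \<not> E (s m) (s n))"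
    proof (rule homogeneous_sequence[where B = "\<lambda>B. \<not> |B| <o \<nu>"])
      show "\<not> |A| <o \<nu>" by (rule A)
      show "\<exists>a\<in>B. \<not> |{b \<in> B. a \<noteq> b \<and> \<not> E a b}| <o \<nu>" if "B \<subseteq> A" "\<not> |B| <o \<nu>" for B
      proof (rule ccontr)
        assume "\<not> ?thesis"
        then have "\<forall>a\<in>B. |{b \<in> B. a \<noteq> b \<and> \<not> E a b}| <o \<nu>" by simp
        then show False using no that by (meson)
      qed
    qed
    then obtain s :: "nat \<Rightarrow> 'b" where "\<And>n. s n \<in> A" "\<And>m n. m < n \<Longrightarrow> s m \<noteq> s n \<and> \<not> E (s m) (s n)"
      by blast
    then show False using no_seq[of s] by blast
  qed
  then obtain B where B: "B \<subseteq> A" "\<not> |B| <o \<nu>" "\<And>a. a \<in> B \<Longrightarrow> |{b \<in> B. a \<noteq> b \<and> \<not> E a b}| <o \<nu>"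
    by blast
  obtain W :: "'b rel" and X where W: "Well_order W" "Field W = UNIV" and X: "X \<subseteq> B"
    "\<And>x y. x \<in> X \<Longrightarrow> y \<in> X \<Longrightarrow> (x, y) \<in> W - Id \<Longrightarrow> E x y"
    "\<And>q. q \<in> B \<Longrightarrow> q \<notin> X \<Longrightarrow> \<exists>x\<in>X. \<not> E x q"
    using greedy_well_ordered_subset[of B E] by metis
  have totW: "x = y \<or> (x, y) \<in> W - Id \<or> (y, x) \<in> W - Id" for x y
    using W unfolding order_on_defs total_on_def by auto
  have "E a b" if "a \<in> X" "b \<in> X" "a \<noteq> b" for a b
    using totW[of a b] X(2)[of a b] X(2)[of b a] sym that by blast
  moreover have "\<not> |X| <o \<nu>"
  proof
    assume Xlt: "|X| <o \<nu>"
    have "|\<Union>x\<in>X. {b \<in> B. x \<noteq> b \<and> \<not> E x b}| <o \<nu>"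
      by (rule card_of_UNION_less_cofinality[OF \<nu> ordLess_ordLeq_trans[OF Xlt cof]])
        (use B(3) X(1) in blast)
    then have "|X \<union> (\<Union>x\<in>X. {b \<in> B. x \<noteq> b \<and> \<not> E x b})| <o \<nu>"
      using \<nu> Xlt by (intro card_of_Un_ordLess_infinite_Field) (auto simp: cinfinite_def)
    moreover have "B \<subseteq> X \<union> (\<Union>x\<in>X. {b \<in> B. x \<noteq> b \<and> \<not> E x b})" using X(3) by blast
    ultimately have "|B| <o \<nu>" by (rule ordLeq_ordLess_trans[OF card_of_mono1, rotated])
    then show False using B(2) by contradiction
  qed
  ultimately show ?thesis using X(1) B(1) by blast
qed

subsection \<open>Copies of the pairs poset\<close>

text \<open>The equivalence forces injectivity when \<open>R\<close> is antisymmetric and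
  \<open>P\<close> is reflexive on the image. The target set allows copies to be located inside a
  given block.\<close>

definition embeds_into :: "'c rel \<Rightarrow> 'a rel \<Rightarrow> 'a set \<Rightarrow> bool" where
  "embeds_into R P S \<longleftrightarrow>
     (\<exists>f. f ` Field R \<subseteq> S \<and> (\<forall>x\<in>Field R. \<forall>y\<in>Field R. (f x, f y) \<in> P \<longleftrightarrow> (x, y) \<in> R))"

lemma contains_copy_iff_embeds_into:
  assumes P: "Partial_order P" and R: "antisym R"
  shows "contains_copy P R \<longleftrightarrow> embeds_into R P (Field P)"
proof
  assume "contains_copy P R"
  then obtain S f where S: "S \<subseteq> Field P" and f: "iso R (Restr P S) f"
    unfolding contains_copy_def by blast
  have "Field (Restr P S) \<subseteq> S" unfolding Field_def by blast
  then show "embeds_into R P (Field P)" using S f unfolding embeds_into_def iso_iff2 bij_betw_def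
    by (intro exI[of _ f]) blast
next
  assume "embeds_into R P (Field P)"
  then obtain f where f: "f ` Field R \<subseteq> Field P"
    "\<forall>x\<in>Field R. \<forall>y\<in>Field R. (f x, f y) \<in> P \<longleftrightarrow> (x, y) \<in> R" unfolding embeds_into_def by blast
  have refl: "(x, x) \<in> P" if "x \<in> Field P" for x
    using P that by (auto simp: order_on_defs refl_on_def)
  have "x = y" if "x \<in> Field R" "y \<in> Field R" "f x = f y" for x y
  proof -
    have "f x \<in> Field P" using f(1) that(1) by blast
    then have "(f x, f y) \<in> P" "(f y, f x) \<in> P" using refl that(3) by simp_all
    then show ?thesis using f(2) that antisymD[OF R] by blast
  qed
  then have "inj_on f (Field R)" by (rule inj_onI)
  moreover have "Field (Restr P (f ` Field R)) = f ` Field R"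
    using refl f(1) unfolding Field_def by blast
  ultimately have "iso R (Restr P (f ` Field R)) f"
    using f(2) unfolding iso_iff2 bij_betw_def by auto
  then show "contains_copy P R" using f(1) unfolding contains_copy_def by blast
qed

lemma Field_pairs_poset:
  assumes "Well_order \<nu>" shows "Field (pairs_poset \<nu>) = \<nu> - Id"
proof -
  have "(a, a) \<in> \<nu>" if "a \<in> Field \<nu>" for a using assms that by (auto simp: order_on_defs refl_on_def)
  then have "((a, b), (a, b)) \<in> pairs_poset \<nu>" if "(a, b) \<in> \<nu> - Id" for a b
    using that unfolding pairs_poset_def by (auto simp: FieldI1 FieldI2)
  then have "\<nu> - Id \<subseteq> Field (pairs_poset \<nu>)" by (auto intro: FieldI1)
  moreover have "Field (pairs_poset \<nu>) \<subseteq> \<nu> - Id" unfolding Field_def pairs_poset_def by auto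
  ultimately show ?thesis by blast
qed

lemma antisym_pairs_poset: "antisym \<nu> \<Longrightarrow> antisym (pairs_poset \<nu>)"
  unfolding antisym_def pairs_poset_def by auto

text \<open>
  The image of \<open>(\<xi>, \<beta>)\<close> is chosen in \<open>K \<xi>\<close> by recursion on \<open>(\<beta>, \<xi>)\<close>, lexicographically: each of the
  fewer than \<open>\<nu>\<close> earlier choices imposes a condition that holds on a final segment of \<open>K \<xi>\<close>.
\<close>

lemma pairs_poset_embeds_in_ladder:
  fixes P :: "'a rel" and \<nu> :: "'b rel" and K :: "'b \<Rightarrow> 'a set"
  assumes P: "Partial_order P" and \<nu>: "Cinfinite \<nu>" and Q: "Q \<subseteq> Field P"
    and KQ: "\<And>\<xi>. \<xi> \<in> Field \<nu> \<Longrightarrow> K \<xi> \<subseteq> Q" and chain: "\<And>\<xi>. \<xi> \<in> Field \<nu> \<Longrightarrow> K \<xi> \<in> Chains P"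
    and below: "\<And>\<eta> \<xi> y k. (\<eta>, \<xi>) \<in> \<nu> - Id \<Longrightarrow> y \<in> K \<xi> \<Longrightarrow> k \<in> K \<eta> \<Longrightarrow> (y, k) \<notin> P"
    and unb: "\<And>\<eta> \<xi> y. (\<eta>, \<xi>) \<in> \<nu> \<Longrightarrow> y \<in> K \<xi> \<Longrightarrow> \<exists>k\<in>K \<eta>. (k, y) \<notin> P"
    and dir: "\<And>\<xi> U. \<xi> \<in> Field \<nu> \<Longrightarrow> U \<subseteq> K \<xi> \<Longrightarrow> |U| <o \<nu> \<Longrightarrow> \<exists>k\<in>K \<xi>. \<forall>u\<in>U. (u, k) \<in> P"
    and dom: "\<And>\<eta> \<xi> k. (\<eta>, \<xi>) \<in> \<nu> - Id \<Longrightarrow> k \<in> K \<eta> \<Longrightarrow> \<exists>k'\<in>K \<xi>. (k, k') \<in> P"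
  shows "embeds_into (pairs_poset \<nu>) P Q"
proof -
  have tr: "trans P" and asym: "antisym P" using P by (auto simp: order_on_defs)
  have refl: "(x, x) \<in> P" if "x \<in> Q" for x
    using P Q that unfolding order_on_defs refl_on_def by blast
  have wo: "Well_order \<nu>" using \<nu> by (simp add: card_order_on_well_order_on)
  then have wf: "wf (\<nu> - Id)" and tr\<nu>: "trans \<nu>" and as\<nu>: "antisym \<nu>" by (auto simp: order_on_defs)
  have tot: "\<xi> = \<eta> \<or> (\<xi>, \<eta>) \<in> \<nu> - Id \<or> (\<eta>, \<xi>) \<in> \<nu> - Id"
    if "\<xi> \<in> Field \<nu>" "\<eta> \<in> Field \<nu>" for \<xi> \<eta>
    using wo that unfolding order_on_defs total_on_def by blast
  let ?R = "(\<nu> - Id) <*lex*> (\<nu> - Id)"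
  \<comment> \<open>An earlier choice at \<open>(\<xi>', \<beta>')\<close> has \<beta>' \<le>
    \<beta>. If \<xi>' \<le> \<xi>, it must lie strictly below \<open>r\<close>. If \<xi>' is larger
    than \<xi>, the two points must be incomparable; the ladder excludes one direction and the
    second clause excludes the other.\<close>
  define cond where "cond \<xi> r p \<longleftrightarrow>
    ((snd (fst p), \<xi>) \<in> \<nu> \<longrightarrow> (snd p, r) \<in> P \<and> snd p \<noteq> r) \<and>
    ((\<xi>, snd (fst p)) \<in> \<nu> - Id \<longrightarrow> (r, snd p) \<notin> P)" for \<xi> r and p :: "('b \<times> 'b) \<times> 'a"
  define good where "good k p r \<longleftrightarrow> ((snd p, fst p) \<in> \<nu> - Id \<longrightarrow>
     r \<in> K (snd p) \<and>
     (\<forall>p'. (p', p) \<in> ?R \<longrightarrow> (snd p', fst p') \<in> \<nu> - Id \<longrightarrow> cond (snd p) r (p', k p')))"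
    for k :: "'b \<times> 'b \<Rightarrow> 'a" and p r
  have "\<exists>k. \<forall>p. good k p (k p)"
  proof (rule dependent_wf_choice)
    show "wf ?R" using wf wf by (rule wf_lex_prod)
    show "good f p r = good g p r" if "\<And>p'. (p', p) \<in> ?R \<Longrightarrow> f p' = g p'" for f g p r
      using that unfolding good_def by simp
    fix p and k :: "'b \<times> 'b \<Rightarrow> 'a"
    assume IH: "\<And>p'. (p', p) \<in> ?R \<Longrightarrow> good k p' (k p')"
    obtain \<beta> \<xi> where p: "p = (\<beta>, \<xi>)" by (cases p)
    show "\<exists>r. good k p r"
    proof (cases "(\<xi>, \<beta>) \<in> \<nu> - Id")
      case False
      then show ?thesis unfolding good_def p by auto
    next
      case True
      then have F: "\<xi> \<in> Field \<nu>" "\<beta> \<in> Field \<nu>" by (auto simp: FieldI1 FieldI2)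
      define D where "D = {p'. (p', p) \<in> ?R \<and> (snd p', fst p') \<in> \<nu> - Id}"
      have "\<exists>t\<in>K \<xi>. \<forall>r\<in>K \<xi>. (t, r) \<in> P \<longrightarrow> cond \<xi> r (p', k p')" if p': "p' \<in> D" for p'
      proof -
        obtain \<beta>' \<xi>' where p'eq: "p' = (\<beta>', \<xi>')" by (cases p')
        have v: "(\<xi>', \<beta>') \<in> \<nu> - Id" using p' unfolding D_def p'eq by simp
        then have F': "\<xi>' \<in> Field \<nu>" by (auto simp: FieldI1)
        have k: "k p' \<in> K \<xi>'" using IH[of p'] p' v unfolding D_def good_def p'eq by simp
        \<comment> \<open>For the same chain or a later one, \<open>t\<close> comes from
          unboundedness of \<open>K \<xi>\<close>; for an earlier chain it comes from
          domination.\<close>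
        consider "\<xi>' = \<xi>" | "(\<xi>', \<xi>) \<in> \<nu> - Id" | "(\<xi>, \<xi>') \<in> \<nu> - Id" using tot[OF F(1) F'] by blast
        then show ?thesis
        proof cases
          case 1
          have "(\<xi>, \<xi>) \<in> \<nu>" using wo F(1) by (auto simp: order_on_defs refl_on_def)
          then obtain t where t: "t \<in> K \<xi>" "(t, k p') \<notin> P" using unb[of \<xi> \<xi> "k p'"] k 1 by blast
          then have kt: "(k p', t) \<in> P" using chain[OF F(1)] k 1 unfolding Chains_def by blast
          have "cond \<xi> r (p', k p')" if "r \<in> K \<xi>" "(t, r) \<in> P" for r
          proof -
            have "(k p', r) \<in> P" by (rule transD[OF tr kt that(2)])
            moreover have "k p' \<noteq> r" using t(2) that(2) by blast
            ultimately show ?thesis unfolding cond_def p'eq using 1 by simp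
          qed
          then show ?thesis using t(1) by blast
        next
          case 2
          obtain t where t: "t \<in> K \<xi>" "(k p', t) \<in> P" using dom[OF 2 k] by blast
          have "cond \<xi> r (p', k p')" if "r \<in> K \<xi>" "(t, r) \<in> P" for r
          proof -
            have "(k p', r) \<in> P" by (rule transD[OF tr t(2) that(2)])
            moreover have "(r, k p') \<notin> P" using below[OF 2 that(1) k] .
            moreover have "(\<xi>, \<xi>') \<notin> \<nu> - Id" using 2 antisymD[OF as\<nu>] by blast
            ultimately show ?thesis unfolding cond_def p'eq by auto
          qed
          then show ?thesis using t(1) by blast
        next
          case 3
          then obtain t where t: "t \<in> K \<xi>" "(t, k p') \<notin> P" using unb[of \<xi> \<xi>' "k p'"] k by blast
          have "cond \<xi> r (p', k p')" if "r \<in> K \<xi>" "(t, r) \<in> P" for r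
          proof -
            have "(r, k p') \<notin> P" using transD[OF tr that(2)] t(2) by blast
            moreover have "(\<xi>', \<xi>) \<notin> \<nu>" using 3 antisymD[OF as\<nu>] by blast
            ultimately show ?thesis unfolding cond_def p'eq by simp
          qed
          then show ?thesis using t(1) by blast
        qed
      qed
      then have "\<forall>p'\<in>D. \<exists>t. t \<in> K \<xi> \<and> (\<forall>r\<in>K \<xi>. (t, r) \<in> P \<longrightarrow> cond \<xi> r (p', k p'))" by blast
      from this[unfolded bchoice_iff] obtain t
        where t: "\<forall>p'\<in>D. t p' \<in> K \<xi> \<and> (\<forall>r\<in>K \<xi>. (t p', r) \<in> P \<longrightarrow> cond \<xi> r (p', k p'))" by (elim exE)
      let ?B = "insert \<beta> (underS \<nu> \<beta>)"
      have "|?B| <o \<nu>"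
      proof -
        have "|underS \<nu> \<beta>| <o \<nu>" using \<nu> F by (simp add: card_of_underS)
        then have "|{\<beta>} \<union> underS \<nu> \<beta>| <o \<nu>" using \<nu> finite_ordLess_Cinfinite[OF _ \<nu>, of "{\<beta>}"]
          by (intro card_of_Un_ordLess_infinite_Field) (auto simp: cinfinite_def)
        then show ?thesis by simp
      qed
      \<comment> \<open>Earlier positions satisfy \<xi>' < \<beta>' \<le> \<beta>, so they lie in a
        square of size below \<nu>. This is why \<beta> is the leading coordinate of the
        recursion.\<close>
      have "D \<subseteq> ?B \<times> ?B"
      proof
        fix p' assume p': "p' \<in> D"
        obtain \<beta>' \<xi>' where p'eq: "p' = (\<beta>', \<xi>')" by (cases p')
        have b: "\<beta>' = \<beta> \<or> (\<beta>', \<beta>) \<in> \<nu> - Id" and x: "(\<xi>', \<beta>') \<in> \<nu> - Id"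
          using p' unfolding D_def p'eq p by auto
        then have "(\<xi>', \<beta>) \<in> \<nu> - Id" using transD[OF tr\<nu>] antisymD[OF as\<nu>] by blast
        then show "p' \<in> ?B \<times> ?B" using b unfolding p'eq underS_def by auto
      qed
      moreover have "|?B \<times> ?B| <o \<nu>" by (rule card_of_Times_ordLess_infinite[OF \<nu>]) fact+
      ultimately have "|D| <o \<nu>" by (rule ordLeq_ordLess_trans[OF card_of_mono1])
      then have "|t ` D| <o \<nu>" by (rule ordLeq_ordLess_trans[OF card_of_image])
      then have "\<exists>r\<in>K \<xi>. \<forall>u\<in>t ` D. (u, r) \<in> P" using t by (intro dir F) auto
      then obtain r where r: "r \<in> K \<xi>" "\<And>p'. p' \<in> D \<Longrightarrow> (t p', r) \<in> P" by auto
      have "cond \<xi> r (p', k p')" if "p' \<in> D" for p' using t r that by blast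
      then have "good k p r" using r(1) unfolding good_def D_def p by auto
      then show ?thesis by blast
    qed
  qed
  then obtain k where k: "\<And>p. good k p (k p)" by blast
  define F where "F p = k (snd p, fst p)" for p
  have FK: "F (\<xi>, \<beta>) \<in> K \<xi>" if "(\<xi>, \<beta>) \<in> \<nu> - Id" for \<xi> \<beta>
    using k[of "(\<beta>, \<xi>)"] that unfolding F_def good_def by simp
  have Fcond: "((\<xi>', \<xi>) \<in> \<nu> \<longrightarrow> (F (\<xi>', \<beta>'), F (\<xi>, \<beta>)) \<in> P \<and> F (\<xi>', \<beta>') \<noteq> F (\<xi>, \<beta>)) \<and>
      ((\<xi>, \<xi>') \<in> \<nu> - Id \<longrightarrow> (F (\<xi>, \<beta>), F (\<xi>', \<beta>')) \<notin> P)"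
    if "(\<xi>, \<beta>) \<in> \<nu> - Id" "(\<xi>', \<beta>') \<in> \<nu> - Id" "((\<beta>', \<xi>'), (\<beta>, \<xi>)) \<in> ?R" for \<xi> \<beta> \<xi>' \<beta>'
  proof -
    have "\<forall>p'. (p', (\<beta>, \<xi>)) \<in> ?R \<longrightarrow> (snd p', fst p') \<in> \<nu> - Id \<longrightarrow> cond \<xi> (k (\<beta>, \<xi>)) (p', k p')"
      using k[of "(\<beta>, \<xi>)"] that(1) unfolding good_def fst_conv snd_conv by (rule mp[THEN conjunct2])
    then have "cond \<xi> (k (\<beta>, \<xi>)) ((\<beta>', \<xi>'), k (\<beta>', \<xi>'))"
      using that(2,3) unfolding fst_conv snd_conv by (metis fst_conv snd_conv)
    then show ?thesis unfolding F_def cond_def fst_conv snd_conv .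
  qed
  have iff: "(F (\<xi>, \<beta>), F (\<xi>', \<beta>')) \<in> P \<longleftrightarrow> (\<xi>, \<xi>') \<in> \<nu> \<and> (\<beta>, \<beta>') \<in> \<nu>"
    if v: "(\<xi>, \<beta>) \<in> \<nu> - Id" "(\<xi>', \<beta>') \<in> \<nu> - Id" for \<xi> \<beta> \<xi>' \<beta>'
  proof
    assume "(\<xi>, \<xi>') \<in> \<nu> \<and> (\<beta>, \<beta>') \<in> \<nu>"
    moreover have "(F (\<xi>, \<beta>), F (\<xi>, \<beta>)) \<in> P"
    proof (rule refl)
      have "\<xi> \<in> Field \<nu>" using v(1) by (auto simp: FieldI1)
      then show "F (\<xi>, \<beta>) \<in> Q" using FK[OF v(1)] KQ by blast
    qed
    ultimately show "(F (\<xi>, \<beta>), F (\<xi>', \<beta>')) \<in> P"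
      using Fcond[OF v(2) v(1)] by (cases "\<xi> = \<xi>' \<and> \<beta> = \<beta>'") auto
  next
    assume le: "(F (\<xi>, \<beta>), F (\<xi>', \<beta>')) \<in> P"
    have fields: "\<xi> \<in> Field \<nu>" "\<xi>' \<in> Field \<nu>" "\<beta> \<in> Field \<nu>" "\<beta>' \<in> Field \<nu>"
      using v by (auto simp: FieldI1 FieldI2)
    have \<xi>: "(\<xi>, \<xi>') \<in> \<nu>"
    proof -
      have "(\<xi>', \<xi>) \<notin> \<nu> - Id" using below[OF _ FK[OF v(1)] FK[OF v(2)]] le by blast
      moreover have "(\<xi>, \<xi>) \<in> \<nu>" using wo fields by (auto simp: order_on_defs refl_on_def)
      ultimately show ?thesis using tot[OF fields(1,2)] by auto
    qed
    have "(\<beta>', \<beta>) \<notin> \<nu> - Id"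
    proof
      assume "(\<beta>', \<beta>) \<in> \<nu> - Id"
      then have R: "((\<beta>', \<xi>'), (\<beta>, \<xi>)) \<in> ?R" by simp
      note c = Fcond[OF v R]
      have "\<xi> = \<xi>'" using c \<xi> le by blast
      then have "(F (\<xi>', \<beta>'), F (\<xi>, \<beta>)) \<in> P" "F (\<xi>', \<beta>') \<noteq> F (\<xi>, \<beta>)" using c \<xi> by blast+
      then show False using le antisymD[OF asym] by blast
    qed
    moreover have "(\<beta>, \<beta>) \<in> \<nu>" using wo fields by (auto simp: order_on_defs refl_on_def)
    ultimately have "(\<beta>, \<beta>') \<in> \<nu>" using tot[OF fields(3,4)] by auto
    with \<xi> show "(\<xi>, \<xi>') \<in> \<nu> \<and> (\<beta>, \<beta>') \<in> \<nu>" by blast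
  qed
  show ?thesis
    unfolding embeds_into_def Field_pairs_poset[OF wo]
  proof (intro exI[of _ F] conjI ballI subsetI)
    fix x assume "x \<in> F ` (\<nu> - Id)"
    then obtain \<xi> \<beta> where x: "x = F (\<xi>, \<beta>)" "(\<xi>, \<beta>) \<in> \<nu> - Id" by auto
    then have "\<xi> \<in> Field \<nu>" by (auto simp: FieldI1)
    then show "x \<in> Q" using FK[OF x(2)] KQ x(1) by blast
  next
    fix p p' assume "p \<in> \<nu> - Id" "p' \<in> \<nu> - Id"
    then show "(F p, F p') \<in> P \<longleftrightarrow> (p, p') \<in> pairs_poset \<nu>"
      using iff[of "fst p" "snd p" "fst p'" "snd p'"]
      by (cases p; cases p') (auto simp: pairs_poset_def)
  qed
qed

section \<open>From upward sets to copies of the pairs poset\<close>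

lemma no_infinite_antichain_converse [simp]:
  "no_infinite_antichain (P\<inverse>) = no_infinite_antichain P"
proof -
  have "(\<forall>x\<in>A. \<forall>y\<in>A. x \<noteq> y \<longrightarrow> (x, y) \<notin> P\<inverse>) \<longleftrightarrow> (\<forall>x\<in>A. \<forall>y\<in>A. x \<noteq> y \<longrightarrow> (x, y) \<notin> P)" for A
    by auto
  then show ?thesis unfolding no_infinite_antichain_def by simp
qed

lemma embeds_into_subset: "embeds_into R P S \<Longrightarrow> S \<subseteq> T \<Longrightarrow> embeds_into R P T"
  unfolding embeds_into_def by (meson subset_trans)

text \<open>An initial ordinal is the shortest well-order of its cardinality, so \<nu> embeds into
  the order induced on \<open>H\<close>.\<close>

lemma exists_order_embedding_into_large_subset:
  assumes \<nu>: "Cinfinite \<nu>" and H: "H \<subseteq> Field \<nu>" "\<not> |H| <o \<nu>"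
  obtains f where "\<And>\<xi>. \<xi> \<in> Field \<nu> \<Longrightarrow> f \<xi> \<in> H"
    "\<And>\<eta> \<xi>. (\<eta>, \<xi>) \<in> \<nu> - Id \<Longrightarrow> (f \<eta>, f \<xi>) \<in> \<nu> - Id"
proof -
  have wo: "Well_order \<nu>" using \<nu> by (simp add: card_order_on_well_order_on)
  let ?r = "Restr \<nu> H"
  have F: "Field ?r = H" using wo H(1) by (intro Refl_Field_Restr2) (auto simp: order_on_defs)
  have wor: "well_order_on H ?r" using Well_order_Restr[OF wo, of H] F by simp
  have "\<nu> \<le>o |H|" using H(2) by (rule iffD1[OF not_ordLess_iff_ordLeq[OF wo card_of_Well_order]])
  then have "\<nu> \<le>o ?r" by (rule ordLeq_transitive[OF _ card_of_least[OF wor]])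
  then obtain f where f: "embed \<nu> ?r f" unfolding ordLeq_def by blast
  have fF: "f \<xi> \<in> H" if "\<xi> \<in> Field \<nu>" for \<xi> using embed_in_Field[OF f that] F by simp
  have "(f \<eta>, f \<xi>) \<in> \<nu> - Id" if "(\<eta>, \<xi>) \<in> \<nu> - Id" for \<eta> \<xi>
  proof -
    have "(f \<eta>, f \<xi>) \<in> \<nu>" using embed_compat[OF f] that unfolding compat_def by blast
    moreover have "\<eta> \<in> Field \<nu>" "\<xi> \<in> Field \<nu>" using that by (auto simp: FieldI1 FieldI2)
    then have "f \<eta> \<noteq> f \<xi>" using embed_inj_on[OF wo f] that unfolding inj_on_def by blast
    ultimately show ?thesis by blast
  qed
  with fF show thesis by (rule that)
qed

text \<open>Suppose infinitely many chains pairwise fail to be dominated. For each later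
  \<open>s j\<close>, the chain \<open>K (s i)\<close> has a witness \<open>c i j\<close> below no
  point of \<open>K (s j)\<close>. As \<nu> is uncountable, some \<open>x i\<close> in
  \<open>K (s i)\<close> is above all \<open>c i j\<close>, and the \<open>x i\<close> form an
  infinite antichain. So Dushnik-Miller yields \<nu> many chains, each dominated by all later
  ones.\<close>

lemma pairs_poset_embeds_into_upward:
  fixes P :: "'a rel" and \<nu> :: "'b rel" and \<kappa> :: "'k rel"
  assumes P: "Partial_order P" and fac: "no_infinite_antichain P"
    and \<kappa>: "Cinfinite \<kappa>" and suc: "\<nu> =o cardSuc \<kappa>" and Q: "upward P \<nu> Q"
  shows "embeds_into (pairs_poset \<nu>) P Q"
proof -
  have \<nu>: "Cinfinite \<nu>" by (rule successor_Cinfinite[OF \<kappa> suc])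
  have cof: "\<nu> \<le>o cofinality \<nu>" by (rule successor_le_cofinality[OF \<kappa> suc])
  have tr: "trans P" using P by (auto simp: order_on_defs)
  have wo: "Well_order \<nu>" using \<nu> by (simp add: card_order_on_well_order_on)
  then have as\<nu>: "antisym \<nu>" by (auto simp: order_on_defs)
  have tot: "\<xi> = \<eta> \<or> (\<xi>, \<eta>) \<in> \<nu> - Id \<or> (\<eta>, \<xi>) \<in> \<nu> - Id"
    if "\<xi> \<in> Field \<nu>" "\<eta> \<in> Field \<nu>" for \<xi> \<eta>
    using wo that unfolding order_on_defs total_on_def by blast
  from exists_chain_ladder[OF P \<kappa> suc Q] obtain K :: "'b \<Rightarrow> 'a set"
    where K: "(\<forall>\<xi>. K \<xi> \<subseteq> Q \<and> K \<xi> \<in> Chains P) \<and>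
    (\<forall>\<eta> \<xi>. (\<eta>, \<xi>) \<in> \<nu> - Id \<longrightarrow> (\<forall>y\<in>K \<xi>. \<forall>k\<in>K \<eta>. (y, k) \<notin> P)) \<and>
    (\<forall>\<eta> \<xi>. (\<eta>, \<xi>) \<in> \<nu> \<longrightarrow> (\<forall>y\<in>K \<xi>. \<exists>k\<in>K \<eta>. (k, y) \<notin> P)) \<and>
    (\<forall>\<xi> U. U \<subseteq> K \<xi> \<longrightarrow> |U| <o \<nu> \<longrightarrow> (\<exists>k\<in>K \<xi>. \<forall>u\<in>U. (u, k) \<in> P))" by (elim exE)
  have KQ: "K \<xi> \<subseteq> Q" and chain: "K \<xi> \<in> Chains P" for \<xi> using K by simp_all
  have below: "(y, k) \<notin> P" if "(\<eta>, \<xi>) \<in> \<nu> - Id" "y \<in> K \<xi>" "k \<in> K \<eta>" for \<eta> \<xi> y k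
    using K that by simp
  have unb: "\<exists>k\<in>K \<eta>. (k, y) \<notin> P" if "(\<eta>, \<xi>) \<in> \<nu>" "y \<in> K \<xi>" for \<eta> \<xi> y using K that by simp
  have dir: "\<exists>k\<in>K \<xi>. \<forall>u\<in>U. (u, k) \<in> P" if "U \<subseteq> K \<xi>" "|U| <o \<nu>" for \<xi> U using K that by simp
  have QP: "Q \<subseteq> Field P" using Q unfolding upward_def by blast
  have K_ne: "\<exists>k. k \<in> K \<xi>" for \<xi>
    using dir[OF _ finite_ordLess_Cinfinite[OF _ \<nu>], of "{}" \<xi>] by auto
  define dom where "dom \<eta> \<xi> \<longleftrightarrow> (\<forall>k\<in>K \<eta>. \<exists>k'\<in>K \<xi>. (k, k') \<in> P)" for \<eta> \<xi>
  define E where "E \<eta> \<xi> \<longleftrightarrow> ((\<eta>, \<xi>) \<in> \<nu> - Id \<longrightarrow> dom \<eta> \<xi>) \<and> ((\<xi>, \<eta>) \<in> \<nu> - Id \<longrightarrow> dom \<xi> \<eta>)"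
    for \<eta> \<xi>
  have E_sym: "E b a" if "E a b" for a b using that unfolding E_def by blast
  have "\<exists>H\<subseteq>Field \<nu>. \<not> |H| <o \<nu> \<and> (\<forall>a\<in>H. \<forall>b\<in>H. a \<noteq> b \<longrightarrow> E a b)"
  proof (rule dushnik_miller_regular[OF \<nu> cof])
    show "\<not> |Field \<nu>| <o \<nu>" using \<nu> by (auto dest: not_ordLess_ordIso simp: card_of_Field_ordIso)
    show "E b a" if "E a b" for a b using that by (rule E_sym)
    fix s :: "nat \<Rightarrow> 'b"
    assume sF: "\<And>n. s n \<in> Field \<nu>"
    show "\<exists>m n. m < n \<and> (s m = s n \<or> E (s m) (s n))"
    proof (rule ccontr)
      assume no: "\<not> ?thesis"
      have notE: "s m \<noteq> s n \<and> \<not> E (s m) (s n)" if "m \<noteq> n" for m n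
      proof (cases "m < n")
        case True then show ?thesis using no by blast
      next
        case False
        then have "s n \<noteq> s m \<and> \<not> E (s n) (s m)" using no that by (meson linorder_neqE_nat)
        then show ?thesis using E_sym[of "s m" "s n"] by auto
      qed
      have "\<exists>k\<in>K (s i). (s i, s j) \<in> \<nu> - Id \<longrightarrow> (\<forall>k'\<in>K (s j). (k, k') \<notin> P)" for i j
      proof (cases "(s i, s j) \<in> \<nu> - Id")
        case False then show ?thesis using K_ne by blast
      next
        case True
        then have "i \<noteq> j" "(s j, s i) \<notin> \<nu> - Id" using antisymD[OF as\<nu>] by blast+
        then have "\<not> dom (s i) (s j)" using notE[of i j] unfolding E_def by blast
        then show ?thesis unfolding dom_def by blast
      qed
      then have "\<forall>i j. \<exists>k. k \<in> K (s i) \<and> ((s i, s j) \<in> \<nu> - Id \<longrightarrow> (\<forall>k'\<in>K (s j). (k, k') \<notin> P))"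
        by blast
      from this[unfolded choice_iff] obtain c where
        "\<forall>i j. c i j \<in> K (s i) \<and> ((s i, s j) \<in> \<nu> - Id \<longrightarrow> (\<forall>k'\<in>K (s j). (c i j, k') \<notin> P))"
        by (elim exE)
      then have c: "\<And>i j. c i j \<in> K (s i)"
        "\<And>i j k'. (s i, s j) \<in> \<nu> - Id \<Longrightarrow> k' \<in> K (s j) \<Longrightarrow> (c i j, k') \<notin> P" by blast+
      have "\<exists>x. x \<in> K (s i) \<and> (\<forall>j. (c i j, x) \<in> P)" for i
      proof -
        have "|range (c i)| \<le>o |UNIV :: nat set|" by (rule card_of_image)
        then have "|range (c i)| \<le>o natLeq" by (rule ordLeq_ordIso_trans[OF _ card_of_nat])
        then have "|range (c i)| <o \<nu>"
          by (rule ordLeq_ordLess_trans[OF _ natLeq_ordLess_successor[OF \<kappa> suc]])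
        then have "\<exists>k\<in>K (s i). \<forall>u\<in>range (c i). (u, k) \<in> P" using c(1) by (intro dir) auto
        then show ?thesis by auto
      qed
      then have "\<forall>i. \<exists>x. x \<in> K (s i) \<and> (\<forall>j. (c i j, x) \<in> P)" by blast
      from this[unfolded choice_iff] obtain x where
        "\<forall>i. x i \<in> K (s i) \<and> (\<forall>j. (c i j, x i) \<in> P)" by (elim exE)
      then have x: "\<And>i. x i \<in> K (s i)" "\<And>i j. (c i j, x i) \<in> P" by blast+
      have less: "(x i, x j) \<notin> P \<and> (x j, x i) \<notin> P" if "(s i, s j) \<in> \<nu> - Id" for i j
        using c(2)[OF that x(1)] x(2)[of i j] transD[OF tr] below[OF that x(1) x(1)] by blast
      have "x i \<in> Field P" for i using x(1) KQ QP by blast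
      from no_infinite_antichain_seq[OF P fac this] obtain m n
        where mn: "m < n" "(x m, x n) \<in> P \<or> (x n, x m) \<in> P" by blast
      then show False using tot[OF sF[of m] sF[of n]] notE[of m n] less[of m n] less[of n m] by blast
    qed
  qed
  then obtain H where H: "H \<subseteq> Field \<nu>" "\<not> |H| <o \<nu>" "\<And>a b. a \<in> H \<Longrightarrow> b \<in> H \<Longrightarrow> a \<noteq> b \<Longrightarrow> E a b"
    by blast
  obtain f where fH: "\<And>\<xi>. \<xi> \<in> Field \<nu> \<Longrightarrow> f \<xi> \<in> H"
    and f: "\<And>\<eta> \<xi>. (\<eta>, \<xi>) \<in> \<nu> - Id \<Longrightarrow> (f \<eta>, f \<xi>) \<in> \<nu> - Id"
    using exists_order_embedding_into_large_subset[OF \<nu> H(1,2)] by metis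
  show ?thesis
  proof (rule pairs_poset_embeds_in_ladder[OF P \<nu> QP, where K = "\<lambda>\<xi>. K (f \<xi>)"])
    fix \<eta> \<xi> y assume \<eta>\<xi>: "(\<eta>, \<xi>) \<in> \<nu>" and y: "y \<in> K (f \<xi>)"
    have "(f \<eta>, f \<xi>) \<in> \<nu>"
    proof (cases "\<eta> = \<xi>")
      case True
      have "f \<xi> \<in> Field \<nu>" using fH H(1) \<eta>\<xi> by (blast intro: FieldI2)
      then show ?thesis using True wo by (auto simp: order_on_defs refl_on_def)
    next
      case False then show ?thesis using f \<eta>\<xi> by blast
    qed
    then show "\<exists>k\<in>K (f \<eta>). (k, y) \<notin> P" using y by (rule unb)
  next
    fix \<eta> \<xi> k assume \<eta>\<xi>: "(\<eta>, \<xi>) \<in> \<nu> - Id" and k: "k \<in> K (f \<eta>)"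
    then have "f \<eta> \<in> H" "f \<xi> \<in> H" using fH by (auto simp: FieldI1 FieldI2)
    then have "dom (f \<eta>) (f \<xi>)" using H(3) f[OF \<eta>\<xi>] unfolding E_def by blast
    then show "\<exists>k'\<in>K (f \<xi>). (k, k') \<in> P" using k unfolding dom_def by blast
  next
    fix \<eta> \<xi> y k assume "(\<eta>, \<xi>) \<in> \<nu> - Id" "y \<in> K (f \<xi>)" "k \<in> K (f \<eta>)"
    then show "(y, k) \<notin> P" using below f by blast
  qed (use KQ chain dir in blast)+
qed

text \<open>Incomparable points are near, so points of different classes are comparable and the
  classes can serve as blocks. The bound \<kappa> is independent of the \<nu> that defines nearness;
  the limit case takes it below \<nu>.\<close>

lemma thin_of_thin_near_classes:
  fixes P :: "'a rel"
  assumes P: "Partial_order P" and \<nu>: "Cinfinite \<nu>" and S: "S \<subseteq> Field P"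
    and inc: "\<And>x. x \<in> S \<Longrightarrow> thin P \<nu> {y \<in> S. (x, y) \<notin> P \<and> (y, x) \<notin> P}"
    and \<kappa>: "Card_order \<kappa>"
    and cls: "\<And>x. x \<in> S \<Longrightarrow> thin P (cardSuc \<kappa>) {y \<in> S. near P \<nu> S y x}"
  shows "thin P (cardSuc \<kappa>) S"
proof (rule thin_blocks[OF \<kappa>, where b = "\<lambda>x. {y \<in> S. near P \<nu> S y x}"])
  note near = near_refl[OF P \<nu> S inc] near_sym[OF P \<nu> S inc] near_trans[OF P \<nu> S inc]
  fix x assume x: "x \<in> S"
  have "{y \<in> S. {z \<in> S. near P \<nu> S z y} = {z \<in> S. near P \<nu> S z x}} \<subseteq> {y \<in> S. near P \<nu> S y x}"
    using near(1) by blast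
  then show "thin P (cardSuc \<kappa>) {y \<in> S. {z \<in> S. near P \<nu> S z y} = {z \<in> S. near P \<nu> S z x}}"
    by (rule thin_subset[OF cls[OF x]])
  fix y assume y: "y \<in> S" and ne: "{z \<in> S. near P \<nu> S z x} \<noteq> {z \<in> S. near P \<nu> S z y}"
  show "(x, y) \<in> P \<or> (y, x) \<in> P"
  proof (rule ccontr)
    assume "\<not> ?thesis"
    then have "near P \<nu> S x y" using incomparable_near[OF P \<nu> S inc] by blast
    then have "near P \<nu> S z x \<longleftrightarrow> near P \<nu> S z y" if "z \<in> S" for z
      using near(2,3) x y that by blast
    then show False using ne by blast
  qed
qed

text \<open>For a successor of \<kappa>, every thin set is covered by at most \<kappa> chains. This
  bound is common to all thin near classes, so if all classes were thin then so would be
  \<open>T\<close>.\<close>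

theorem pairs_poset_embeds_of_not_thin:
  fixes P :: "'a rel" and \<nu> :: "'b rel" and \<kappa> :: "'k rel"
  assumes P: "Partial_order P" and fac: "no_infinite_antichain P"
    and \<kappa>: "Cinfinite \<kappa>" and suc: "\<nu> =o cardSuc \<kappa>" and S: "S \<subseteq> Field P" "\<not> thin P \<nu> S"
  shows "embeds_into (pairs_poset \<nu>) P S \<or> embeds_into (pairs_poset \<nu>) (P\<inverse>) S"
proof -
  have \<nu>: "Cinfinite \<nu>" by (rule successor_Cinfinite[OF \<kappa> suc])
  have le: "cardSuc \<kappa> \<le>o \<nu>" "\<nu> \<le>o cardSuc \<kappa>" using suc by (simp_all add: ordIso_iff_ordLeq)
  obtain T where T: "T \<subseteq> S" "\<not> thin P \<nu> T"
    and inc: "\<And>x. x \<in> T \<Longrightarrow> thin P \<nu> {y \<in> T. (x, y) \<notin> P \<and> (y, x) \<notin> P}"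
    using subset_with_thin_incomparables[OF P fac S] by blast
  have TP: "T \<subseteq> Field P" using T(1) S(1) by blast
  have "\<exists>x\<in>T. \<not> thin P \<nu> {y \<in> T. near P \<nu> T y x}"
  proof (rule ccontr)
    assume "\<not> ?thesis"
    then have "thin P (cardSuc \<kappa>) {y \<in> T. near P \<nu> T y x}" if "x \<in> T" for x
      using that thin_ordLeq[OF _ le(2)] by blast
    then have "thin P (cardSuc \<kappa>) T" using \<kappa> by (intro thin_of_thin_near_classes[OF P \<nu> TP inc]) auto
    then show False using thin_ordLeq[OF _ le(1)] T(2) by blast
  qed
  then obtain x where x: "x \<in> T" "\<not> thin P \<nu> {y \<in> T. near P \<nu> T y x}" by blast
  obtain Q where Q: "Q \<subseteq> T" "upward P \<nu> Q \<or> upward (P\<inverse>) \<nu> Q"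
    using upward_in_near_class[OF P \<nu> TP inc x] by blast
  have "embeds_into (pairs_poset \<nu>) P Q \<or> embeds_into (pairs_poset \<nu>) (P\<inverse>) Q"
    using Q(2) pairs_poset_embeds_into_upward[OF P fac \<kappa> suc]
      pairs_poset_embeds_into_upward[of "P\<inverse>", OF _ _ \<kappa> suc] P fac by auto
  moreover have "Q \<subseteq> S" using Q(1) T(1) by blast
  ultimately show ?thesis using embeds_into_subset by blast
qed

text \<open>Suppose fewer than \<nu> colours suffice. By regularity each row (pairs with fixed first
  entry \<alpha>) repeats some colour \<nu> times, and two rows \<alpha> < \<alpha>' repeat the same
  colour. For any \<beta>' with this colour in row \<alpha>', row \<alpha> has it at some \<beta>
  beyond \<beta>', and these two pairs are incomparable.\<close>

lemma not_thin_image_pairs_poset: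
  fixes P :: "'a rel" and \<nu> :: "'b rel"
  assumes \<nu>: "Cinfinite \<nu>" and cof: "\<nu> \<le>o cofinality \<nu>"
    and F: "\<And>x y. x \<in> Field (pairs_poset \<nu>) \<Longrightarrow> y \<in> Field (pairs_poset \<nu>) \<Longrightarrow>
      (F x, F y) \<in> P \<longleftrightarrow> (x, y) \<in> pairs_poset \<nu>"
  shows "\<not> thin P \<nu> (F ` Field (pairs_poset \<nu>))"
proof
  have wo: "Well_order \<nu>" using \<nu> by (simp add: card_order_on_well_order_on)
  have as\<nu>: "antisym \<nu>" using wo by (auto simp: order_on_defs)
  have tot: "\<xi> = \<eta> \<or> (\<xi>, \<eta>) \<in> \<nu> - Id \<or> (\<eta>, \<xi>) \<in> \<nu> - Id"
    if "\<xi> \<in> Field \<nu>" "\<eta> \<in> Field \<nu>" for \<xi> \<eta>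
    using wo that unfolding order_on_defs total_on_def by blast
  note FP = Field_pairs_poset[OF wo]
  have Un: "|A \<union> B| <o \<nu>" if "|A| <o \<nu>" "|B| <o \<nu>" for A B :: "'b set"
    using \<nu> that by (intro card_of_Un_ordLess_infinite_Field) (auto simp: cinfinite_def)
  have le_small: "|{\<beta>. (\<beta>, \<alpha>) \<in> \<nu>}| <o \<nu>" if "\<alpha> \<in> Field \<nu>" for \<alpha>
  proof -
    have "|underS \<nu> \<alpha>| <o \<nu>" using \<nu> that by (simp add: card_of_underS)
    then have "|{\<alpha>} \<union> underS \<nu> \<alpha>| <o \<nu>"
      by (intro Un[OF finite_ordLess_Cinfinite[OF _ \<nu>]]) simp_all
    moreover have "{\<beta>. (\<beta>, \<alpha>) \<in> \<nu>} \<subseteq> {\<alpha>} \<union> underS \<nu> \<alpha>" unfolding underS_def by blast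
    ultimately show ?thesis by (rule ordLeq_ordLess_trans[OF card_of_mono1, rotated])
  qed
  assume "thin P \<nu> (F ` Field (pairs_poset \<nu>))"
  then obtain f :: "'a \<Rightarrow> 'a" where f: "|f ` F ` (\<nu> - Id)| <o \<nu>"
    "\<forall>x\<in>F ` (\<nu> - Id). \<forall>y\<in>F ` (\<nu> - Id). f x = f y \<longrightarrow> (x, y) \<in> P \<or> (y, x) \<in> P"
    unfolding thin_def FP by blast
  let ?C = "f ` F ` (\<nu> - Id)"
  let ?B = "\<lambda>\<alpha> c. {\<beta>. (\<alpha>, \<beta>) \<in> \<nu> - Id \<and> f (F (\<alpha>, \<beta>)) = c}"
  have "\<exists>c. c \<in> ?C \<and> \<not> |?B \<alpha> c| <o \<nu>" if \<alpha>: "\<alpha> \<in> Field \<nu>" for \<alpha>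
  proof (rule ccontr)
    assume no: "\<not> ?thesis"
    have "|?B \<alpha> c| <o \<nu>" if "c \<in> ?C" for c
    proof (rule ccontr)
      assume "\<not> |?B \<alpha> c| <o \<nu>"
      with that have "c \<in> ?C \<and> \<not> |?B \<alpha> c| <o \<nu>" by (rule conjI)
      then have "\<exists>c. c \<in> ?C \<and> \<not> |?B \<alpha> c| <o \<nu>" by (rule exI)
      with no show False by (rule notE)
    qed
    then have "|\<Union>c\<in>?C. ?B \<alpha> c| <o \<nu>"
      by (rule card_of_UNION_less_cofinality[OF \<nu> ordLess_ordLeq_trans[OF f(1) cof]])
    then have "|{\<beta>. (\<beta>, \<alpha>) \<in> \<nu>} \<union> (\<Union>c\<in>?C. ?B \<alpha> c)| <o \<nu>" by (intro Un le_small \<alpha>)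
    moreover have "Field \<nu> \<subseteq> {\<beta>. (\<beta>, \<alpha>) \<in> \<nu>} \<union> (\<Union>c\<in>?C. ?B \<alpha> c)"
    proof
      fix \<beta> assume \<beta>: "\<beta> \<in> Field \<nu>"
      have "(\<alpha>, \<alpha>) \<in> \<nu>" using wo \<alpha> by (auto simp: order_on_defs refl_on_def)
      then show "\<beta> \<in> {\<beta>. (\<beta>, \<alpha>) \<in> \<nu>} \<union> (\<Union>c\<in>?C. ?B \<alpha> c)" using tot[OF \<alpha> \<beta>] by auto
    qed
    ultimately have "|Field \<nu>| <o \<nu>" by (rule ordLeq_ordLess_trans[OF card_of_mono1, rotated])
    moreover have "|Field \<nu>| =o \<nu>" using \<nu> by (simp add: card_of_Field_ordIso)
    ultimately show False using not_ordLess_ordIso by blast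
  qed
  then have "\<forall>\<alpha>\<in>Field \<nu>. \<exists>c. c \<in> ?C \<and> \<not> |?B \<alpha> c| <o \<nu>" by blast
  from this[unfolded bchoice_iff] obtain c
    where c: "\<forall>\<alpha>\<in>Field \<nu>. c \<alpha> \<in> ?C \<and> \<not> |?B \<alpha> (c \<alpha>)| <o \<nu>" by (elim exE)
  have "\<not> inj_on c (Field \<nu>)"
  proof
    assume "inj_on c (Field \<nu>)"
    then have "|Field \<nu>| \<le>o |?C|" using c by (intro card_of_ordLeqI) auto
    then have "|Field \<nu>| <o \<nu>" using f(1) by (rule ordLeq_ordLess_trans)
    moreover have "|Field \<nu>| =o \<nu>" using \<nu> by (simp add: card_of_Field_ordIso)
    ultimately show False using not_ordLess_ordIso by blast
  qed
  then obtain \<xi> \<eta> where "\<xi> \<in> Field \<nu>" "\<eta> \<in> Field \<nu>" "c \<xi> = c \<eta>" "\<xi> \<noteq> \<eta>"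
    unfolding inj_on_def by blast
  then obtain \<alpha> \<alpha>' where \<alpha>: "\<alpha> \<in> Field \<nu>" "\<alpha>' \<in> Field \<nu>" "c \<alpha> = c \<alpha>'" "(\<alpha>, \<alpha>') \<in> \<nu> - Id"
    using tot[of \<xi> \<eta>] by metis
  have unb: "\<exists>\<beta>'\<in>?B \<gamma> (c \<gamma>). (\<beta>', \<beta>) \<notin> \<nu>" if "\<gamma> \<in> Field \<nu>" "\<beta> \<in> Field \<nu>" for \<gamma> \<beta>
  proof (rule ccontr)
    assume "\<not> ?thesis"
    then have "?B \<gamma> (c \<gamma>) \<subseteq> {\<beta>'. (\<beta>', \<beta>) \<in> \<nu>}" by blast
    then have "|?B \<gamma> (c \<gamma>)| <o \<nu>"
      using le_small[OF that(2)] by (rule ordLeq_ordLess_trans[OF card_of_mono1])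
    then show False using c that(1) by blast
  qed
  obtain \<beta>' where \<beta>': "\<beta>' \<in> ?B \<alpha>' (c \<alpha>')" using unb[OF \<alpha>(2) \<alpha>(2)] by blast
  then have "\<beta>' \<in> Field \<nu>" by (auto simp: FieldI2)
  then obtain \<beta> where \<beta>: "\<beta> \<in> ?B \<alpha> (c \<alpha>)" "(\<beta>, \<beta>') \<notin> \<nu>" using unb[OF \<alpha>(1)] by blast
  have v: "(\<alpha>, \<beta>) \<in> \<nu> - Id" "(\<alpha>', \<beta>') \<in> \<nu> - Id" and "f (F (\<alpha>, \<beta>)) = f (F (\<alpha>', \<beta>'))"
    using \<beta> \<beta>' \<alpha>(3) by auto
  then have "(F (\<alpha>, \<beta>), F (\<alpha>', \<beta>')) \<in> P \<or> (F (\<alpha>', \<beta>'), F (\<alpha>, \<beta>)) \<in> P" using f(2) by blast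
  then have "((\<alpha>, \<beta>), (\<alpha>', \<beta>')) \<in> pairs_poset \<nu> \<or> ((\<alpha>', \<beta>'), (\<alpha>, \<beta>)) \<in> pairs_poset \<nu>"
    using F v unfolding FP by blast
  moreover have "(\<alpha>', \<alpha>) \<notin> \<nu>" using \<alpha>(4) antisymD[OF as\<nu>] by blast
  ultimately show False using \<beta>(2) unfolding pairs_poset_def by blast
qed

subsection \<open>Limit cardinals\<close>

lemma underS_mono:
  assumes "Well_order \<nu>" "(a, b) \<in> \<nu>" shows "underS \<nu> a \<subseteq> underS \<nu> b"
proof -
  have "trans \<nu>" "antisym \<nu>" using assms(1) by (auto simp: order_on_defs)
  then show ?thesis using assms(2) unfolding underS_def trans_def antisym_def by blast
qed

lemma underS_max:
  assumes \<nu>: "Well_order \<nu>" and ab: "a \<in> Field \<nu>" "b \<in> Field \<nu>"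
  shows "\<exists>e\<in>Field \<nu>. underS \<nu> a \<subseteq> underS \<nu> e \<and> underS \<nu> b \<subseteq> underS \<nu> e"
proof (cases "(a, b) \<in> \<nu>")
  case True
  then show ?thesis using underS_mono[OF \<nu>] ab by blast
next
  case False
  then have "a = b \<or> (b, a) \<in> \<nu>" using \<nu> ab unfolding order_on_defs total_on_def by blast
  then show ?thesis using underS_mono[OF \<nu>] ab by blast
qed

lemma cardSuc_card_of_mono: "A \<subseteq> B \<Longrightarrow> cardSuc |A| \<le>o cardSuc |B|"
  by (simp add: cardSuc_mono_ordLeq card_of_Card_order card_of_mono1)

lemma thin_underS_mono:
  assumes "thin P (cardSuc |A| ) S" "A \<subseteq> B" shows "thin P (cardSuc |B| ) S"
  using assms(1) cardSuc_card_of_mono[OF assms(2)] by (rule thin_ordLeq)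

lemma thin_imp_thin_underS:
  fixes P :: "'a rel"
  assumes \<nu>: "Card_order \<nu>" and S: "thin P \<nu> S"
  shows "\<exists>c\<in>Field \<nu>. thin P (cardSuc |underS \<nu> c| ) S"
proof -
  obtain f :: "'a \<Rightarrow> 'a" where f: "|f ` S| <o \<nu>"
    "\<forall>x\<in>S. \<forall>y\<in>S. f x = f y \<longrightarrow> (x, y) \<in> P \<or> (y, x) \<in> P" using S unfolding thin_def by blast
  obtain c where c: "c \<in> Field \<nu>" "|f ` S| \<le>o |underS \<nu> c|"
    using ordLess_imp_ordLeq_underS[OF \<nu> f(1)] by blast
  have "|f ` S| <o cardSuc |underS \<nu> c|"
    using c(2) by (simp add: card_of_ordLess_cardSuc_iff card_of_Card_order)
  then have "thin P (cardSuc |underS \<nu> c| ) S" by (rule thinI) (use f(2) in blast)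
  then show ?thesis using c(1) by blast
qed

lemma Cinfinite_card_of: "infinite C \<Longrightarrow> Cinfinite |C|"
  by (simp add: cinfinite_def Field_card_of card_of_card_order_on)

lemma cofinal_underS:
  assumes \<nu>: "Well_order \<nu>" and A: "cofinal A \<nu>" and c: "c \<in> Field \<nu>"
  shows "\<exists>a\<in>A. underS \<nu> c \<subseteq> underS \<nu> a"
proof -
  obtain a where "a \<in> A" "(c, a) \<in> \<nu>" using A c unfolding cofinal_def by blast
  then show ?thesis using underS_mono[OF \<nu>] by auto
qed

lemma exists_infinite_underS:
  assumes "Card_order \<nu>" "natLeq <o \<nu>"
  shows "\<exists>c\<in>Field \<nu>. infinite (underS \<nu> c)"
proof -
  have "|UNIV :: nat set| <o \<nu>" by (rule ordIso_ordLess_trans[OF card_of_nat assms(2)])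
  then obtain c where c: "c \<in> Field \<nu>" "|UNIV :: nat set| \<le>o |underS \<nu> c|"
    using ordLess_imp_ordLeq_underS[OF assms(1)] by blast
  have "infinite (underS \<nu> c)" using card_of_ordLeq_infinite[OF c(2)] by simp
  then show ?thesis using c(1) by blast
qed

text \<open>The successor case provides a copy of the pairs poset on
  \<open>cardSuc \<kappa>\<close>, or of its dual. It is itself not thin and has at most
  \<open>cardSuc \<kappa>\<close> points.\<close>

lemma exists_small_not_thin_subset:
  fixes P :: "'a rel" and \<nu> :: "'b rel" and \<kappa> :: "'k rel"
  assumes P: "Partial_order P" and fac: "no_infinite_antichain P" and \<kappa>: "Cinfinite \<kappa>"
    and \<nu>: "Cinfinite \<nu>" "cardSuc \<kappa> <o \<nu>" and S: "S \<subseteq> Field P" "\<not> thin P (cardSuc \<kappa>) S"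
  shows "\<exists>T\<subseteq>S. |T| <o \<nu> \<and> \<not> thin P (cardSuc \<kappa>) T"
proof -
  let ?\<mu> = "cardSuc \<kappa>"
  have \<mu>: "Cinfinite ?\<mu>" using \<kappa> by (rule Cinfinite_cardSuc)
  have suc: "?\<mu> =o cardSuc \<kappa>" using \<mu> by (simp add: ordIso_refl)
  have wo: "Well_order ?\<mu>" using \<mu> by (simp add: card_order_on_well_order_on)
  obtain R where R: "R = P \<or> R = P\<inverse>" "embeds_into (pairs_poset ?\<mu>) R S"
    using pairs_poset_embeds_of_not_thin[OF P fac \<kappa> suc S] by blast
  then obtain f where f: "f ` Field (pairs_poset ?\<mu>) \<subseteq> S"
    "\<forall>x\<in>Field (pairs_poset ?\<mu>). \<forall>y\<in>Field (pairs_poset ?\<mu>). (f x, f y) \<in> R \<longleftrightarrow> (x, y) \<in> pairs_poset ?\<mu>"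
    unfolding embeds_into_def by blast
  let ?T = "f ` Field (pairs_poset ?\<mu>)"
  have "\<not> thin R ?\<mu> ?T"
    by (rule not_thin_image_pairs_poset[OF \<mu> successor_le_cofinality[OF \<kappa> suc]]) (use f(2) in blast)
  then have "\<not> thin P ?\<mu> ?T" using R(1) by auto
  moreover have "|?T| <o \<nu>"
  proof -
    have F: "|Field ?\<mu>| <o \<nu>" using \<mu> \<nu>(2) card_of_Field_ordIso[of ?\<mu>] by (auto intro: ordIso_ordLess_trans)
    have "|?T| \<le>o |Field (pairs_poset ?\<mu>)|" by (rule card_of_image)
    moreover have "Field (pairs_poset ?\<mu>) \<subseteq> Field ?\<mu> \<times> Field ?\<mu>"
      unfolding Field_pairs_poset[OF wo] by (auto simp: FieldI1 FieldI2)
    then have "|Field (pairs_poset ?\<mu>)| \<le>o |Field ?\<mu> \<times> Field ?\<mu>|" by (rule card_of_mono1)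
    ultimately have "|?T| \<le>o |Field ?\<mu> \<times> Field ?\<mu>|" by (rule ordLeq_transitive)
    then show ?thesis by (rule ordLeq_ordLess_trans[OF _ card_of_Times_ordLess_infinite[OF \<nu>(1) F F]])
  qed
  ultimately show ?thesis using f(1) by blast
qed

definition setless :: "'a rel \<Rightarrow> 'a set \<Rightarrow> 'a set \<Rightarrow> bool" where
  "setless P A B \<longleftrightarrow> (\<forall>x\<in>A. \<forall>y\<in>B. (x, y) \<in> P \<and> x \<noteq> y)"

lemma setless_converse: "setless (P\<inverse>) A B = setless P B A"
  unfolding setless_def by auto

context
  fixes \<nu> :: "'b rel" and P :: "'a rel"
  assumes \<nu>: "Cinfinite \<nu>" and nat_less: "natLeq <o \<nu>"
    and lim: "\<forall>c\<in>Field \<nu>. cardSuc |underS \<nu> c| <o \<nu>"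
    and P: "Partial_order P" and fac: "no_infinite_antichain P"
begin

lemma wo_\<nu>: "Well_order \<nu>"
  using \<nu> by (simp add: card_order_on_well_order_on)

text \<open>
  Otherwise no bounded set contains a small non-thin set \<open>T\<close>. If \<open>\<nu>\<close> is regular, small sets are
  bounded. If \<open>\<nu>\<close> is singular, take \<open>T\<close> inside a set \<open>QA a\<close> on which the cover numbers of the
  complements of \<open>\<up>t\<close> are bounded by a fixed cardinal below \<open>\<nu>\<close>; then \<open>T\<close> is bounded again.
\<close>

lemma upward_exists_not_thin_lower_set:
  assumes Q: "upward P \<nu> Q" and c: "c \<in> Field \<nu>" "infinite (underS \<nu> c)"
  shows "\<exists>y\<in>Q. \<not> thin P (cardSuc |underS \<nu> c| ) {q \<in> Q. (q, y) \<in> P}"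
proof (rule ccontr)
  let ?\<kappa> = "|underS \<nu> c|"
  assume no: "\<not> ?thesis"
  have QP: "Q \<subseteq> Field P" and Qnt: "\<not> thin P \<nu> Q" using Q unfolding upward_def by blast+
  have \<kappa>: "Cinfinite ?\<kappa>" using c(2) by (rule Cinfinite_card_of)
  have \<kappa>lt: "?\<kappa> <o \<nu>" using \<nu> c(1) by (simp add: card_of_underS)
  note lim_c = bspec[OF lim c(1)]
  have unbounded: False
    if "T \<subseteq> Q" "\<not> thin P (cardSuc ?\<kappa>) T" "y \<in> Q" "\<forall>t\<in>T. (t, y) \<in> P" for T y
  proof -
    have "T \<subseteq> {q \<in> Q. (q, y) \<in> P}" using that by blast
    then show False using no that(2,3) thin_subset by blast
  qed
  show False
  proof (cases "\<nu> \<le>o cofinality \<nu>")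
    case True
    have "\<not> thin P (cardSuc ?\<kappa>) Q"
      using Qnt thin_ordLeq[OF _ ordLess_imp_ordLeq[OF lim_c]] by blast
    from exists_small_not_thin_subset[OF P fac \<kappa> \<nu> lim_c QP this]
    obtain T where "T \<subseteq> Q \<and> |T| <o \<nu> \<and> \<not> thin P (cardSuc ?\<kappa>) T" by (elim exE)
    then have T: "T \<subseteq> Q" "|T| <o \<nu> \<and> \<not> thin P (cardSuc ?\<kappa>) T" by simp_all
    have "|T| <o cofinality \<nu>" using T(2) True ordLess_ordLeq_trans by blast
    from upward_strict_bound[OF P \<nu> Q T(1) this] show False using unbounded T by blast
  next
    case False
    obtain A where A: "A \<subseteq> Field \<nu>" "cofinal A \<nu>" "cofinality \<nu> = |A|"
      using exists_cofinal_card_eq_cofinality[OF \<nu>] by metis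
    have Alt: "|A| <o \<nu>"
      using False A(3) not_ordLess_iff_ordLeq[OF wo_\<nu> card_of_Well_order, of A] by metis
    define QA where "QA a = {t \<in> Q. thin P (cardSuc |underS \<nu> a| ) {z \<in> Q. (t, z) \<notin> P}}" for a
    have "\<exists>a\<in>A. t \<in> QA a" if t: "t \<in> Q" for t
    proof -
      have "thin P \<nu> {z \<in> Q. (t, z) \<notin> P}" using Q t unfolding upward_def by blast
      then obtain d where d: "d \<in> Field \<nu>" "thin P (cardSuc |underS \<nu> d| ) {z \<in> Q. (t, z) \<notin> P}"
        using thin_imp_thin_underS[of \<nu>] \<nu> by blast
      obtain a where a: "a \<in> A" "underS \<nu> d \<subseteq> underS \<nu> a" using cofinal_underS[OF wo_\<nu> A(2) d(1)] by blast
      show ?thesis using a(1) t thin_underS_mono[OF d(2) a(2)] unfolding QA_def by blast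
    qed
    then have "Q \<subseteq> (\<Union>a\<in>A. QA a)" by blast
    then have "\<not> thin P \<nu> (\<Union>a\<in>A. QA a)" using Qnt thin_subset by blast
    then have "\<not> (\<forall>a\<in>A. thin P (cardSuc ?\<kappa>) (QA a))"
      using thin_UNION_uniform[OF \<nu> Alt \<kappa>lt] by blast
    then obtain a where a: "a \<in> A" "\<not> thin P (cardSuc ?\<kappa>) (QA a)" by blast
    have "QA a \<subseteq> Field P" using QP unfolding QA_def by blast
    from exists_small_not_thin_subset[OF P fac \<kappa> \<nu> lim_c this a(2)]
    obtain T where "T \<subseteq> QA a \<and> |T| <o \<nu> \<and> \<not> thin P (cardSuc ?\<kappa>) T" by (elim exE)
    then have T: "T \<subseteq> QA a" "|T| <o \<nu> \<and> \<not> thin P (cardSuc ?\<kappa>) T" by simp_all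
    have "thin P \<nu> (\<Union>t\<in>T. {z \<in> Q. (t, z) \<notin> P})"
    proof (rule thin_UNION_uniform[OF \<nu>, where C = "underS \<nu> a"])
      show "|T| <o \<nu>" using T(2) by simp
      show "|underS \<nu> a| <o \<nu>" using \<nu> A(1) a(1) by (auto intro: card_of_underS)
    qed (use T(1) in \<open>auto simp: QA_def\<close>)
    then have "\<not> Q \<subseteq> (\<Union>t\<in>T. {z \<in> Q. (t, z) \<notin> P})" using Qnt thin_subset by blast
    then obtain y where "y \<in> Q" "\<forall>t\<in>T. (t, y) \<in> P" by blast
    moreover have "T \<subseteq> Q" using T(1) unfolding QA_def by blast
    ultimately show False using unbounded T(2) by blast
  qed
qed

text \<open>The block \<open>B a\<close> consists of the points strictly above all earlier
  \<open>y b\<close> and below \<open>y a\<close>. Fewer than \<open>cofinality \<nu>\<close> points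
  precede \<open>y a\<close>, so the first condition discards only a thin set, and a
  \<open>y a\<close> whose lower set in \<open>Q\<close> has a large enough cover number keeps a
  large block.\<close>

lemma upward_exists_blocks:
  assumes Q: "upward P \<nu> Q"
  shows "\<exists>\<B>. (\<forall>B\<in>\<B>. B \<subseteq> Q \<and> thin P \<nu> B) \<and>
    (\<forall>B\<in>\<B>. \<forall>B'\<in>\<B>. B \<noteq> B' \<longrightarrow> setless P B B' \<or> setless P B' B) \<and>
    (\<forall>c\<in>Field \<nu>. \<exists>B\<in>\<B>. \<not> thin P (cardSuc |underS \<nu> c| ) B)"
proof -
  have tr: "trans P" and asym: "antisym P" using P by (auto simp: order_on_defs)
  have QP: "Q \<subseteq> Field P" and Qnt: "\<not> thin P \<nu> Q" using Q unfolding upward_def by blast+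
  have not_above_thin: "thin P \<nu> ({z \<in> Q. (y, z) \<notin> P} \<union> {y})" if "y \<in> Q" for y
  proof -
    have "(y, y) \<in> P" using P QP that unfolding order_on_defs refl_on_def by blast
    then show ?thesis using Q that unfolding upward_def by (intro thin_Un \<nu> thin_singleton) auto
  qed
  obtain A where A: "A \<subseteq> Field \<nu>" "cofinal A \<nu>" "cofinality \<nu> = |A|"
    using exists_cofinal_card_eq_cofinality[OF \<nu>] by metis
  \<comment> \<open>Proper initial segments of this well-order of \<open>A\<close> have fewer than
    \<open>cofinality \<nu>\<close> elements.\<close>
  let ?r = "|A|"
  have wor: "Well_order ?r" by (rule card_of_Well_order)
  have wf: "wf (?r - Id)" using card_of_well_order_on[of A] unfolding well_order_on_def by blast
  obtain i where i: "i \<in> Field \<nu>" "infinite (underS \<nu> i)"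
    using exists_infinite_underS[of \<nu>] \<nu> nat_less by blast
  define QA where "QA y a = {q \<in> Q. \<forall>b. (b, a) \<in> ?r - Id \<longrightarrow> (y b, q) \<in> P \<and> y b \<noteq> q}"
    for y :: "'b \<Rightarrow> 'a" and a
  define good where "good y a v \<longleftrightarrow> (a \<in> A \<longrightarrow> v \<in> Q \<and>
     \<not> thin P (cardSuc |underS \<nu> a| ) {q \<in> QA y a. (q, v) \<in> P})" for y :: "'b \<Rightarrow> 'a" and a v
  have "\<exists>y. \<forall>a. good y a (y a)"
  proof (rule dependent_wf_choice[OF wf])
    fix y y' :: "'b \<Rightarrow> 'a" and a v
    assume eq: "\<And>b. (b, a) \<in> ?r - Id \<Longrightarrow> y b = y' b"
    have "QA y a = QA y' a" unfolding QA_def using eq by auto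
    then show "good y a v = good y' a v" unfolding good_def by simp
  next
    fix a and y :: "'b \<Rightarrow> 'a"
    assume IH: "\<And>b. (b, a) \<in> ?r - Id \<Longrightarrow> good y b (y b)"
    show "\<exists>v. good y a v"
    proof (cases "a \<in> A")
      case False then show ?thesis unfolding good_def by blast
    next
      case True
      have yQ: "y b \<in> Q" if "b \<in> underS ?r a" for b
      proof -
        have "(b, a) \<in> ?r - Id" using that unfolding underS_def by blast
        moreover have "b \<in> A" using that FieldI1[of b a ?r] unfolding underS_def Field_card_of by blast
        ultimately show ?thesis using IH unfolding good_def by blast
      qed
      have "|underS ?r a| <o cofinality \<nu>"
        unfolding A(3) using True by (intro card_of_underS card_of_Card_order) (simp add: Field_card_of)
      then have "thin P \<nu> (\<Union>b\<in>underS ?r a. {z \<in> Q. (y b, z) \<notin> P} \<union> {y b})"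
        by (rule thin_UNION[OF \<nu>]) (rule not_above_thin[OF yQ])
      moreover have "Q - QA y a \<subseteq> (\<Union>b\<in>underS ?r a. {z \<in> Q. (y b, z) \<notin> P} \<union> {y b})"
        unfolding QA_def underS_def by blast
      ultimately have "thin P \<nu> (Q - QA y a)" by (rule thin_subset)
      then obtain d where d: "d \<in> Field \<nu>" "thin P (cardSuc |underS \<nu> d| ) (Q - QA y a)"
        using thin_imp_thin_underS[of \<nu>] \<nu> by blast
      \<comment> \<open>The final index \<open>e\<close> has to exceed \<open>a\<close>, the size
        demanded of the block, \<open>d\<close>, the cover number of the discarded part, and
        \<open>i\<close>, so that sets covered by at most \<open>|underS \<nu> e|\<close> chains are
        closed under finite unions.\<close>
      obtain e0 where e0: "e0 \<in> Field \<nu>" "underS \<nu> a \<subseteq> underS \<nu> e0" "underS \<nu> d \<subseteq> underS \<nu> e0"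
        using underS_max[OF wo_\<nu>, of a d] True A(1) d(1) by blast
      obtain e where e: "e \<in> Field \<nu>" "underS \<nu> e0 \<subseteq> underS \<nu> e" "underS \<nu> i \<subseteq> underS \<nu> e"
        using underS_max[OF wo_\<nu> e0(1) i(1)] by blast
      have inf: "infinite (underS \<nu> e)" using e(3) i(2) finite_subset by blast
      obtain v where v: "v \<in> Q" "\<not> thin P (cardSuc |underS \<nu> e| ) {q \<in> Q. (q, v) \<in> P}"
        using upward_exists_not_thin_lower_set[OF Q e(1) inf] by blast
      have "\<not> thin P (cardSuc |underS \<nu> a| ) {q \<in> QA y a. (q, v) \<in> P}"
      proof
        assume "thin P (cardSuc |underS \<nu> a| ) {q \<in> QA y a. (q, v) \<in> P}"
        then have "thin P (cardSuc |underS \<nu> e| ) {q \<in> QA y a. (q, v) \<in> P}"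
          by (rule thin_underS_mono) (use e0 e in blast)
        moreover have "thin P (cardSuc |underS \<nu> e| ) (Q - QA y a)"
          using d(2) by (rule thin_underS_mono) (use e0 e in blast)
        ultimately have "thin P (cardSuc |underS \<nu> e| ) ({q \<in> QA y a. (q, v) \<in> P} \<union> (Q - QA y a))"
          by (rule thin_Un[OF Cinfinite_cardSuc[OF Cinfinite_card_of[OF inf]]])
        then have "thin P (cardSuc |underS \<nu> e| ) {q \<in> Q. (q, v) \<in> P}"
          by (rule thin_subset) blast
        then show False using v(2) by contradiction
      qed
      then show ?thesis using v(1) unfolding good_def by blast
    qed
  qed
  then obtain y where y: "\<And>a. good y a (y a)" by blast
  define B where "B a = {q \<in> QA y a. (q, y a) \<in> P}" for a
  have B_less: "setless P (B b) (B a)" if "(b, a) \<in> ?r - Id" for a b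
    unfolding setless_def
  proof (intro ballI conjI)
    fix q q' assume "q \<in> B b" "q' \<in> B a"
    then have 1: "(q, y b) \<in> P" and 2: "(y b, q') \<in> P" "y b \<noteq> q'"
      using that unfolding B_def QA_def by blast+
    show "(q, q') \<in> P" by (rule transD[OF tr 1 2(1)])
    show "q \<noteq> q'" using 1 2 antisymD[OF asym] by blast
  qed
  show ?thesis
  proof (intro exI[of _ "B ` A"] conjI ballI impI)
    fix X assume "X \<in> B ` A"
    then obtain a where a: "a \<in> A" "X = B a" by blast
    show "X \<subseteq> Q" unfolding a(2) B_def QA_def by blast
    have yaQ: "y a \<in> Q" using y[of a] a(1) unfolding good_def by blast
    \<comment> \<open>A point strictly above \<open>y a\<close> has the whole block outside its
      up-set, which makes the block thin.\<close>
    have "\<not> Q \<subseteq> {z \<in> Q. (y a, z) \<notin> P} \<union> {y a}"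
      using thin_subset[OF not_above_thin[OF yaQ]] Qnt by blast
    then obtain z where z: "z \<in> Q" "(y a, z) \<in> P" "y a \<noteq> z" by blast
    have "(z, q) \<notin> P" if "q \<in> X" for q
    proof
      assume "(z, q) \<in> P"
      moreover have "(q, y a) \<in> P" using that unfolding a(2) B_def by blast
      ultimately have "(z, y a) \<in> P" by (rule transD[OF tr])
      then show False using z antisymD[OF asym] by blast
    qed
    then have "X \<subseteq> {q \<in> Q. (z, q) \<notin> P}" using \<open>X \<subseteq> Q\<close> by blast
    moreover have "thin P \<nu> {q \<in> Q. (z, q) \<notin> P}" using Q z(1) unfolding upward_def by blast
    ultimately show "thin P \<nu> X" by (rule thin_subset[rotated])
    fix Y assume "Y \<in> B ` A" and ne: "X \<noteq> Y"
    then obtain b where b: "b \<in> A" "Y = B b" by blast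
    have "a \<noteq> b" using ne a b by blast
    then have "(a, b) \<in> ?r - Id \<or> (b, a) \<in> ?r - Id"
      using wor a(1) b(1) unfolding order_on_defs total_on_def Field_card_of by blast
    then show "setless P X Y \<or> setless P Y X" using B_less a b by blast
  next
    fix c assume "c \<in> Field \<nu>"
    then obtain a where a: "a \<in> A" "underS \<nu> c \<subseteq> underS \<nu> a"
      using cofinal_underS[OF wo_\<nu> A(2)] by blast
    have "\<not> thin P (cardSuc |underS \<nu> a| ) (B a)" using y[of a] a(1) unfolding good_def B_def by blast
    then have "\<not> thin P (cardSuc |underS \<nu> c| ) (B a)" using thin_underS_mono[OF _ a(2)] by blast
    then show "\<exists>X\<in>B ` A. \<not> thin P (cardSuc |underS \<nu> c| ) X" using a(1) by blast
  qed
qed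

end

section \<open>Assembling lexicographical sums\<close>

lemma antisym_lex_sum:
  assumes "antisym C" "\<And>i. antisym (Q i)" shows "antisym (lex_sum C Q)"
proof (rule antisymI)
  fix p q assume "(p, q) \<in> lex_sum C Q" "(q, p) \<in> lex_sum C Q"
  then show "p = q"
    using antisymD[OF assms(1)] antisymD[OF assms(2)] unfolding lex_sum_def by blast
qed

lemma Field_lex_sum_subset: "Field (lex_sum C Q) \<subseteq> {(i, x). i \<in> Field C \<and> x \<in> Field (Q i)}"
  unfolding Field_def lex_sum_def by auto

lemma contains_copy_converse: "contains_copy (P\<inverse>) Q \<longleftrightarrow> contains_copy P (Q\<inverse>)"
proof -
  have "Restr (P\<inverse>) S = (Restr P S)\<inverse>" for S by auto
  then have "iso Q (Restr (P\<inverse>) S) = iso (Q\<inverse>) (Restr P S)" for S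
    unfolding iso_iff2 fun_eq_iff by auto
  then show ?thesis unfolding contains_copy_def by simp
qed

text \<open>The index chain is \<open>D\<close> ordered by the position of the blocks in
  \<open>P\<close>, which may be unrelated to the order of \<nu>; nonempty blocks make it
  antisymmetric.\<close>

lemma exists_limit_index_data:
  fixes \<nu> :: "'b rel" and P :: "'a rel" and c :: "'b \<Rightarrow> 'b" and B :: "'b \<Rightarrow> 'a set"
  assumes \<nu>: "Cinfinite \<nu>" and lim: "\<forall>c\<in>Field \<nu>. cardSuc |underS \<nu> c| <o \<nu>"
    and P: "Partial_order P"
    and D: "D \<subseteq> Field \<nu>" "cofinal D \<nu>" "|D| =o cofinality \<nu>"
    and c: "\<And>a. a \<in> D \<Longrightarrow> c a \<in> Field \<nu>" "\<And>a. a \<in> D \<Longrightarrow> infinite (underS \<nu> (c a))"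
      "\<And>a. a \<in> D \<Longrightarrow> underS \<nu> a \<subseteq> underS \<nu> (c a)"
    and distinct: "\<And>a b. a \<in> D \<Longrightarrow> b \<in> D \<Longrightarrow> a \<noteq> b \<Longrightarrow>
      \<not> cardSuc |underS \<nu> (c a)| =o cardSuc |underS \<nu> (c b)|"
    and BP: "\<And>a. a \<in> D \<Longrightarrow> B a \<subseteq> Field P" and ne: "\<And>a. a \<in> D \<Longrightarrow> B a \<noteq> {}"
    and sep: "\<And>a b. a \<in> D \<Longrightarrow> b \<in> D \<Longrightarrow> a \<noteq> b \<Longrightarrow> setless P (B a) (B b) \<or> setless P (B b) (B a)"
    and emb: "\<And>a. a \<in> D \<Longrightarrow> embeds_into (pairs_poset (cardSuc |underS \<nu> (c a)| )) P (B a)"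
  shows "\<exists>(C :: 'b rel) (\<kappa> :: 'b \<Rightarrow> 'b rel). limit_index_data \<nu> C \<kappa> \<and>
    contains_copy P (lex_sum C (\<lambda>\<alpha>. pairs_poset (cardSuc (\<kappa> \<alpha>))))"
proof -
  have tr: "trans P" and asym: "antisym P" using P by (auto simp: order_on_defs)
  have wo: "Well_order \<nu>" using \<nu> by (simp add: card_order_on_well_order_on)
  define C where "C = {(a, b). a \<in> D \<and> b \<in> D \<and> (a = b \<or> setless P (B a) (B b))}"
  define \<kappa> where "\<kappa> a = |underS \<nu> (c a)|" for a
  have FC: "Field C = D" unfolding C_def Field_def by auto
  have asymC: "antisym C"
  proof (rule antisymI, rule ccontr)
    fix a b assume ab: "(a, b) \<in> C" "(b, a) \<in> C" "a \<noteq> b"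
    then have "a \<in> D" "b \<in> D" "setless P (B a) (B b)" "setless P (B b) (B a)"
      unfolding C_def by auto
    moreover obtain x y where "x \<in> B a" "y \<in> B b" using ne calculation(1,2) by blast
    ultimately show False using antisymD[OF asym, of x y] unfolding setless_def by blast
  qed
  have "trans C"
  proof (rule transI)
    fix a b d assume ab: "(a, b) \<in> C" "(b, d) \<in> C"
    show "(a, d) \<in> C"
    proof (cases "a = b \<or> b = d")
      case True then show ?thesis using ab by blast
    next
      case False
      then have D3: "a \<in> D" "b \<in> D" "d \<in> D" and less: "setless P (B a) (B b)" "setless P (B b) (B d)"
        using ab unfolding C_def by auto
      obtain y where y: "y \<in> B b" using ne D3(2) by blast
      have "setless P (B a) (B d)" unfolding setless_def
      proof (intro ballI conjI)
        fix x z assume "x \<in> B a" "z \<in> B d"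
        then have xyz: "(x, y) \<in> P" "x \<noteq> y" "(y, z) \<in> P" using less y unfolding setless_def by blast+
        show "(x, z) \<in> P" by (rule transD[OF tr xyz(1,3)])
        show "x \<noteq> z" using xyz antisymD[OF asym] by blast
      qed
      then show ?thesis using D3 unfolding C_def by blast
    qed
  qed
  moreover have "refl_on D C" "C \<subseteq> D \<times> D" unfolding refl_on_def C_def by auto
  moreover have "total_on D C" using sep unfolding total_on_def C_def by blast
  ultimately have lin: "Linear_order C" using asymC FC by (simp add: order_on_defs)
  have card\<kappa>: "Card_order (\<kappa> a)" for a unfolding \<kappa>_def by (rule card_of_Card_order)
  have "is_cardinal_Sup ((\<lambda>\<alpha>. cardSuc (\<kappa> \<alpha>)) ` D) \<nu>"
    unfolding is_cardinal_Sup_def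
  proof (intro conjI ballI allI impI)
    show "Card_order \<nu>" using \<nu> by simp
    show "\<mu> \<le>o \<nu>" if "\<mu> \<in> (\<lambda>\<alpha>. cardSuc (\<kappa> \<alpha>)) ` D" for \<mu>
      using that bspec[OF lim c(1)] unfolding \<kappa>_def by (auto intro: ordLess_imp_ordLeq)
    fix \<mu> :: "'b rel"
    assume \<mu>: "Card_order \<mu> \<and> (\<forall>k\<in>(\<lambda>\<alpha>. cardSuc (\<kappa> \<alpha>)) ` D. k \<le>o \<mu>)"
    \<comment> \<open>A smaller \<mu> would be bounded by some \<open>|underS \<nu> d|\<close>,
      hence by \<open>\<kappa> a\<close> for an \<open>a\<close> in \<open>D\<close> beyond
      \<open>d\<close>, and then \<open>cardSuc (\<kappa> a)\<close> would exceed \<mu>.\<close>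
    show "\<nu> \<le>o \<mu>"
    proof (rule ccontr)
      assume "\<not> \<nu> \<le>o \<mu>"
      then have lt: "\<mu> <o \<nu>"
        using \<mu> wo not_ordLeq_iff_ordLess[of \<mu> \<nu>] by (simp add: card_order_on_well_order_on)
      have F\<mu>: "|Field \<mu>| =o \<mu>" using \<mu> by (simp add: card_of_Field_ordIso)
      have "|Field \<mu>| <o \<nu>" by (rule ordIso_ordLess_trans[OF F\<mu> lt])
      then obtain d where d: "d \<in> Field \<nu>" "|Field \<mu>| \<le>o |underS \<nu> d|"
        using ordLess_imp_ordLeq_underS[of \<nu> "Field \<mu>"] \<nu> by blast
      obtain a where a: "a \<in> D" "underS \<nu> d \<subseteq> underS \<nu> a" using cofinal_underS[OF wo D(2) d(1)] by blast
      have "|underS \<nu> d| \<le>o \<kappa> a" unfolding \<kappa>_def using a c(3) by (intro card_of_mono1) blast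
      then have "\<mu> \<le>o \<kappa> a"
        by (rule ordLeq_transitive[OF ordIso_ordLeq_trans[OF ordIso_symmetric[OF F\<mu>] d(2)]])
      then have "\<mu> <o cardSuc (\<kappa> a)" by (rule ordLeq_ordLess_trans[OF _ cardSuc_greater[OF card\<kappa>]])
      moreover have "cardSuc (\<kappa> a) \<le>o \<mu>" using \<mu> a(1) by blast
      ultimately show False using not_ordLess_ordLeq by blast
    qed
  qed
  then have "limit_index_data \<nu> C \<kappa>"
    unfolding limit_index_data_def FC
    using lin[unfolded FC] D(3) card\<kappa> lim c distinct unfolding \<kappa>_def
    by (simp add: cardSuc_finite card_of_card_order_on Field_card_of)
  moreover have "contains_copy P (lex_sum C (\<lambda>\<alpha>. pairs_poset (cardSuc (\<kappa> \<alpha>))))"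
  proof -
    let ?Q = "\<lambda>\<alpha>. pairs_poset (cardSuc (\<kappa> \<alpha>))"
    have "antisym (cardSuc (\<kappa> a))" for a using cardSuc_Well_order[OF card\<kappa>[of a]] by (auto simp: order_on_defs)
    then have asymQ: "antisym (lex_sum C ?Q)" by (intro antisym_lex_sum asymC antisym_pairs_poset)
    have "\<forall>a\<in>D. \<exists>f. f ` Field (?Q a) \<subseteq> B a \<and>
        (\<forall>x\<in>Field (?Q a). \<forall>y\<in>Field (?Q a). (f x, f y) \<in> P \<longleftrightarrow> (x, y) \<in> ?Q a)"
      using emb unfolding embeds_into_def \<kappa>_def by blast
    from this[unfolded bchoice_iff] obtain f where
      f: "\<forall>a\<in>D. f a ` Field (?Q a) \<subseteq> B a \<and>
        (\<forall>x\<in>Field (?Q a). \<forall>y\<in>Field (?Q a). (f a x, f a y) \<in> P \<longleftrightarrow> (x, y) \<in> ?Q a)" by (elim exE)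
    define G where "G = (\<lambda>(a, x). f a x)"
    have "(G p, G q) \<in> P \<longleftrightarrow> (p, q) \<in> lex_sum C ?Q"
      if pq: "p \<in> Field (lex_sum C ?Q)" "q \<in> Field (lex_sum C ?Q)" for p q
    proof -
      obtain a x b y where eq: "p = (a, x)" "q = (b, y)" by (cases p; cases q)
      have v: "a \<in> D" "b \<in> D" "x \<in> Field (?Q a)" "y \<in> Field (?Q b)"
        using pq Field_lex_sum_subset[of C ?Q] unfolding eq FC by blast+
      have fB: "f a x \<in> B a" "f b y \<in> B b" using f v by blast+
      have lex: "(p, q) \<in> lex_sum C ?Q \<longleftrightarrow> (a, b) \<in> C - Id \<or> a = b \<and> (x, y) \<in> ?Q a"
        using v unfolding eq lex_sum_def FC by blast
      show ?thesis
      proof (cases "a = b")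
        case True
        then show ?thesis using lex f v unfolding G_def eq by auto
      next
        case False
        then consider "setless P (B a) (B b)" | "setless P (B b) (B a)" using sep v by blast
        then show ?thesis
        proof cases
          case 1
          then have "(a, b) \<in> C" "(f a x, f b y) \<in> P" using v fB unfolding C_def setless_def by auto
          then show ?thesis using lex False unfolding G_def eq by simp
        next
          case 2
          then have "(b, a) \<in> C" "(f b y, f a x) \<in> P" "f b y \<noteq> f a x"
            using v fB unfolding C_def setless_def by auto
          then have "(a, b) \<notin> C" "(f a x, f b y) \<notin> P"
            using False antisymD[OF asymC] antisymD[OF asym] by blast+
          then show ?thesis using lex False unfolding G_def eq by simp
        qed
      qed
    qed
    moreover have "G p \<in> Field P" if p: "p \<in> Field (lex_sum C ?Q)" for p
    proof -
      obtain a x where eq: "p = (a, x)" by (cases p)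
      have "a \<in> D" "x \<in> Field (?Q a)" using p Field_lex_sum_subset[of C ?Q] unfolding eq FC by blast+
      then have "f a x \<in> B a" "B a \<subseteq> Field P" using f BP by blast+
      then show ?thesis unfolding G_def eq by auto
    qed
    ultimately show ?thesis
      unfolding contains_copy_iff_embeds_into[OF P asymQ] embeds_into_def by (intro exI[of _ G]) blast
  qed
  ultimately show ?thesis by blast
qed

text \<open>At stage \<open>a\<close> the new index lies beyond \<open>a\<close>, beyond the
  successors of all earlier cardinals and beyond the cover numbers of all earlier blocks; this is
  possible since fewer than \<open>cofinality \<nu>\<close> stages precede. So the cardinals
  increase strictly and each block is new. Every block contains a pairs poset or a dual one; one
  orientation occurs cofinally often, and the dual one is a sum in
  \<open>P\<inverse>\<close>.\<close>

lemma exists_limit_sum_of_blocks: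
  fixes \<nu> :: "'b rel" and P :: "'a rel"
  assumes \<nu>: "Cinfinite \<nu>" and nat_less: "natLeq <o \<nu>"
    and lim: "\<forall>c\<in>Field \<nu>. cardSuc |underS \<nu> c| <o \<nu>"
    and P: "Partial_order P" and fac: "no_infinite_antichain P"
    and \<B>: "\<And>B. B \<in> \<B> \<Longrightarrow> B \<subseteq> Field P" "\<And>B. B \<in> \<B> \<Longrightarrow> thin P \<nu> B"
    and sep: "\<And>B B'. B \<in> \<B> \<Longrightarrow> B' \<in> \<B> \<Longrightarrow> B \<noteq> B' \<Longrightarrow> setless P B B' \<or> setless P B' B"
    and unb: "\<And>c. c \<in> Field \<nu> \<Longrightarrow> \<exists>B\<in>\<B>. \<not> thin P (cardSuc |underS \<nu> c| ) B"
  shows "\<exists>(C :: 'b rel) (\<kappa> :: 'b \<Rightarrow> 'b rel). limit_index_data \<nu> C \<kappa> \<and>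
    (let Q = lex_sum C (\<lambda>\<alpha>. pairs_poset (cardSuc (\<kappa> \<alpha>)))
     in contains_copy P Q \<or> contains_copy P (Q\<inverse>))"
proof -
  have wo: "Well_order \<nu>" using \<nu> by (simp add: card_order_on_well_order_on)
  obtain A where A: "A \<subseteq> Field \<nu>" "cofinal A \<nu>" "cofinality \<nu> = |A|"
    using exists_cofinal_card_eq_cofinality[OF \<nu>] by metis
  let ?r = "|A|"
  have wor: "Well_order ?r" by (rule card_of_Well_order)
  have wf: "wf (?r - Id)" using card_of_well_order_on[of A] unfolding well_order_on_def by blast
  obtain i where i: "i \<in> Field \<nu>" "infinite (underS \<nu> i)"
    using exists_infinite_underS[of \<nu>] \<nu> nat_less by blast
  \<comment> \<open>A value pairs an index, standing for a cardinal, with a block whose cover number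
    exceeds that cardinal.\<close>
  define good where "good g a v \<longleftrightarrow> (a \<in> A \<longrightarrow>
     fst v \<in> Field \<nu> \<and> infinite (underS \<nu> (fst v)) \<and> underS \<nu> a \<subseteq> underS \<nu> (fst v) \<and>
     snd v \<in> \<B> \<and> \<not> thin P (cardSuc |underS \<nu> (fst v)| ) (snd v) \<and>
     (\<forall>b. (b, a) \<in> ?r - Id \<longrightarrow> cardSuc |underS \<nu> (fst (g b))| \<le>o |underS \<nu> (fst v)| \<and>
        thin P (cardSuc |underS \<nu> (fst v)| ) (snd (g b))))"
    for g :: "'b \<Rightarrow> 'b \<times> 'a set" and a v
  have "\<exists>g. \<forall>a. good g a (g a)"
  proof (rule dependent_wf_choice[OF wf])
    show "good g a v = good g' a v" if "\<And>b. (b, a) \<in> ?r - Id \<Longrightarrow> g b = g' b"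
      for g g' :: "'b \<Rightarrow> 'b \<times> 'a set" and a v
      using that unfolding good_def by auto
    fix a and g :: "'b \<Rightarrow> 'b \<times> 'a set"
    assume IH: "\<And>b. (b, a) \<in> ?r - Id \<Longrightarrow> good g b (g b)"
    show "\<exists>v. good g a v"
    proof (cases "a \<in> A")
      case False then show ?thesis unfolding good_def by blast
    next
      case True
      have g: "fst (g b) \<in> Field \<nu>" "snd (g b) \<in> \<B>" if "b \<in> underS ?r a" for b
      proof -
        have "(b, a) \<in> ?r - Id" using that unfolding underS_def by blast
        moreover have "b \<in> A" using that FieldI1[of b a ?r] unfolding underS_def Field_card_of by blast
        ultimately show "fst (g b) \<in> Field \<nu>" "snd (g b) \<in> \<B>" using IH unfolding good_def by blast+
      qed
      have small: "|underS ?r a| <o cofinality \<nu>"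
        unfolding A(3) using True by (intro card_of_underS card_of_Card_order) (simp add: Field_card_of)
      have "\<exists>d\<in>Field \<nu>. \<forall>b\<in>underS ?r a. thin P (cardSuc |underS \<nu> d| ) (snd (g b))"
        by (rule thin_uniform_of_less_cofinality[OF \<nu> small]) (rule \<B>(2)[OF g(2)])
      then obtain d1 where d1: "d1 \<in> Field \<nu>"
        "\<forall>b\<in>underS ?r a. thin P (cardSuc |underS \<nu> d1| ) (snd (g b))" by (rule bexE)
      have card: "|Field (cardSuc |underS \<nu> x| )| =o cardSuc |underS \<nu> x|" for x
        by (intro card_of_Field_ordIso cardSuc_Card_order card_of_Card_order)
      have "\<exists>d\<in>Field \<nu>. \<forall>b\<in>underS ?r a. |Field (cardSuc |underS \<nu> (fst (g b))| )| \<le>o |underS \<nu> d|"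
        by (rule cardinalities_bounded_of_less_cofinality[OF \<nu> small])
          (rule ordIso_ordLess_trans[OF card bspec[OF lim g(1)]])
      then obtain d2 where d2: "d2 \<in> Field \<nu>"
        "\<forall>b\<in>underS ?r a. |Field (cardSuc |underS \<nu> (fst (g b))| )| \<le>o |underS \<nu> d2|" by (rule bexE)
      obtain e1 where e1: "e1 \<in> Field \<nu>" "underS \<nu> d1 \<subseteq> underS \<nu> e1" "underS \<nu> d2 \<subseteq> underS \<nu> e1"
        using underS_max[OF wo d1(1) d2(1)] by blast
      have aF: "a \<in> Field \<nu>" using True A(1) by blast
      obtain e2 where e2: "e2 \<in> Field \<nu>" "underS \<nu> i \<subseteq> underS \<nu> e2" "underS \<nu> a \<subseteq> underS \<nu> e2"
        using underS_max[OF wo i(1) aF] by blast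
      obtain e where e: "e \<in> Field \<nu>" "underS \<nu> e1 \<subseteq> underS \<nu> e" "underS \<nu> e2 \<subseteq> underS \<nu> e"
        using underS_max[OF wo e1(1) e2(1)] by blast
      obtain B where B: "B \<in> \<B>" "\<not> thin P (cardSuc |underS \<nu> e| ) B" using unb[OF e(1)] by blast
      have "cardSuc |underS \<nu> (fst (g b))| \<le>o |underS \<nu> e| \<and> thin P (cardSuc |underS \<nu> e| ) (snd (g b))"
        if "(b, a) \<in> ?r - Id" for b
      proof
        have b: "b \<in> underS ?r a" using that unfolding underS_def by blast
        have "|underS \<nu> d2| \<le>o |underS \<nu> e|" using e e1 by (intro card_of_mono1) blast
        then show "cardSuc |underS \<nu> (fst (g b))| \<le>o |underS \<nu> e|"
          by (rule ordLeq_transitive[OF ordIso_ordLeq_trans[OF ordIso_symmetric[OF card] bspec[OF d2(2) b]]])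
        show "thin P (cardSuc |underS \<nu> e| ) (snd (g b))"
          by (rule thin_underS_mono[OF bspec[OF d1(2) b]]) (use e e1 in blast)
      qed
      moreover have "infinite (underS \<nu> e)" using i(2) finite_subset[OF subset_trans[OF e2(2) e(3)]] by blast
      moreover have "underS \<nu> a \<subseteq> underS \<nu> e" using e2(3) e(3) by blast
      ultimately have "good g a (e, B)" using e(1) B unfolding good_def by simp
      then show ?thesis by blast
    qed
  qed
  then obtain g where g: "\<And>a. good g a (g a)" by blast
  define c where "c a = fst (g a)" for a
  define B where "B a = snd (g a)" for a
  have c: "c a \<in> Field \<nu>" "infinite (underS \<nu> (c a))" "underS \<nu> a \<subseteq> underS \<nu> (c a)"
    and B: "B a \<in> \<B>" "\<not> thin P (cardSuc |underS \<nu> (c a)| ) (B a)" if "a \<in> A" for a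
    using g[of a] that unfolding good_def c_def B_def by blast+
  have less: "cardSuc |underS \<nu> (c b)| <o cardSuc |underS \<nu> (c a)|"
    and diff: "B a \<noteq> B b" if ab: "a \<in> A" "(b, a) \<in> ?r - Id" for a b
  proof -
    have *: "cardSuc |underS \<nu> (c b)| \<le>o |underS \<nu> (c a)|" "thin P (cardSuc |underS \<nu> (c a)| ) (B b)"
      using g[of a] ab unfolding good_def c_def B_def by blast+
    show "cardSuc |underS \<nu> (c b)| <o cardSuc |underS \<nu> (c a)|"
      by (rule ordLeq_ordLess_trans[OF *(1) cardSuc_greater[OF card_of_Card_order]])
    show "B a \<noteq> B b" using *(2) B(2)[OF ab(1)] by metis
  qed
  have tot: "(b, a) \<in> ?r - Id \<or> (a, b) \<in> ?r - Id" if "a \<in> A" "b \<in> A" "a \<noteq> b" for a b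
    using wor that unfolding order_on_defs total_on_def Field_card_of by blast
  have distinct: "\<not> cardSuc |underS \<nu> (c a)| =o cardSuc |underS \<nu> (c b)|"
    if "a \<in> A" "b \<in> A" "a \<noteq> b" for a b
    using tot[OF that] less[OF that(1)] less[OF that(2)] not_ordLess_ordIso ordIso_symmetric by metis
  have Bdiff: "B a \<noteq> B b" if "a \<in> A" "b \<in> A" "a \<noteq> b" for a b
    using tot[OF that] diff[OF that(1)] diff[OF that(2)] by metis
  have Bne: "B a \<noteq> {}" if "a \<in> A" for a
  proof
    assume "B a = {}"
    moreover have "thin P (cardSuc |underS \<nu> (c a)| ) {}"
      using finite_ordLess_Cinfinite[OF _ Cinfinite_cardSuc[OF Cinfinite_card_of[OF c(2)[OF that]]], of "{} :: 'a set"]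
      unfolding thin_def by simp
    ultimately show False using B(2)[OF that] by simp
  qed
  let ?E = "\<lambda>R a. embeds_into (pairs_poset (cardSuc |underS \<nu> (c a)| )) R (B a)"
  have key: "\<exists>(C :: 'b rel) (\<kappa> :: 'b \<Rightarrow> 'b rel). limit_index_data \<nu> C \<kappa> \<and>
      contains_copy R (lex_sum C (\<lambda>\<alpha>. pairs_poset (cardSuc (\<kappa> \<alpha>))))"
    if R: "R = P \<or> R = P\<inverse>" and cof: "cofinal {a \<in> A. ?E R a} \<nu>" for R
  proof (rule exists_limit_index_data[OF \<nu> lim, where D = "{a \<in> A. ?E R a}" and c = c and B = B])
    show "Partial_order R" using R P by auto
    show "{a \<in> A. ?E R a} \<subseteq> Field \<nu>" using A(1) by blast
    \<comment> \<open>\<open>A\<close> has the least size of a cofinal set, so a cofinal part of it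
      has the same size.\<close>
    have "|{a \<in> A. ?E R a}| \<le>o cofinality \<nu>" unfolding A(3) by (rule card_of_mono1) blast
    moreover have "cofinality \<nu> \<le>o |{a \<in> A. ?E R a}|" using cof A(1) by (intro cofinality_le) auto
    ultimately show "|{a \<in> A. ?E R a}| =o cofinality \<nu>" by (simp add: ordIso_iff_ordLeq)
    show "B a \<subseteq> Field R" if "a \<in> {a \<in> A. ?E R a}" for a
    proof -
      have "B a \<subseteq> Field P" using that by (intro \<B>(1) B(1)) simp
      moreover have "Field R = Field P" using R by auto
      ultimately show ?thesis by simp
    qed
    show "setless R (B a) (B b) \<or> setless R (B b) (B a)"
      if "a \<in> {a \<in> A. ?E R a}" "b \<in> {a \<in> A. ?E R a}" "a \<noteq> b" for a b
    proof -
      have "setless P (B a) (B b) \<or> setless P (B b) (B a)"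
        using that by (intro sep B(1) Bdiff) auto
      then show ?thesis using R by (auto simp: setless_converse)
    qed
  qed (use c Bne distinct cof in auto)
  have PorD: "?E P a \<or> ?E (P\<inverse>) a" if a: "a \<in> A" for a
  proof (rule pairs_poset_embeds_of_not_thin[OF P fac Cinfinite_card_of[OF c(2)[OF a]]])
    show "cardSuc |underS \<nu> (c a)| =o cardSuc |underS \<nu> (c a)|"
      by (rule ordIso_refl[OF cardSuc_Card_order[OF card_of_Card_order]])
    show "B a \<subseteq> Field P" by (rule \<B>(1)[OF B(1)[OF a]])
  qed (rule B(2)[OF a])
  \<comment> \<open>If neither part were cofinal, a single \<open>z\<close> would bound both, and
    hence all of \<open>A\<close>.\<close>
  have "cofinal {a \<in> A. ?E P a} \<nu> \<or> cofinal {a \<in> A. ?E (P\<inverse>) a} \<nu>"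
  proof (rule ccontr)
    assume "\<not> ?thesis"
    then obtain x y where x: "x \<in> Field \<nu>" "\<And>a. a \<in> A \<Longrightarrow> ?E P a \<Longrightarrow> (x, a) \<notin> \<nu> - Id"
      and y: "y \<in> Field \<nu>" "\<And>a. a \<in> A \<Longrightarrow> ?E (P\<inverse>) a \<Longrightarrow> (y, a) \<notin> \<nu> - Id"
      unfolding cofinal_def by blast
    have lin: "trans \<nu>" "antisym \<nu>" using wo by (auto simp: order_on_defs)
    have "(x, x) \<in> \<nu>" "(y, y) \<in> \<nu>" "x = y \<or> (x, y) \<in> \<nu> \<or> (y, x) \<in> \<nu>"
      using wo x(1) y(1) unfolding order_on_defs total_on_def refl_on_def by blast+
    then obtain z where z: "z \<in> Field \<nu>" "(x, z) \<in> \<nu>" "(y, z) \<in> \<nu>" using x(1) y(1) by blast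
    obtain a where a: "a \<in> A" "(z, a) \<in> \<nu> - Id" using A(2) z(1) unfolding cofinal_def by blast
    have "(x, a) \<in> \<nu> - Id" "(y, a) \<in> \<nu> - Id"
      using transD[OF lin(1)] antisymD[OF lin(2)] z a(2) by blast+
    then show False using PorD[OF a(1)] x(2)[OF a(1)] y(2)[OF a(1)] by blast
  qed
  then show ?thesis unfolding Let_def contains_copy_converse[symmetric]
    using key[of P] key[of "P\<inverse>"] by blast
qed

text \<open>If all near classes are thin, they are the blocks themselves. Their cover numbers are
  then cofinal in \<nu>, because a common bound \<open>|underS \<nu> c|\<close> would carry over to
  \<open>T\<close> by \<open>thin_of_thin_near_classes\<close>.\<close>

lemma exists_limit_sum_of_not_thin:
  fixes \<nu> :: "'b rel" and P :: "'a rel"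
  assumes \<nu>: "Cinfinite \<nu>" and nat_less: "natLeq <o \<nu>"
    and lim: "\<forall>c\<in>Field \<nu>. cardSuc |underS \<nu> c| <o \<nu>"
    and P: "Partial_order P" and fac: "no_infinite_antichain P" and nt: "\<not> thin P \<nu> (Field P)"
  shows "\<exists>(C :: 'b rel) (\<kappa> :: 'b \<Rightarrow> 'b rel). limit_index_data \<nu> C \<kappa> \<and>
    (let Q = lex_sum C (\<lambda>\<alpha>. pairs_poset (cardSuc (\<kappa> \<alpha>)))
     in contains_copy P Q \<or> contains_copy P (Q\<inverse>))"
proof -
  note limit_sum = exists_limit_sum_of_blocks[OF \<nu> nat_less lim P fac]
  obtain T where T: "T \<subseteq> Field P" "\<not> thin P \<nu> T"
    and inc: "\<And>x. x \<in> T \<Longrightarrow> thin P \<nu> {y \<in> T. (x, y) \<notin> P \<and> (y, x) \<notin> P}"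
    using subset_with_thin_incomparables[OF P fac _ nt] by blast
  define cls where "cls x = {y \<in> T. near P \<nu> T y x}" for x
  show ?thesis
  proof (cases "\<exists>x\<in>T. \<not> thin P \<nu> (cls x)")
    case True
    then obtain x where x: "x \<in> T" "\<not> thin P \<nu> {y \<in> T. near P \<nu> T y x}" unfolding cls_def by blast
    obtain Q where Q: "Q \<subseteq> T" "upward P \<nu> Q \<or> upward (P\<inverse>) \<nu> Q"
      using upward_in_near_class[OF P \<nu> T(1) inc x] by blast
    have "\<exists>\<B>. (\<forall>B\<in>\<B>. B \<subseteq> Q \<and> thin P \<nu> B) \<and>
      (\<forall>B\<in>\<B>. \<forall>B'\<in>\<B>. B \<noteq> B' \<longrightarrow> setless P B B' \<or> setless P B' B) \<and>
      (\<forall>c\<in>Field \<nu>. \<exists>B\<in>\<B>. \<not> thin P (cardSuc |underS \<nu> c| ) B)"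
      using Q(2)
    proof
      assume "upward P \<nu> Q"
      then show ?thesis by (rule upward_exists_blocks[OF \<nu> nat_less lim P fac])
    next
      assume up: "upward (P\<inverse>) \<nu> Q"
      have "Partial_order (P\<inverse>)" "no_infinite_antichain (P\<inverse>)" using P fac by simp_all
      from upward_exists_blocks[OF \<nu> nat_less lim this up] show ?thesis
        unfolding thin_converse setless_converse by (auto simp: disj_commute)
    qed
    then obtain \<B> where \<B>: "\<forall>B\<in>\<B>. B \<subseteq> Q \<and> thin P \<nu> B"
      "\<forall>B\<in>\<B>. \<forall>B'\<in>\<B>. B \<noteq> B' \<longrightarrow> setless P B B' \<or> setless P B' B"
      "\<forall>c\<in>Field \<nu>. \<exists>B\<in>\<B>. \<not> thin P (cardSuc |underS \<nu> c| ) B" by blast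
    show ?thesis by (rule limit_sum[of \<B>]) (use \<B> Q(1) T(1) in blast)+
  next
    case False
    note near = near_refl[OF P \<nu> T(1) inc] near_sym[OF P \<nu> T(1) inc] near_trans[OF P \<nu> T(1) inc]
    show ?thesis
    proof (rule limit_sum[of "cls ` T"])
      show "B \<subseteq> Field P" "thin P \<nu> B" if "B \<in> cls ` T" for B
        using that False T(1) by (auto simp: cls_def)
      show "setless P B B' \<or> setless P B' B" if "B \<in> cls ` T" "B' \<in> cls ` T" "B \<noteq> B'" for B B'
      proof -
        obtain x y where xy: "x \<in> T" "y \<in> T" "B = cls x" "B' = cls y"
          using \<open>B \<in> cls ` T\<close> \<open>B' \<in> cls ` T\<close> by blast
        have not_near: "\<not> near P \<nu> T x y"
        proof
          assume "near P \<nu> T x y"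
          then have "near P \<nu> T z x \<longleftrightarrow> near P \<nu> T z y" if "z \<in> T" for z
            using near(2,3) xy(1,2) that by blast
          then show False using \<open>B \<noteq> B'\<close> xy unfolding cls_def by blast
        qed
        have less: "setless P (cls x) (cls y)"
          if xy: "x \<in> T" "y \<in> T" "(x, y) \<in> P" "\<not> near P \<nu> T x y" for x y
          unfolding setless_def cls_def
        proof (intro ballI conjI)
          fix u v assume uv: "u \<in> {z \<in> T. near P \<nu> T z x}" "v \<in> {z \<in> T. near P \<nu> T z y}"
          then have n: "near P \<nu> T x u" "near P \<nu> T y v" using near(2) by blast+
          show "(u, v) \<in> P"
            using near_classes_ordered[OF P \<nu> T(1) inc xy(1) _ xy(2) _ xy(3,4) n] uv by blast
          show "u \<noteq> v" using near(3)[of u x y] n uv xy near(2) by blast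
        qed
        have "(x, y) \<in> P \<or> (y, x) \<in> P"
          using incomparable_near[OF P \<nu> T(1) inc] not_near by blast
        then show ?thesis
          using less[of x y] less[of y x] xy not_near near(2) by blast
      qed
      show "\<exists>B\<in>cls ` T. \<not> thin P (cardSuc |underS \<nu> c| ) B" if c: "c \<in> Field \<nu>" for c
      proof (rule ccontr)
        assume "\<not> ?thesis"
        then have "thin P (cardSuc |underS \<nu> c| ) {y \<in> T. near P \<nu> T y x}" if "x \<in> T" for x
          using that unfolding cls_def by blast
        note cls_thin = this
        have "thin P (cardSuc |underS \<nu> c| ) T"
          by (rule thin_of_thin_near_classes[OF P \<nu> T(1) inc card_of_Card_order cls_thin])
        then show False using thin_ordLeq[OF _ ordLess_imp_ordLeq[OF bspec[OF lim c]]] T(2) by blast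
      qed
    qed
  qed
qed

section \<open>Copies force large cover numbers, and the theorem\<close>

lemma not_thin_of_pairs_poset_copy:
  assumes \<kappa>: "Cinfinite \<kappa>" and suc: "\<nu> =o cardSuc \<kappa>" and P: "Partial_order P"
    and emb: "embeds_into (pairs_poset \<nu>) P S"
  shows "\<not> thin P \<nu> S"
proof -
  obtain f where f: "f ` Field (pairs_poset \<nu>) \<subseteq> S"
    "\<forall>x\<in>Field (pairs_poset \<nu>). \<forall>y\<in>Field (pairs_poset \<nu>). (f x, f y) \<in> P \<longleftrightarrow> (x, y) \<in> pairs_poset \<nu>"
    using emb unfolding embeds_into_def by blast
  have "\<not> thin P \<nu> (f ` Field (pairs_poset \<nu>))"
    by (rule not_thin_image_pairs_poset[OF successor_Cinfinite[OF \<kappa> suc] successor_le_cofinality[OF \<kappa> suc]])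
      (use f(2) in blast)
  then show ?thesis using thin_subset[OF _ f(1)] by blast
qed

text \<open>Each summand alone needs at least \<open>cardSuc (\<kappa> \<alpha>)\<close> colours,
  successor cardinals being regular. So the number of colours is an upper bound of the family, and
  therefore at least its supremum \<nu>.\<close>

lemma not_thin_of_limit_sum_copy:
  fixes \<nu> :: "'b rel" and P :: "'a rel" and \<kappa> :: "'b \<Rightarrow> 'b rel"
  assumes \<nu>: "Cinfinite \<nu>" and P: "Partial_order P" and data: "limit_index_data \<nu> C \<kappa>"
    and copy: "contains_copy P (lex_sum C (\<lambda>\<alpha>. pairs_poset (cardSuc (\<kappa> \<alpha>))))"
  shows "\<not> thin P \<nu> (Field P)"
proof
  assume "thin P \<nu> (Field P)"
  then obtain f :: "'a \<Rightarrow> 'a" where f: "|f ` Field P| <o \<nu>"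
    "\<forall>x\<in>Field P. \<forall>y\<in>Field P. f x = f y \<longrightarrow> (x, y) \<in> P \<or> (y, x) \<in> P" unfolding thin_def by blast
  let ?Q = "\<lambda>\<alpha>. pairs_poset (cardSuc (\<kappa> \<alpha>))"
  obtain S G where S: "S \<subseteq> Field P" and G: "iso (lex_sum C ?Q) (Restr P S) G"
    using copy unfolding contains_copy_def by blast
  have card\<kappa>: "Card_order (\<kappa> \<alpha>)" and inf\<kappa>: "Cinfinite (\<kappa> \<alpha>)" if "\<alpha> \<in> Field C" for \<alpha>
    using data that unfolding limit_index_data_def by (auto simp: cinfinite_def cardSuc_finite)
  have le: "cardSuc (\<kappa> \<alpha>) \<le>o |f ` Field P|" if \<alpha>: "\<alpha> \<in> Field C" for \<alpha>
  proof (rule ccontr)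
    assume "\<not> ?thesis"
    then have "|f ` Field P| <o cardSuc (\<kappa> \<alpha>)"
      by (rule iffD1[OF not_ordLeq_iff_ordLess[OF card_of_Well_order cardSuc_Well_order[OF card\<kappa>[OF \<alpha>]]]])
    then have thin: "thin P (cardSuc (\<kappa> \<alpha>)) (Field P)" by (rule thinI) (use f(2) in blast)
    have wo: "Well_order (cardSuc (\<kappa> \<alpha>))" by (rule cardSuc_Well_order[OF card\<kappa>[OF \<alpha>]])
    have refl: "(x, x) \<in> ?Q \<alpha>" if "x \<in> Field (?Q \<alpha>)" for x
      using that wo unfolding Field_pairs_poset[OF wo]
      by (cases x) (auto simp: pairs_poset_def order_on_defs refl_on_def FieldI1 FieldI2)
    have sub: "(\<alpha>, x) \<in> Field (lex_sum C ?Q)" if "x \<in> Field (?Q \<alpha>)" for x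
    proof (rule FieldI1)
      show "((\<alpha>, x), (\<alpha>, x)) \<in> lex_sum C ?Q"
        using that refl[OF that] \<alpha> unfolding lex_sum_def by blast
    qed
    have lex: "((\<alpha>, x), (\<alpha>, y)) \<in> lex_sum C ?Q \<longleftrightarrow> (x, y) \<in> ?Q \<alpha>"
      if "x \<in> Field (?Q \<alpha>)" "y \<in> Field (?Q \<alpha>)" for x y
      using that \<alpha> unfolding lex_sum_def by (cases x; cases y) auto
    have GS: "G p \<in> S" if "p \<in> Field (lex_sum C ?Q)" for p
    proof -
      have "G p \<in> Field (Restr P S)" using G that unfolding iso_iff2 bij_betw_def by blast
      then show ?thesis unfolding Field_def by blast
    qed
    have "embeds_into (?Q \<alpha>) P (Field P)"
      unfolding embeds_into_def
    proof (intro exI[of _ "\<lambda>x. G (\<alpha>, x)"] conjI ballI)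
      show "(\<lambda>x. G (\<alpha>, x)) ` Field (?Q \<alpha>) \<subseteq> Field P" using GS sub S by blast
      fix x y assume xy: "x \<in> Field (?Q \<alpha>)" "y \<in> Field (?Q \<alpha>)"
      have "(G (\<alpha>, x), G (\<alpha>, y)) \<in> Restr P S \<longleftrightarrow> ((\<alpha>, x), (\<alpha>, y)) \<in> lex_sum C ?Q"
        using G sub[OF xy(1)] sub[OF xy(2)] unfolding iso_iff2 by blast
      then show "(G (\<alpha>, x), G (\<alpha>, y)) \<in> P \<longleftrightarrow> (x, y) \<in> ?Q \<alpha>"
        using lex[OF xy] GS[OF sub[OF xy(1)]] GS[OF sub[OF xy(2)]] by blast
    qed
    from not_thin_of_pairs_poset_copy[OF inf\<kappa>[OF \<alpha>] ordIso_refl[OF cardSuc_Card_order[OF card\<kappa>[OF \<alpha>]]] P this]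
    show False using thin by contradiction
  qed
  \<comment> \<open>\<open>is_cardinal_Sup\<close> tests upper bounds on the type of \<nu>, so the
    number of colours is replaced by the size of an initial segment.\<close>
  obtain c where c: "c \<in> Field \<nu>" "|f ` Field P| \<le>o |underS \<nu> c|"
    using ordLess_imp_ordLeq_underS[OF _ f(1)] \<nu> by blast
  have "\<forall>k\<in>(\<lambda>\<alpha>. cardSuc (\<kappa> \<alpha>)) ` Field C. k \<le>o |underS \<nu> c|"
    using ordLeq_transitive[OF le c(2)] by blast
  then have "\<nu> \<le>o |underS \<nu> c|"
    using data card_of_Card_order[of "underS \<nu> c"] unfolding limit_index_data_def is_cardinal_Sup_def
    by simp
  moreover have "|underS \<nu> c| <o \<nu>" using \<nu> c(1) by (simp add: card_of_underS)
  ultimately show False using not_ordLess_ordLeq by blast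
qed

theorem theorem1p1:
  fixes \<nu> :: "'b rel" and P :: "'a rel"
  assumes "Card_order \<nu>" and "uncountable (Field \<nu>)"
    and "Partial_order P" and "no_infinite_antichain P"
  shows
    "(successor_cardinal \<nu> \<longrightarrow>
        (\<nu> \<le>o Cov P \<longleftrightarrow>
           contains_copy P (pairs_poset \<nu>) \<or> contains_copy P ((pairs_poset \<nu>)\<inverse>))) \<and>
     (limit_cardinal \<nu> \<longrightarrow>
        (\<nu> \<le>o Cov P \<longleftrightarrow>
           (\<exists>(C :: 'b rel) (\<kappa> :: 'b \<Rightarrow> 'b rel). limit_index_data \<nu> C \<kappa> \<and>
              (let Q = lex_sum C (\<lambda>\<alpha>. pairs_poset (cardSuc (\<kappa> \<alpha>)))
               in contains_copy P Q \<or> contains_copy P (Q\<inverse>)))))"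
proof (intro conjI impI)
  note \<nu> = assms(1) and P = assms(3) and fac = assms(4)
  have P': "Partial_order (P\<inverse>)" using P by simp
  have inf: "infinite (Field \<nu>)" using assms(2) countable_finite by blast
  then have cinf: "Cinfinite \<nu>" using \<nu> by (simp add: cinfinite_def)
  note Cov = Cov_ge_iff_not_thin[OF P \<nu>]
  {
    assume "successor_cardinal \<nu>"
    then obtain \<kappa> :: "'b rel" where \<kappa>: "Card_order \<kappa>" "\<nu> =o cardSuc \<kappa>"
      unfolding successor_cardinal_def by blast
    \<comment> \<open>A finite \<kappa> would have a finite successor, so \<kappa> is
      infinite.\<close>
    have "|Field \<nu>| =o |Field (cardSuc \<kappa>)|"
      by (rule card_of_cong[OF \<kappa>(2)])
    then have "infinite (Field (cardSuc \<kappa>))" using inf card_of_ordIso_finite by blast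
    then have inf\<kappa>: "Cinfinite \<kappa>" using \<kappa>(1) by (simp add: cinfinite_def cardSuc_finite)
    have anti: "antisym (pairs_poset \<nu>)"
      using \<nu> by (intro antisym_pairs_poset) (auto simp: order_on_defs card_order_on_def)
    have "\<not> thin P \<nu> (Field P) \<longleftrightarrow>
      embeds_into (pairs_poset \<nu>) P (Field P) \<or> embeds_into (pairs_poset \<nu>) (P\<inverse>) (Field P)"
      using pairs_poset_embeds_of_not_thin[OF P fac inf\<kappa> \<kappa>(2) subset_refl]
        not_thin_of_pairs_poset_copy[OF inf\<kappa> \<kappa>(2) P]
        not_thin_of_pairs_poset_copy[OF inf\<kappa> \<kappa>(2) P'] by auto
    then show "\<nu> \<le>o Cov P \<longleftrightarrow>
        contains_copy P (pairs_poset \<nu>) \<or> contains_copy P ((pairs_poset \<nu>)\<inverse>)"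
      using contains_copy_iff_embeds_into[OF P anti] contains_copy_iff_embeds_into[OF P' anti]
      unfolding Cov contains_copy_converse[symmetric] by simp
  next
    assume limit: "limit_cardinal \<nu>"
    \<comment> \<open>The successor of a smaller cardinal is at most \<nu>, and equality would make
      \<nu> a successor.\<close>
    have lim: "\<forall>c\<in>Field \<nu>. cardSuc |underS \<nu> c| <o \<nu>"
    proof
      fix c assume c: "c \<in> Field \<nu>"
      have "cardSuc |underS \<nu> c| \<le>o \<nu>"
        by (rule cardSuc_least[OF card_of_Card_order \<nu> card_of_underS[OF \<nu> c]])
      moreover have "\<not> \<nu> =o cardSuc |underS \<nu> c|"
        using limit \<nu> card_of_Card_order unfolding limit_cardinal_def successor_cardinal_def by blast
      ultimately show "cardSuc |underS \<nu> c| <o \<nu>"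
        using ordLeq_iff_ordLess_or_ordIso ordIso_symmetric by metis
    qed
    \<comment> \<open>Uncountability provides infinite initial segments of \<nu>, from which the
      infinite index cardinals are taken.\<close>
    have nat_less: "natLeq <o \<nu>"
    proof -
      have "\<not> \<nu> \<le>o natLeq"
      proof
        assume "\<nu> \<le>o natLeq"
        then have "|Field \<nu>| \<le>o natLeq" by (rule ordIso_ordLeq_trans[OF card_of_Field_ordIso[OF \<nu>]])
        then have "|Field \<nu>| \<le>o |UNIV :: nat set|"
          by (rule ordLeq_ordIso_trans[OF _ ordIso_symmetric[OF card_of_nat]])
        then obtain f :: "'b \<Rightarrow> nat" where "inj_on f (Field \<nu>)"
          using card_of_ordLeq[of "Field \<nu>" "UNIV :: nat set"] by auto
        then have "countable (Field \<nu>)" by (rule countableI)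
        then show False using assms(2) by contradiction
      qed
      then show ?thesis
        using \<nu> by (intro iffD1[OF not_ordLeq_iff_ordLess[OF natLeq_Well_order]] card_order_on_well_order_on)
    qed
    show "\<nu> \<le>o Cov P \<longleftrightarrow>
           (\<exists>(C :: 'b rel) (\<kappa> :: 'b \<Rightarrow> 'b rel). limit_index_data \<nu> C \<kappa> \<and>
              (let Q = lex_sum C (\<lambda>\<alpha>. pairs_poset (cardSuc (\<kappa> \<alpha>)))
               in contains_copy P Q \<or> contains_copy P (Q\<inverse>)))"
      unfolding Cov
    proof
      assume "\<not> thin P \<nu> (Field P)"
      then show "\<exists>(C :: 'b rel) (\<kappa> :: 'b \<Rightarrow> 'b rel). limit_index_data \<nu> C \<kappa> \<and>
              (let Q = lex_sum C (\<lambda>\<alpha>. pairs_poset (cardSuc (\<kappa> \<alpha>)))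
               in contains_copy P Q \<or> contains_copy P (Q\<inverse>))"
        by (rule exists_limit_sum_of_not_thin[OF cinf nat_less lim P fac])
    next
      assume "\<exists>(C :: 'b rel) (\<kappa> :: 'b \<Rightarrow> 'b rel). limit_index_data \<nu> C \<kappa> \<and>
              (let Q = lex_sum C (\<lambda>\<alpha>. pairs_poset (cardSuc (\<kappa> \<alpha>)))
               in contains_copy P Q \<or> contains_copy P (Q\<inverse>))"
      then show "\<not> thin P \<nu> (Field P)"
        unfolding Let_def contains_copy_converse[symmetric]
        using not_thin_of_limit_sum_copy[OF cinf P] not_thin_of_limit_sum_copy[OF cinf P'] by auto
    qed
  }
qed

end
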